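(* Consider the three-color urn model (white, black, green) with replacement matrix $$R=\begin{pmatrix} sQ & (1-s)\mathbf 1\\ \mathbf 0' & 1\end{pmatrix},$$ where $0<s<1$, $\mathbf 1=(1,1)'$, $\mathbf 0=(0,0)'$, and $Q$ is a $2\times 2$ irreducible aperiodic stochastic matrix with stationary distribution (row vector) $\boldsymbol\pi_Q$. Assume $W_0+B_0>0$. Let $\lambda$ be the non-principal eigenvalue of $Q$ (the one other than $1$) and $\boldsymbol\xi$ a corresponding right eigenvector. Write $\boldsymbol C_n=(W_n,B_n,G_n)$ and $\boldsymbol S_n=(W_n,B_n)$. Then the following hold. (i) $\boldsymbol C_n\mathbf 1/(n+1)=1$ (here $\mathbf 1=(1,1,1)'$). (ii) $\boldsymbol C_n/(n+1)\to(0,0,1)$ almost surely. (iii) $\boldsymbol S_n\mathbf 1/(n+1)^s$ converges almost surely, as well as in $L^2$, to a non-degenerate positive random variable $U$. (iv) $\boldsymbol S_n/(n+1)^s\to \boldsymbol\pi_Q U$ almost surely. (v) If $\lambda<1/2$, then $\boldsymbol S_n\boldsymbol\xi/n^{s/2}\Rightarrow N\left(0,\frac{s^2\lambda^2}{s(1-2\lambda)}U\boldsymbol\pi_Q\boldsymbol\xi^2\right)$. (vi) If $\lambda=1/2$, then $\boldsymbol S_n\boldsymbol\xi/\sqrt{n^s\log n}\Rightarrow N\left(0,s^2\lambda^2U\boldsymbol\pi_Q\boldsymbol\xi^2\right)$. (vii) If $\lambda>1/2$, then $\boldsymbol S_n\boldsymbol\xi/\Pi_n(s\lambda)$ is an $L^2$-bounded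 martingale and, almost surely as well as in $L^2$, $\boldsymbol S_n\boldsymbol\xi/n^{s\lambda}\to V$, where $V$ is a non-degenerate random variable. The random variable $U$ in (iv), (v) and (vi) is the same limiting random variable obtained in (iii). The distributions of $U$ and $V$ depend on the initial value $\boldsymbol S_0$.
   Context: Urn model: there are $K$ colors (here $K=3$). $\boldsymbol C_0$ is a row probability vector (non-negative real coordinates summing to $1$) giving the initial "numbers of balls" of each color, and $R=((r_{ij}))$ is a non-random $K\times K$ stochastic matrix. $\boldsymbol C_n$ is the row vector of the numbers of balls of each color after the $n$-th trial. At the $n$-th trial a ball is drawn at random, so that, given the past, color $i$ appears with probability $\boldsymbol C_{i,n-1}/n$ (the total after $n-1$ trials is $n$); if color $i$ appears, then for every $j$ the number of balls of color $j$ is increased by $r_{ij}$. The filtration $\mathcal F_n$ is the natural filtration of $(\boldsymbol C_n)$; martingales are with respect to it. Notation: $'$ denotes transpose. For a vector $\boldsymbol\xi$, $\boldsymbol\xi^2$ is the vector of squared coordinates. $\Pi_n(\lambda)=\prod_{j=0}^{n-1}\left(1+\frac{\lambda}{j+1}\right)$. $\Rightarrow$ denotes convergence in distribution. For a non-negative random variable $U$ and a constant $c\ge 0$, $N(0,cU)$ denotes the variance mixture of normals, i.e. the law of $\sqrt{cU}\,Z$ with $Z$ standard normal independent of $U$. *)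

theory Defs
  imports "HOL-Probability.Probability"
begin

definition probability_vector :: "real^'k \<Rightarrow> bool" where
  "probability_vector p \<longleftrightarrow> (\<forall>i. 0 \<le> p $ i) \<and> (\<Sum>i\<in>UNIV. p $ i) = 1"

definition stochastic_matrix :: "real^'k^'k \<Rightarrow> bool" where
  "stochastic_matrix A \<longleftrightarrow> (\<forall>i. probability_vector (row i A))"

text \<open>Powers for the matrix product; the \<open>^\<close> of the class \<open>power\<close> is componentwise on vectors.\<close>

primrec matrix_power :: "real^'k^'k \<Rightarrow> nat \<Rightarrow> real^'k^'k" where
  "matrix_power A 0 = mat 1"
| "matrix_power A (Suc n) = A ** matrix_power A n"

definition irreducible_matrix :: "real^'k^'k \<Rightarrow> bool" where
  "irreducible_matrix A \<longleftrightarrow> (\<forall>i j. \<exists>n>0. 0 < matrix_power A n $ i $ j)"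

definition aperiodic_matrix :: "real^'k^'k \<Rightarrow> bool" where
  "aperiodic_matrix A \<longleftrightarrow> (\<forall>i. Gcd {n::nat. 0 < n \<and> 0 < matrix_power A n $ i $ i} = 1)"

definition stationary_distribution :: "real^'k^'k \<Rightarrow> real^'k \<Rightarrow> bool" where
  "stationary_distribution A p \<longleftrightarrow> probability_vector p \<and> p v* A = p"

definition right_eigenvector :: "real^'k^'k \<Rightarrow> real \<Rightarrow> real^'k \<Rightarrow> bool" where
  "right_eigenvector A l x \<longleftrightarrow> x \<noteq> 0 \<and> A *v x = l *\<^sub>R x"

definition natural_filtration ::
  "'a measure \<Rightarrow> (nat \<Rightarrow> 'a \<Rightarrow> 'b::topological_space) \<Rightarrow> nat \<Rightarrow> 'a measure" where
  "natural_filtration M X n =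
     sigma (space M) (\<Union>k\<in>{..n}. {X k -` A \<inter> space M | A. A \<in> sets borel})"

definition martingale :: "'a measure \<Rightarrow> (nat \<Rightarrow> 'a measure) \<Rightarrow> (nat \<Rightarrow> 'a \<Rightarrow> real) \<Rightarrow> bool" where
  "martingale M F X \<longleftrightarrow>
     (\<forall>n. X n \<in> borel_measurable (F n) \<and> integrable M (X n) \<and>
          (AE \<omega> in M. real_cond_exp M (F n) (X (Suc n)) \<omega> = X n \<omega>))"

definition square_integrable :: "'a measure \<Rightarrow> ('a \<Rightarrow> real) \<Rightarrow> bool" where
  "square_integrable M X \<longleftrightarrow> X \<in> borel_measurable M \<and> integrable M (\<lambda>\<omega>. (X \<omega>)\<^sup>2)"

definition L2_bounded :: "'a measure \<Rightarrow> (nat \<Rightarrow> 'a \<Rightarrow> real) \<Rightarrow> bool" where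
  "L2_bounded M X \<longleftrightarrow>
     (\<forall>n. square_integrable M (X n)) \<and> (\<exists>B. \<forall>n. (\<integral>\<omega>. (X n \<omega>)\<^sup>2 \<partial>M) \<le> B)"

definition converges_in_L2 :: "'a measure \<Rightarrow> (nat \<Rightarrow> 'a \<Rightarrow> real) \<Rightarrow> ('a \<Rightarrow> real) \<Rightarrow> bool" where
  "converges_in_L2 M X Y \<longleftrightarrow>
     (\<forall>n. square_integrable M (X n)) \<and> square_integrable M Y \<and>
     (\<lambda>n. \<integral>\<omega>. (X n \<omega> - Y \<omega>)\<^sup>2 \<partial>M) \<longlonglongrightarrow> 0"

definition converges_in_distribution ::
  "'a measure \<Rightarrow> (nat \<Rightarrow> 'a \<Rightarrow> real) \<Rightarrow> real measure \<Rightarrow> bool" where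
  "converges_in_distribution M X \<mu> \<longleftrightarrow> weak_conv_m (\<lambda>n. distr M borel (X n)) \<mu>"

definition nondegenerate :: "'a measure \<Rightarrow> ('a \<Rightarrow> real) \<Rightarrow> bool" where
  "nondegenerate M X \<longleftrightarrow> \<not> (\<exists>c. AE \<omega> in M. X \<omega> = c)"

text \<open>For a random variable \<open>U \<ge> 0\<close> and \<open>c \<ge> 0\<close>: the law of \<open>sqrt (c U) Z\<close>, where \<open>Z\<close> is standard
  normal and independent of \<open>U\<close> (hence the product of the law of \<open>U\<close> with that of \<open>Z\<close>).\<close>

definition normal_variance_mixture :: "'a measure \<Rightarrow> real \<Rightarrow> ('a \<Rightarrow> real) \<Rightarrow> real measure" where
  "normal_variance_mixture M c U =
     distr (distr M borel U \<Otimes>\<^sub>M std_normal_distribution) borel (\<lambda>(u, z). sqrt (c * u) * z)"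

text \<open>The total content before trial \<open>n + 1\<close> is \<open>n + 1\<close>, and \<open>draw (n + 1)\<close> is the colour drawn in
  that trial. The past is the natural filtration of the urn content. Conditioning on the past draws
  as well would be a stronger requirement, by the tower property.\<close>

locale urn_process = prob_space M for M :: "'a measure" +
  fixes R :: "real^'k^'k" and c\<^sub>0 :: "real^'k"
    and draw :: "nat \<Rightarrow> 'a \<Rightarrow> 'k" and C :: "nat \<Rightarrow> 'a \<Rightarrow> real^'k"
  assumes stochastic: "stochastic_matrix R"
    and initial: "probability_vector c\<^sub>0"
    and draw_measurable: "\<And>n. draw (Suc n) \<in> M \<rightarrow>\<^sub>M count_space UNIV"
    and C_0: "\<And>\<omega>. \<omega> \<in> space M \<Longrightarrow> C 0 \<omega> = c\<^sub>0"
    and C_Suc: "\<And>n \<omega>. \<omega> \<in> space M \<Longrightarrow> C (Suc n) \<omega> = C n \<omega> + row (draw (Suc n) \<omega>) R"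
    and draw_prob: "\<And>n i. AE \<omega> in M.
      real_cond_exp M (natural_filtration M C n) (indicator {\<omega> \<in> space M. draw (Suc n) \<omega> = i}) \<omega>
        = C n \<omega> $ i / real (Suc n)"

text \<open>Colours are numbered \<open>1\<close> (white), \<open>2\<close> (black), \<open>3\<close> (green).\<close>

definition triangular_matrix :: "real \<Rightarrow> real^2^2 \<Rightarrow> real^3^3" where
  "triangular_matrix s Q =
     vector [vector [s * Q $ 1 $ 1, s * Q $ 1 $ 2, 1 - s],
             vector [s * Q $ 2 $ 1, s * Q $ 2 $ 2, 1 - s],
             vector [0, 0, 1]]"

definition nongreen :: "real^3 \<Rightarrow> real^2" where
  "nongreen c = vector [c $ 1, c $ 2]"

definition Pi_prod :: "nat \<Rightarrow> real \<Rightarrow> real" where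
  "Pi_prod n l = (\<Prod>j<n. 1 + l / real (j + 1))"

end

theory Submission
  imports Defs "HOL-Real_Asymp.Real_Asymp"
begin

text \<open>
  Let \<open>S n\<close> be the white and black content and \<open>\<eta>\<close> a right eigenvector of \<open>Q\<close> with eigenvalue \<open>\<mu>\<close>. In
  the mean a draw multiplies \<open>X n = S n \<bullet> \<eta>\<close> by \<open>1 + s \<mu> / (n + 1)\<close>, so \<open>X n / \<Pi>\<^sub>n(s \<mu>)\<close> is a martingale,
  and \<open>\<Pi>\<^sub>n(s \<mu>)\<close> is asymptotic to \<open>n\<close> to the power \<open>s \<mu>\<close> divided by \<open>\<Gamma>(1 + s \<mu>)\<close>. The mass \<open>T n = S n \<bullet> 1\<close> is
  the case \<open>\<mu> = 1\<close>. The conditional variance of the increment is at most a multiple of \<open>T n / (n + 1)\<close>, whose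
  mean has order \<open>n\<close> to the power \<open>s - 1\<close>; after normalisation it is summable exactly for \<open>\<mu> > 1/2\<close>. Martingales
  bounded in mean square converge, almost surely and in mean square (\<open>L2_bounded_converges\<close>), and this yields both
  the limit \<open>U\<close> of the mass and, for \<open>l > 1/2\<close>, the limit \<open>V\<close> (\<open>eigenvector_functional_limit\<close>). The limits
  are not constant because the second draw is already random given the past, and their laws depend on the
  initial content because their means do; a second urn on which this can be observed is
  built from independent uniform random numbers (\<open>urn_process_exists\<close>).

  That \<open>U\<close> does not vanish follows from an exact negative moment: suitable quotients of Gamma
  functions of \<open>T / s\<close> are again multiplied by a deterministic factor in the mean
  (\<open>mass_limit_positive\<close>). For the eigenvalue \<open>l < 1\<close>, the quotient \<open>X n / \<Pi>\<^sub>n(s)\<close> tends to \<open>0\<close> by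
  Kronecker's lemma (\<open>X_negligible_AE\<close>); as the stationary distribution is orthogonal to \<open>\<xi>\<close>, this fixes the
  direction of \<open>S n\<close>, and the remaining content is green.

  For \<open>l \<le> 1/2\<close> the characteristic function of \<open>X n\<close> is followed backwards in time
  (\<open>characteristic_function_limit\<close>). The exponential \<open>exp (\<i> \<alpha> X - \<beta> T)\<close> evolves under one draw into another
  one of this form, up to small errors: the real exponent collects the conditional variances, which are
  proportional to the mass since \<open>X\<close> is negligible against \<open>T\<close>. Starting from \<open>\<beta> = 0\<close> at time \<open>n\<close> and stopping
  at a fixed time \<open>m\<close> leaves, as \<open>n\<close> grows, \<open>E exp (- \<beta> T m)\<close>, where \<open>T m / \<Pi>\<^sub>m(s)\<close> is close to a multiple of \<open>U\<close>. All factors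
  have modulus at most \<open>1\<close>, so the errors may simply be added in expectation, and the limit is the
  characteristic function of a normal law with random variance. The sum of the conditional variances is
  evaluated by the Stolz--Cesaro theorem; it produces the factor \<open>1 / (s (1 - 2 l))\<close> for \<open>l < 1/2\<close> and a logarithm
  for \<open>l = 1/2\<close>.
\<close>

section \<open>Averaging and asymptotics of real sequences\<close>

text \<open>Stolz--Cesaro: once the quotients of the increments are within \<open>e\<close> of \<open>L\<close>, so is every
  weighted average of them, and the initial segment is negligible because \<open>a\<close> diverges.\<close>

lemma stolz_cesaro:
  fixes x a :: "nat \<Rightarrow> real"
  assumes inc: "\<And>n. a n < a (Suc n)" and div: "filterlim a at_top sequentially"
    and lim: "(\<lambda>n. (x (Suc n) - x n) / (a (Suc n) - a n)) \<longlonglongrightarrow> L"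
  shows "(\<lambda>n. x n / a n) \<longlonglongrightarrow> L"
proof (rule LIMSEQ_I)
  fix e :: real assume e: "0 < e"
  from LIMSEQ_D[OF lim, of "e / 2"] e obtain m where
    m: "\<And>n. n \<ge> m \<Longrightarrow> \<bar>(x (Suc n) - x n) / (a (Suc n) - a n) - L\<bar> < e / 2" by auto
  have incr: "\<bar>x (Suc n) - x n - L * (a (Suc n) - a n)\<bar> \<le> e / 2 * (a (Suc n) - a n)" if "n \<ge> m" for n
  proof -
    have p: "a (Suc n) - a n > 0" using inc[of n] by simp
    have "x (Suc n) - x n - L * (a (Suc n) - a n)
        = ((x (Suc n) - x n) / (a (Suc n) - a n) - L) * (a (Suc n) - a n)"
      using p by (simp add: field_simps)
    then have "\<bar>x (Suc n) - x n - L * (a (Suc n) - a n)\<bar>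
        = \<bar>(x (Suc n) - x n) / (a (Suc n) - a n) - L\<bar> * (a (Suc n) - a n)"
      using p by (simp add: abs_mult)
    also have "\<dots> \<le> e / 2 * (a (Suc n) - a n)"
      using m[OF that] p by (intro mult_right_mono) auto
    finally show ?thesis .
  qed
  have seg: "\<bar>x n - x m - L * (a n - a m)\<bar> \<le> e / 2 * (a n - a m)" if "n \<ge> m" for n
    using that
  proof (induction n rule: dec_induct)
    case (step n)
    have "x (Suc n) - x m - L * (a (Suc n) - a m)
        = (x n - x m - L * (a n - a m)) + (x (Suc n) - x n - L * (a (Suc n) - a n))"
      by (simp add: algebra_simps)
    then have "\<bar>x (Suc n) - x m - L * (a (Suc n) - a m)\<bar>
        \<le> \<bar>x n - x m - L * (a n - a m)\<bar> + \<bar>x (Suc n) - x n - L * (a (Suc n) - a n)\<bar>"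
      by (metis abs_triangle_ineq)
    also have "\<dots> \<le> e / 2 * (a n - a m) + e / 2 * (a (Suc n) - a n)"
      using step.IH incr[OF step.hyps(1)] by (rule add_mono)
    also have "\<dots> = e / 2 * (a (Suc n) - a m)" by (simp add: field_simps)
    finally show ?case .
  qed simp
  define K where "K = \<bar>x m - L * a m\<bar> + e * \<bar>a m\<bar>"
  have "eventually (\<lambda>n. a n > 2 * K / e + 1) sequentially"
    using div by (simp add: filterlim_at_top_dense)
  then obtain N where N: "\<And>n. n \<ge> N \<Longrightarrow> a n > 2 * K / e + 1"
    by (auto simp: eventually_sequentially)
  have "K \<ge> 0" using e by (simp add: K_def)
  show "\<exists>no. \<forall>n\<ge>no. norm (x n / a n - L) < e"
  proof (intro exI allI impI)
    fix n assume n: "n \<ge> max m N"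
    have an: "a n > 2 * K / e + 1" using N n by simp
    have pos: "a n > 0" using an \<open>K \<ge> 0\<close> e
      by (smt (verit) divide_nonneg_pos)
    have "\<bar>x n - L * a n\<bar> \<le> \<bar>x n - x m - L * (a n - a m)\<bar> + \<bar>x m - L * a m\<bar>"
      by (simp add: algebra_simps)
    also have "\<dots> \<le> e / 2 * (a n - a m) + \<bar>x m - L * a m\<bar>" using seg[of n] n by simp
    also have "\<dots> \<le> e / 2 * a n + K"
    proof -
      have "e * - a m \<le> e * \<bar>a m\<bar>" using e by (intro mult_left_mono) auto
      moreover have "0 \<le> e * \<bar>a m\<bar>" using e by simp
      ultimately have "e / 2 * (- a m) \<le> e * \<bar>a m\<bar>" by simp
      then show ?thesis by (simp add: K_def right_diff_distrib)
    qed
    also have "\<dots> < e * a n"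
    proof -
      have "K < e / 2 * a n" using an e by (simp add: field_simps)
      then show ?thesis by simp
    qed
    finally have "\<bar>x n - L * a n\<bar> < e * a n" .
    moreover have "x n / a n - L = (x n - L * a n) / a n" using pos by (simp add: field_simps)
    ultimately show "norm (x n / a n - L) < e" using pos by (simp add: abs_divide field_simps)
  qed
qed

text \<open>Kronecker's lemma. If \<open>B\<close> are the partial sums of the convergent series and \<open>b\<close> is its sum,
  Abel summation gives \<open>z (Suc n) - z n = \<Delta>(a (B - b)) - (\<Delta>a) (B - b)\<close>, and the last term averages
  to \<open>0\<close> by Stolz--Cesaro.\<close>

lemma kronecker_lemma:
  fixes z a :: "nat \<Rightarrow> real"
  assumes inc: "\<And>n. a n < a (Suc n)" and div: "filterlim a at_top sequentially"
    and pos: "\<And>n. a n > 0"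
    and conv: "convergent (\<lambda>n. \<Sum>k<n. (z (Suc k) - z k) / a (Suc k))"
  shows "(\<lambda>n. z n / a n) \<longlonglongrightarrow> 0"
proof -
  define B where "B n = (\<Sum>k<n. (z (Suc k) - z k) / a (Suc k))" for n
  obtain b where b: "B \<longlonglongrightarrow> b" using conv unfolding convergent_def B_def by blast
  define w where "w n = z n - a n * (B n - b)" for n
  have "(w (Suc n) - w n) / (a (Suc n) - a n) = - (B n - b)" for n
  proof -
    have "B (Suc n) = B n + (z (Suc n) - z n) / a (Suc n)" by (simp add: B_def)
    then have "a (Suc n) * B (Suc n) = a (Suc n) * B n + (z (Suc n) - z n)"
      using pos[of "Suc n"] by (simp add: field_simps)
    then have "w (Suc n) - w n = (a (Suc n) - a n) * (- (B n - b))"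
      by (simp add: w_def algebra_simps)
    then show ?thesis using inc[of n] by simp
  qed
  moreover have "(\<lambda>n. - (B n - b)) \<longlonglongrightarrow> 0" using b by (auto intro!: tendsto_eq_intros)
  ultimately have "(\<lambda>n. w n / a n) \<longlonglongrightarrow> 0"
    by (intro stolz_cesaro[OF inc div]) simp
  moreover have "(\<lambda>n. B n - b) \<longlonglongrightarrow> 0" using b by (auto intro!: tendsto_eq_intros)
  ultimately have "(\<lambda>n. w n / a n + (B n - b)) \<longlonglongrightarrow> 0 + 0" by (rule tendsto_add)
  moreover have "w n / a n + (B n - b) = z n / a n" for n
    using pos[of n] by (simp add: w_def field_simps)
  ultimately show ?thesis by simp
qed

lemma Pi_prod_0 [simp]: "Pi_prod 0 c = 1"
  by (simp add: Pi_prod_def)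

lemma Pi_prod_Suc: "Pi_prod (Suc n) c = Pi_prod n c * (1 + c / real (Suc n))"
  by (simp add: Pi_prod_def add.commute)

lemma Pi_factor_pos: "c > - 1 \<Longrightarrow> 1 + c / real (Suc n) > 0"
  by (simp add: field_simps add_pos_nonneg)

lemma Pi_prod_pos: "c > - 1 \<Longrightarrow> Pi_prod n c > 0"
  by (induction n) (simp_all add: Pi_prod_Suc Pi_factor_pos del: of_nat_Suc)

lemma Pi_prod_ge_1: "c \<ge> 0 \<Longrightarrow> Pi_prod n c \<ge> 1"
  unfolding Pi_prod_def by (intro prod_ge_1) auto

lemma Pi_prod_mono: "0 \<le> c \<Longrightarrow> m \<le> n \<Longrightarrow> Pi_prod m c \<le> Pi_prod n c"
proof (rule lift_Suc_mono_le[of "\<lambda>n. Pi_prod n c"])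
  fix n assume "0 \<le> c"
  then show "Pi_prod n c \<le> Pi_prod (Suc n) c"
    using mult_left_mono[of 1 "1 + c / real (Suc n)" "Pi_prod n c"] Pi_prod_pos[of c n]
    by (simp add: Pi_prod_Suc)
qed

lemma Pi_prod_antimono: "- 1 < c \<Longrightarrow> c \<le> 0 \<Longrightarrow> m \<le> n \<Longrightarrow> Pi_prod n c \<le> Pi_prod m c"
proof (rule lift_Suc_antimono_le[of "\<lambda>n. Pi_prod n c"])
  fix n assume "- 1 < c" "c \<le> 0"
  then show "Pi_prod (Suc n) c \<le> Pi_prod n c"
    using mult_left_mono[of "1 + c / real (Suc n)" 1 "Pi_prod n c"] Pi_prod_pos[of c n]
    by (simp add: Pi_prod_Suc divide_nonpos_pos)
qed

text \<open>Euler's limit formula: \<open>Pi_prod n c = (1 + c)(2 + c)\<cdots>(n + c) / n!\<close> is the generalised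
  binomial coefficient \<open>(c + n choose n)\<close>.\<close>

lemma Pi_prod_asymptotic:
  assumes "c > - 1"
  shows "(\<lambda>n. Pi_prod n c / real n powr c) \<longlonglongrightarrow> 1 / Gamma (1 + c)"
proof -
  have "(\<lambda>n. Pi_prod n c / exp (c * ln (real n))) \<longlonglongrightarrow> rGamma (c + 1)"
  proof -
    have "Pi_prod n c = (c + of_nat n gchoose n)" for n
      unfolding gbinomial_prod_rev Pi_prod_def
    proof -
      have "(\<Prod>j<n. 1 + c / real (j + 1)) = (\<Prod>j<n. (c + real (j + 1)) / real (j + 1))"
        by (intro prod.cong refl) (simp add: field_simps)
      also have "\<dots> = (\<Prod>j<n. c + real (j + 1)) / fact n"
        by (simp add: prod_dividef fact_prod_Suc lessThan_atLeast0)
      also have "(\<Prod>j<n. c + real (j + 1)) = (\<Prod>i<n. c + real n - real i)"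
        by (subst prod.nat_diff_reindex[symmetric]) (intro prod.cong refl, auto simp: of_nat_diff)
      finally show "(\<Prod>j<n. 1 + c / real (j + 1)) = (\<Prod>i = 0..<n. c + real n - real i) / fact n"
        by (simp add: lessThan_atLeast0)
    qed
    then show ?thesis using Gamma_gbinomial[of c] by (simp add: exp_minus divide_inverse)
  qed
  moreover have "eventually (\<lambda>n. Pi_prod n c / exp (c * ln (real n)) = Pi_prod n c / real n powr c) sequentially"
    using eventually_gt_at_top[of 0] by eventually_elim (simp add: powr_def)
  ultimately have "(\<lambda>n. Pi_prod n c / real n powr c) \<longlonglongrightarrow> rGamma (c + 1)"
    by (rule Lim_transform_eventually)
  then show ?thesis by (simp add: rGamma_inverse_Gamma inverse_eq_divide add.commute)
qed

lemma Gamma_pos: "c > - 1 \<Longrightarrow> Gamma (1 + c :: real) > 0"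
  by (rule Gamma_real_pos) simp

lemma powr_Suc_ratio: "(\<lambda>n. real (n + 1) powr c / real n powr c) \<longlonglongrightarrow> 1"
  by real_asymp

lemma Pi_prod_asymptotic_Suc:
  assumes "c > - 1"
  shows "(\<lambda>n. Pi_prod n c / real (n + 1) powr c) \<longlonglongrightarrow> 1 / Gamma (1 + c)"
proof -
  have "(\<lambda>n. (Pi_prod n c / real n powr c) / (real (n + 1) powr c / real n powr c))
      \<longlonglongrightarrow> (1 / Gamma (1 + c)) / 1"
    by (intro tendsto_divide Pi_prod_asymptotic assms powr_Suc_ratio) auto
  moreover have "eventually (\<lambda>n. (Pi_prod n c / real n powr c) / (real (n + 1) powr c / real n powr c)
      = Pi_prod n c / real (n + 1) powr c) sequentially"
    using eventually_gt_at_top[of 0] by eventually_elim auto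
  ultimately have "(\<lambda>n. Pi_prod n c / real (n + 1) powr c) \<longlonglongrightarrow> (1 / Gamma (1 + c)) / 1"
    by (rule Lim_transform_eventually)
  then show ?thesis by simp
qed

lemma Pi_prod_bounds:
  assumes c: "c > - 1"
  obtains a b where "a > 0" "b > 0" "\<And>n. a * real (n + 1) powr c \<le> Pi_prod n c"
    "\<And>n. Pi_prod n c \<le> b * real (n + 1) powr c"
proof -
  let ?q = "\<lambda>n. Pi_prod n c / real (n + 1) powr c"
  have qpos: "?q n > 0" for n using Pi_prod_pos[OF c] by simp
  have "?q \<longlonglongrightarrow> 1 / Gamma (1 + c)" by (rule Pi_prod_asymptotic_Suc[OF c])
  moreover from this have "(\<lambda>n. inverse (?q n)) \<longlonglongrightarrow> inverse (1 / Gamma (1 + c))"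
    using Gamma_pos[OF c] by (intro tendsto_inverse) auto
  ultimately have "Bseq ?q" and "Bseq (\<lambda>n. inverse (?q n))"
    by (blast intro: convergent_imp_Bseq convergentI)+
  then obtain b d where b: "b > 0" "\<And>n. \<bar>?q n\<bar> \<le> b" and d: "d > 0" "\<And>n. \<bar>inverse (?q n)\<bar> \<le> d"
    by (auto simp: Bseq_def)
  show ?thesis
  proof (rule that[of "1 / d" b])
    fix n
    have p: "real (n + 1) powr c > 0" by simp
    show "Pi_prod n c \<le> b * real (n + 1) powr c"
      using b(2)[of n] p qpos[of n] by (simp add: field_simps)
    show "1 / d * real (n + 1) powr c \<le> Pi_prod n c"
      using d(2)[of n] d(1) p Pi_prod_pos[OF c, of n] by (simp add: field_simps)
  qed (use b d in auto)
qed

lemma summable_tail_small: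
  fixes g :: "nat \<Rightarrow> real"
  assumes "summable g" "0 < e"
  obtains m where "\<And>k n. m \<le> k \<Longrightarrow> (\<Sum>j=k..<n. g j) < e"
proof -
  obtain N where "\<And>m n. N \<le> m \<Longrightarrow> norm (sum g {m..<n}) < e"
    using assms unfolding summable_Cauchy by blast
  then show ?thesis using that[of N] by (force intro: order_le_less_trans[OF abs_ge_self])
qed

section \<open>Square-integrable martingales\<close>

lemma square_integrable_integrable:
  assumes "prob_space M" "square_integrable M X" shows "integrable M X"
proof -
  interpret prob_space M by fact
  show ?thesis
    by (rule square_integrable_imp_integrable) (use assms(2) in \<open>auto simp: square_integrable_def\<close>)
qed

lemma square_integrable_mult:
  assumes "square_integrable M X" "square_integrable M Y"
  shows "integrable M (\<lambda>\<omega>. X \<omega> * Y \<omega>)"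
proof (rule Bochner_Integration.integrable_bound)
  show "integrable M (\<lambda>\<omega>. (X \<omega>)\<^sup>2 + (Y \<omega>)\<^sup>2)"
    and "(\<lambda>\<omega>. X \<omega> * Y \<omega>) \<in> borel_measurable M"
    using assms by (auto simp: square_integrable_def)
  have "\<bar>x * y\<bar> \<le> x\<^sup>2 + y\<^sup>2" for x y :: real
  proof -
    have "2 * \<bar>x * y\<bar> \<le> x\<^sup>2 + y\<^sup>2" using sum_squares_bound[of "\<bar>x\<bar>" "\<bar>y\<bar>"] by (simp add: abs_mult)
    then show ?thesis using abs_ge_zero[of "x * y"] by linarith
  qed
  then show "AE \<omega> in M. norm (X \<omega> * Y \<omega>) \<le> norm ((X \<omega>)\<^sup>2 + (Y \<omega>)\<^sup>2)" by simp
qed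

lemma square_integrable_add:
  assumes "square_integrable M X" "square_integrable M Y"
  shows "square_integrable M (\<lambda>\<omega>. X \<omega> + Y \<omega>)"
  using assms square_integrable_mult[OF assms]
  by (auto simp: square_integrable_def power2_sum mult.assoc)

lemma square_integrable_cmult:
  assumes "square_integrable M X" shows "square_integrable M (\<lambda>\<omega>. c * X \<omega>)"
  using assms by (auto simp: square_integrable_def power_mult_distrib)

lemma square_integrable_diff:
  assumes "square_integrable M X" "square_integrable M Y"
  shows "square_integrable M (\<lambda>\<omega>. X \<omega> - Y \<omega>)"
  using square_integrable_add[OF assms(1) square_integrable_cmult[OF assms(2), of "- 1"]] by simp

lemma square_integrable_sum:
  assumes "prob_space M" "\<And>i. i \<in> I \<Longrightarrow> square_integrable M (X i)"
  shows "square_integrable M (\<lambda>\<omega>. \<Sum>i\<in>I. X i \<omega>)"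
proof -
  interpret prob_space M by fact
  have "square_integrable M (\<lambda>\<omega>. 0)" by (simp add: square_integrable_def)
  then show ?thesis using assms(2)
    by (induction I rule: infinite_finite_induct) (auto intro: square_integrable_add)
qed

lemma square_integrable_indicator_mult:
  assumes "square_integrable M X" "A \<in> sets M"
  shows "square_integrable M (\<lambda>\<omega>. indicator A \<omega> * X \<omega>)"
proof -
  have "(\<lambda>\<omega>. (indicator A \<omega> * X \<omega>)\<^sup>2) = (\<lambda>\<omega>. indicator A \<omega> * (X \<omega>)\<^sup>2)"
    by (auto simp: indicator_def)
  then show ?thesis
    using assms integrable_mult_indicator[of A M "\<lambda>\<omega>. (X \<omega>)\<^sup>2"] by (auto simp: square_integrable_def)
qed

locale L2_martingale = prob_space M for M :: "'a measure" +
  fixes F :: "nat \<Rightarrow> 'a measure" and X :: "nat \<Rightarrow> 'a \<Rightarrow> real"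
  assumes subalg: "\<And>n. subalgebra M (F n)"
    and filt: "\<And>m n. m \<le> n \<Longrightarrow> sets (F m) \<subseteq> sets (F n)"
    and mart: "martingale M F X"
    and sq: "\<And>n. square_integrable M (X n)"
begin

lemma measurable_F_mono:
  assumes "m \<le> n" "Y \<in> borel_measurable (F m)" shows "Y \<in> borel_measurable (F n)"
proof -
  have "space (F m) = space (F n)" using subalg by (simp add: subalgebra_def)
  then have "subalgebra (F n) (F m)" using filt[OF assms(1)] by (simp add: subalgebra_def)
  then show ?thesis using assms(2) by (rule measurable_from_subalg)
qed

lemma X_meas: "X n \<in> borel_measurable (F n)"
  using mart by (simp add: martingale_def)

lemma integral_mult_Suc:
  assumes Y: "Y \<in> borel_measurable (F n)" "square_integrable M Y"
  shows "(\<integral>\<omega>. Y \<omega> * X (Suc n) \<omega> \<partial>M) = (\<integral>\<omega>. Y \<omega> * X n \<omega> \<partial>M)"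
proof -
  interpret finite_measure_subalgebra M "F n" by unfold_locales (rule subalg)
  have [measurable]: "Y \<in> borel_measurable M" "X (Suc n) \<in> borel_measurable M" "X n \<in> borel_measurable M"
    using Y sq by (simp_all add: square_integrable_def)
  have "(\<integral>\<omega>. Y \<omega> * X (Suc n) \<omega> \<partial>M) = (\<integral>\<omega>. Y \<omega> * real_cond_exp M (F n) (X (Suc n)) \<omega> \<partial>M)"
    by (intro real_cond_exp_intg(2)[symmetric] square_integrable_mult Y sq) simp
  also have "\<dots> = (\<integral>\<omega>. Y \<omega> * X n \<omega> \<partial>M)"
    using mart by (intro integral_cong_AE) (auto simp: martingale_def)
  finally show ?thesis .
qed

lemma integral_mult_later:
  assumes "m \<le> n" and Y: "Y \<in> borel_measurable (F m)" "square_integrable M Y"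
  shows "(\<integral>\<omega>. Y \<omega> * X n \<omega> \<partial>M) = (\<integral>\<omega>. Y \<omega> * X m \<omega> \<partial>M)"
  using assms(1)
proof (induction n rule: dec_induct)
  case (step n)
  then show ?case using integral_mult_Suc[OF measurable_F_mono[OF _ Y(1)] Y(2), of n] by simp
qed simp

lemma expectation_eq: "expectation (X n) = expectation (X 0)"
  using integral_mult_later[of 0 n "\<lambda>_. 1"] by (simp add: square_integrable_def)

lemma second_moment_increment:
  assumes "m \<le> n"
  shows "(\<integral>\<omega>. (X n \<omega> - X m \<omega>)\<^sup>2 \<partial>M) = (\<integral>\<omega>. (X n \<omega>)\<^sup>2 \<partial>M) - (\<integral>\<omega>. (X m \<omega>)\<^sup>2 \<partial>M)"
proof -
  note int = square_integrable_mult[OF sq sq]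
  have "(\<integral>\<omega>. (X n \<omega> - X m \<omega>)\<^sup>2 \<partial>M) = (\<integral>\<omega>. X n \<omega> * X n \<omega> + X m \<omega> * X m \<omega> - 2 * (X m \<omega> * X n \<omega>) \<partial>M)"
    by (intro Bochner_Integration.integral_cong) (auto simp: power2_eq_square algebra_simps)
  also have "\<dots> = (\<integral>\<omega>. X n \<omega> * X n \<omega> \<partial>M) + (\<integral>\<omega>. X m \<omega> * X m \<omega> \<partial>M) - 2 * (\<integral>\<omega>. X m \<omega> * X n \<omega> \<partial>M)"
    using int by simp
  finally show ?thesis
    using integral_mult_later[OF assms X_meas sq] by (simp add: power2_eq_square)
qed

lemma second_moment_mono: "m \<le> n \<Longrightarrow> (\<integral>\<omega>. (X m \<omega>)\<^sup>2 \<partial>M) \<le> (\<integral>\<omega>. (X n \<omega>)\<^sup>2 \<partial>M)"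
  using second_moment_increment[of m n] Bochner_Integration.integral_nonneg[of M "\<lambda>\<omega>. (X n \<omega> - X m \<omega>)\<^sup>2"] by simp

text \<open>Kolmogorov's maximal inequality. On the event that the level \<open>e\<close> has already been exceeded
  the mean square of the martingale can only grow, because the next increment is orthogonal to the
  past; hence the event may be enlarged one time step at a time.\<close>

lemma maximal_inequality:
  assumes "0 < e" and "m \<le> n"
  shows "e\<^sup>2 * prob {\<omega>\<in>space M. \<exists>k\<in>{m..n}. e \<le> \<bar>X k \<omega> - X m \<omega>\<bar>} \<le> (\<integral>\<omega>. (X n \<omega> - X m \<omega>)\<^sup>2 \<partial>M)"
proof -
  define A where "A n = {\<omega>\<in>space M. \<exists>k\<in>{m..n}. e \<le> \<bar>X k \<omega> - X m \<omega>\<bar>}" for n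
  define Y where "Y n \<omega> = X n \<omega> - X m \<omega>" for n \<omega>
  have YF: "Y k \<in> borel_measurable (F n)" if "m \<le> k" "k \<le> n" for k n
    unfolding Y_def using that
    by (intro borel_measurable_diff measurable_F_mono[OF _ X_meas]) auto
  have Ysq: "square_integrable M (Y n)" for n
    unfolding Y_def by (intro square_integrable_diff sq)
  have AF: "A n \<in> sets (F n)" if "m \<le> n" for n
  proof -
    have "A n = (\<Union>k\<in>{m..n}. {\<omega>\<in>space (F n). e \<le> \<bar>Y k \<omega>\<bar>})"
      using subalg[of n] by (auto simp: A_def Y_def subalgebra_def)
    moreover have "{\<omega>\<in>space (F n). e \<le> \<bar>Y k \<omega>\<bar>} \<in> sets (F n)" if "k \<in> {m..n}" for k
    proof -
      have [measurable]: "Y k \<in> borel_measurable (F n)" using YF that by auto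
      show ?thesis by measurable
    qed
    ultimately show ?thesis by auto
  qed
  have AM: "A n \<in> sets M" if "m \<le> n" for n using AF[OF that] subalg[of n] by (auto simp: subalgebra_def)
  have "e\<^sup>2 * prob (A n) \<le> (\<integral>\<omega>. indicator (A n) \<omega> * (Y n \<omega>)\<^sup>2 \<partial>M)"
    using assms(2)
  proof (induction n rule: dec_induct)
    case base
    have "A m = {}" using assms(1) by (auto simp: A_def)
    then show ?case by simp
  next
    case (step n)
    define N where "N = A (Suc n) - A n"
    have sub: "A n \<subseteq> A (Suc n)" by (auto simp: A_def)
    have NM: "N \<in> sets M" using AM step by (simp add: N_def)
    have int: "integrable M (\<lambda>\<omega>. indicator B \<omega> * (Y k \<omega> * Y j \<omega>))" if "B \<in> sets M" for B k j
      using integrable_mult_indicator[OF that square_integrable_mult[OF Ysq Ysq]] by simp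
    have "prob (A (Suc n)) = prob (A n) + prob N"
      using AM[of n] AM[of "Suc n"] step sub finite_measure_Diff[of "A (Suc n)" "A n"] by (simp add: N_def)
    moreover have "e\<^sup>2 * prob N \<le> (\<integral>\<omega>. indicator N \<omega> * (Y (Suc n) \<omega>)\<^sup>2 \<partial>M)"
    proof -
      have "(\<integral>\<omega>. e\<^sup>2 * indicator N \<omega> \<partial>M) \<le> (\<integral>\<omega>. indicator N \<omega> * (Y (Suc n) \<omega>)\<^sup>2 \<partial>M)"
      proof (rule integral_mono)
        show "integrable M (\<lambda>\<omega>. e\<^sup>2 * indicator N \<omega>)"
          using NM by (intro integrable_mult_right integrable_real_indicator) (auto simp: emeasure_eq_measure)
        show "integrable M (\<lambda>\<omega>. indicator N \<omega> * (Y (Suc n) \<omega>)\<^sup>2)"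
          using int[OF NM] by (simp add: power2_eq_square)
        fix \<omega> assume "\<omega> \<in> space M"
        have "e \<le> \<bar>Y (Suc n) \<omega>\<bar>" if "\<omega> \<in> N"
          using that by (auto simp: N_def A_def Y_def le_Suc_eq)
        then show "e\<^sup>2 * indicator N \<omega> \<le> indicator N \<omega> * (Y (Suc n) \<omega>)\<^sup>2"
          using assms(1) abs_le_square_iff[of e "Y (Suc n) \<omega>"] by (auto simp: indicator_def)
      qed
      then show ?thesis using NM by simp
    qed
    moreover have "(\<integral>\<omega>. indicator (A n) \<omega> * (Y n \<omega>)\<^sup>2 \<partial>M) \<le> (\<integral>\<omega>. indicator (A n) \<omega> * (Y (Suc n) \<omega>)\<^sup>2 \<partial>M)"
    proof -
      have An: "A n \<in> sets M" "A n \<in> sets (F n)" using AM AF step by auto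
      have meas: "(\<lambda>\<omega>. indicator (A n) \<omega> * Y n \<omega>) \<in> borel_measurable (F n)"
        using YF[of n n] An step by (intro borel_measurable_times) auto
      have sqi: "square_integrable M (\<lambda>\<omega>. indicator (A n) \<omega> * Y n \<omega>)"
        by (rule square_integrable_indicator_mult[OF Ysq An(1)])
      have "(\<integral>\<omega>. indicator (A n) \<omega> * Y n \<omega> * X (Suc n) \<omega> \<partial>M) = (\<integral>\<omega>. indicator (A n) \<omega> * Y n \<omega> * X n \<omega> \<partial>M)"
        by (rule integral_mult_Suc[OF meas sqi])
      then have orth: "(\<integral>\<omega>. indicator (A n) \<omega> * Y n \<omega> * (X (Suc n) \<omega> - X n \<omega>) \<partial>M) = 0"
        using square_integrable_mult[OF sqi sq] by (simp add: right_diff_distrib)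
      have "(\<integral>\<omega>. indicator (A n) \<omega> * (Y n \<omega>)\<^sup>2 \<partial>M)
          = (\<integral>\<omega>. indicator (A n) \<omega> * (Y n \<omega>)\<^sup>2 + 2 * (indicator (A n) \<omega> * Y n \<omega> * (X (Suc n) \<omega> - X n \<omega>)) \<partial>M)"
        using orth int[OF An(1)] square_integrable_mult[OF sqi square_integrable_diff[OF sq sq]]
        by (simp add: power2_eq_square)
      also have "\<dots> \<le> (\<integral>\<omega>. indicator (A n) \<omega> * (Y (Suc n) \<omega>)\<^sup>2 \<partial>M)"
      proof (rule integral_mono)
        fix \<omega> assume "\<omega> \<in> space M"
        have "(Y (Suc n) \<omega>)\<^sup>2 = (Y n \<omega>)\<^sup>2 + 2 * (Y n \<omega> * (X (Suc n) \<omega> - X n \<omega>)) + (X (Suc n) \<omega> - X n \<omega>)\<^sup>2"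
          by (simp add: Y_def power2_eq_square algebra_simps)
        then show "indicator (A n) \<omega> * (Y n \<omega>)\<^sup>2 + 2 * (indicator (A n) \<omega> * Y n \<omega> * (X (Suc n) \<omega> - X n \<omega>))
            \<le> indicator (A n) \<omega> * (Y (Suc n) \<omega>)\<^sup>2"
          by (auto simp: indicator_def)
      qed (use int[OF An(1)] square_integrable_mult[OF sqi square_integrable_diff[OF sq sq]]
          in \<open>simp_all add: power2_eq_square\<close>)
      finally show ?thesis .
    qed
    moreover have "(\<integral>\<omega>. indicator (A (Suc n)) \<omega> * (Y (Suc n) \<omega>)\<^sup>2 \<partial>M)
        = (\<integral>\<omega>. indicator (A n) \<omega> * (Y (Suc n) \<omega>)\<^sup>2 \<partial>M) + (\<integral>\<omega>. indicator N \<omega> * (Y (Suc n) \<omega>)\<^sup>2 \<partial>M)"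
    proof -
      have "indicator (A (Suc n)) \<omega> = (indicator (A n) \<omega> + indicator N \<omega> :: real)" for \<omega>
        using sub by (auto simp: N_def indicator_def)
      then show ?thesis using int[OF NM] int[OF AM[of n]] step
        by (simp add: power2_eq_square distrib_right)
    qed
    ultimately show ?case using step.IH by (simp add: distrib_left)
  qed
  also have "\<dots> \<le> (\<integral>\<omega>. (Y n \<omega>)\<^sup>2 \<partial>M)"
  proof (rule integral_mono)
    show "integrable M (\<lambda>\<omega>. (Y n \<omega>)\<^sup>2)" using Ysq by (simp add: square_integrable_def)
    then show "integrable M (\<lambda>\<omega>. indicator (A n) \<omega> * (Y n \<omega>)\<^sup>2)"
      using integrable_mult_indicator[OF AM[OF assms(2)], of "\<lambda>\<omega>. (Y n \<omega>)\<^sup>2"] by simp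
  qed (auto simp: indicator_def)
  finally show ?thesis by (simp add: A_def Y_def)
qed

text \<open>The second moments increase to a finite limit, so the maximal inequality makes the oscillation
  beyond time \<open>m\<close> small in probability, uniformly; this gives almost sure convergence, and Fatou's
  lemma transfers the mean-square Cauchy property to the limit.\<close>

theorem L2_bounded_converges:
  assumes bdd: "\<And>n. (\<integral>\<omega>. (X n \<omega>)\<^sup>2 \<partial>M) \<le> B"
  obtains V where "V \<in> borel_measurable M" "AE \<omega> in M. (\<lambda>n. X n \<omega>) \<longlonglongrightarrow> V \<omega>" "converges_in_L2 M X V"
proof -
  define v where "v n = (\<integral>\<omega>. (X n \<omega>)\<^sup>2 \<partial>M)" for n
  have inc: "incseq v" unfolding v_def by (intro incseq_SucI second_moment_mono) simp
  have Xm [measurable]: "X n \<in> borel_measurable M" for n using sq by (simp add: square_integrable_def)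
  have "bdd_above (range v)" using bdd by (auto simp: v_def bdd_above_def)
  then have vlim: "v \<longlonglongrightarrow> (SUP n. v n)" using inc by (rule LIMSEQ_incseq_SUP)
  define w where "w = (SUP n. v n)"
  have vw: "v n \<le> w" for n unfolding w_def by (rule cSUP_upper) (use \<open>bdd_above (range v)\<close> in auto)
  have wv: "(\<lambda>n. w - v n) \<longlonglongrightarrow> 0" using vlim by (auto intro!: tendsto_eq_intros simp: w_def)
  define D where "D e m n = {\<omega>\<in>space M. \<exists>k\<in>{m..n}. e \<le> \<bar>X k \<omega> - X m \<omega>\<bar>}" for e :: real and m n :: nat
  have D[measurable]: "D e m n \<in> sets M" for e m n unfolding D_def by measurable
  define E where "E e m = (\<Union>n. D e m n)" for e m
  have E[measurable]: "E e m \<in> sets M" for e m unfolding E_def by measurable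
  have PE: "prob (E e m) \<le> (w - v m) / e\<^sup>2" if "0 < e" for e m
  proof -
    have "incseq (\<lambda>n. D e m n)" by (auto simp: incseq_def D_def)
    then have "(\<lambda>n. prob (D e m n)) \<longlonglongrightarrow> prob (E e m)"
      unfolding E_def by (intro finite_Lim_measure_incseq) auto
    moreover have "prob (D e m n) \<le> (w - v m) / e\<^sup>2" if "n \<ge> m" for n
    proof -
      have "e\<^sup>2 * prob (D e m n) \<le> v n - v m"
        unfolding D_def v_def second_moment_increment[OF that, symmetric]
        by (rule maximal_inequality[OF \<open>0 < e\<close> that])
      also have "\<dots> \<le> w - v m" using vw[of n] by simp
      finally show ?thesis using \<open>0 < e\<close> by (simp add: field_simps)
    qed
    ultimately show ?thesis by (intro LIMSEQ_le_const2) auto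
  qed
  have "AE \<omega> in M. \<exists>m. \<omega> \<notin> E e m" if "0 < e" for e
  proof -
    have "prob (\<Inter>m. E e m) \<le> (w - v m) / e\<^sup>2" for m
      by (rule order_trans[OF finite_measure_mono PE[OF that, of m]]) auto
    moreover have "(\<lambda>m. (w - v m) / e\<^sup>2) \<longlonglongrightarrow> 0"
      using tendsto_divide[OF wv tendsto_const[of "e\<^sup>2"]] that by simp
    ultimately have "prob (\<Inter>m. E e m) \<le> 0"
      by (intro LIMSEQ_le_const[of "\<lambda>m. (w - v m) / e\<^sup>2"]) auto
    then have "prob (\<Inter>m. E e m) = 0" by (simp add: measure_le_0_iff)
    then have "AE \<omega> in M. \<omega> \<notin> (\<Inter>m. E e m)" by (subst prob_eq_0[symmetric]) auto
    then show ?thesis by auto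
  qed
  then have "AE \<omega> in M. \<forall>j::nat. \<exists>m. \<omega> \<notin> E (1 / real (Suc j)) m" by (subst AE_all_countable) auto
  with AE_space have conv: "AE \<omega> in M. convergent (\<lambda>n. X n \<omega>)"
  proof (eventually_elim)
    fix \<omega> assume \<omega>: "\<omega> \<in> space M" and *: "\<forall>j::nat. \<exists>m. \<omega> \<notin> E (1 / real (Suc j)) m"
    have "Cauchy (\<lambda>n. X n \<omega>)"
    proof (rule CauchyI')
      fix e :: real assume "0 < e"
      then obtain j :: nat where j: "1 / real (Suc j) < e / 2" using nat_approx_posE[of "e/2"] by auto
      obtain m where m: "\<omega> \<notin> E (1 / real (Suc j)) m" using * by blast
      have "\<bar>X k \<omega> - X m \<omega>\<bar> < e / 2" if "k \<ge> m" for k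
      proof -
        have "\<omega> \<notin> D (1 / real (Suc j)) m k" using m by (auto simp: E_def)
        then have "\<not> 1 / real (Suc j) \<le> \<bar>X k \<omega> - X m \<omega>\<bar>" using that \<omega> by (auto simp: D_def)
        then show ?thesis using j by linarith
      qed
      then have "dist (X p \<omega>) (X q \<omega>) < e" if "p \<ge> m" "q \<ge> m" for p q
        using that \<open>\<And>k. k \<ge> m \<Longrightarrow> \<bar>X k \<omega> - X m \<omega>\<bar> < e / 2\<close>[of p]
          \<open>\<And>k. k \<ge> m \<Longrightarrow> \<bar>X k \<omega> - X m \<omega>\<bar> < e / 2\<close>[of q]
        unfolding dist_real_def by linarith
      then show "\<exists>N. \<forall>p\<ge>N. \<forall>q>p. dist (X p \<omega>) (X q \<omega>) < e"
        by (meson less_imp_le order_trans)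
    qed
    then show "convergent (\<lambda>n. X n \<omega>)" by (simp add: Cauchy_convergent_iff)
  qed
  define V where "V \<omega> = lim (\<lambda>n. X n \<omega>)" for \<omega>
  have V[measurable]: "V \<in> borel_measurable M" unfolding V_def by measurable
  have lim: "AE \<omega> in M. (\<lambda>n. X n \<omega>) \<longlonglongrightarrow> V \<omega>"
    using conv by eventually_elim (simp add: V_def convergent_LIMSEQ_iff)
  have fatou: "integrable M (\<lambda>\<omega>. (X n \<omega> - V \<omega>)\<^sup>2) \<and> (\<integral>\<omega>. (X n \<omega> - V \<omega>)\<^sup>2 \<partial>M) \<le> w - v n" for n
  proof -
    have "(\<integral>\<^sup>+\<omega>. ennreal ((X n \<omega> - V \<omega>)\<^sup>2) \<partial>M) = (\<integral>\<^sup>+\<omega>. liminf (\<lambda>k. ennreal ((X n \<omega> - X k \<omega>)\<^sup>2)) \<partial>M)"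
    proof (rule nn_integral_cong_AE)
      show "AE \<omega> in M. ennreal ((X n \<omega> - V \<omega>)\<^sup>2) = liminf (\<lambda>k. ennreal ((X n \<omega> - X k \<omega>)\<^sup>2))"
        using lim
      proof eventually_elim
        fix \<omega> assume "(\<lambda>k. X k \<omega>) \<longlonglongrightarrow> V \<omega>"
        then have "(\<lambda>k. ennreal ((X n \<omega> - X k \<omega>)\<^sup>2)) \<longlonglongrightarrow> ennreal ((X n \<omega> - V \<omega>)\<^sup>2)"
          by (intro tendsto_intros tendsto_ennrealI)
        then show "ennreal ((X n \<omega> - V \<omega>)\<^sup>2) = liminf (\<lambda>k. ennreal ((X n \<omega> - X k \<omega>)\<^sup>2))"
          by (intro lim_imp_Liminf[symmetric]) auto
      qed
    qed
    also have "\<dots> \<le> liminf (\<lambda>k. \<integral>\<^sup>+\<omega>. ennreal ((X n \<omega> - X k \<omega>)\<^sup>2) \<partial>M)"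
      by (rule nn_integral_liminf) simp
    also have "\<dots> \<le> liminf (\<lambda>k. ennreal (w - v n))"
    proof (rule Liminf_mono, rule eventually_sequentiallyI)
      fix k assume "n \<le> k"
      have "(\<integral>\<^sup>+\<omega>. ennreal ((X n \<omega> - X k \<omega>)\<^sup>2) \<partial>M) = ennreal (\<integral>\<omega>. (X n \<omega> - X k \<omega>)\<^sup>2 \<partial>M)"
        using square_integrable_diff[OF sq sq] by (intro nn_integral_eq_integral) (auto simp: square_integrable_def)
      also have "(\<integral>\<omega>. (X n \<omega> - X k \<omega>)\<^sup>2 \<partial>M) = v k - v n"
        using second_moment_increment[OF \<open>n \<le> k\<close>] by (simp add: v_def power2_commute)
      finally show "(\<integral>\<^sup>+\<omega>. ennreal ((X n \<omega> - X k \<omega>)\<^sup>2) \<partial>M) \<le> ennreal (w - v n)"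
        using vw[of k] by (simp add: ennreal_leI)
    qed
    also have "\<dots> = ennreal (w - v n)" by (simp add: Liminf_const)
    finally have le: "(\<integral>\<^sup>+\<omega>. ennreal ((X n \<omega> - V \<omega>)\<^sup>2) \<partial>M) \<le> ennreal (w - v n)" .
    have int: "integrable M (\<lambda>\<omega>. (X n \<omega> - V \<omega>)\<^sup>2)"
      using le by (intro integrableI_bounded) (auto simp: top_unique less_top[symmetric] intro: le_less_trans)
    moreover have "(\<integral>\<omega>. (X n \<omega> - V \<omega>)\<^sup>2 \<partial>M) \<le> w - v n"
      using le int nn_integral_eq_integral[OF int] vw[of n] by (simp add: ennreal_le_iff)
    ultimately show ?thesis by simp
  qed
  have "square_integrable M (\<lambda>\<omega>. X 0 \<omega> - V \<omega>)"
    using fatou[of 0] by (simp add: square_integrable_def)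
  from square_integrable_diff[OF sq[of 0] this] have Vsq: "square_integrable M V" by simp
  have "(\<lambda>n. \<integral>\<omega>. (X n \<omega> - V \<omega>)\<^sup>2 \<partial>M) \<longlonglongrightarrow> 0"
    by (rule tendsto_sandwich[OF _ _ tendsto_const wv]) (use fatou in auto)
  then have "converges_in_L2 M X V" using Vsq sq by (simp add: converges_in_L2_def)
  with V lim show ?thesis using that by blast
qed

end

text \<open>Deterministic weights keep the increments centred and orthogonal. Weights that decrease fast
  enough turn a martingale whose second moments diverge into a bounded one, to which Kronecker's lemma
  can then be applied.\<close>

lemma (in L2_martingale) weighted_martingale:
  fixes c :: "nat \<Rightarrow> real"
  defines "Y \<equiv> \<lambda>n \<omega>. \<Sum>k<n. c k * (X (Suc k) \<omega> - X k \<omega>)"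
  shows "L2_martingale M F Y"
    and "(\<integral>\<omega>. (Y n \<omega>)\<^sup>2 \<partial>M) = (\<Sum>k<n. (c k)\<^sup>2 * ((\<integral>\<omega>. (X (Suc k) \<omega>)\<^sup>2 \<partial>M) - (\<integral>\<omega>. (X k \<omega>)\<^sup>2 \<partial>M)))"
proof -
  have sqY: "square_integrable M (Y n)" for n
    unfolding Y_def
    by (intro square_integrable_sum square_integrable_cmult square_integrable_diff sq prob_space_axioms)
  have YF: "Y n \<in> borel_measurable (F n)" for n
    unfolding Y_def
    by (intro borel_measurable_sum borel_measurable_times borel_measurable_const borel_measurable_diff
        measurable_F_mono[OF _ X_meas]) auto
  have [measurable]: "X n \<in> borel_measurable M" "Y n \<in> borel_measurable M" for n
    using sq sqY by (simp_all add: square_integrable_def)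
  have intX: "integrable M (X n)" "integrable M (Y n)" for n
    using square_integrable_integrable[OF prob_space_axioms] sq sqY by blast+
  have YS: "Y (Suc n) = (\<lambda>\<omega>. Y n \<omega> + c n * (X (Suc n) \<omega> - X n \<omega>))" for n
    by (simp add: Y_def fun_eq_iff)
  have ce: "AE \<omega> in M. real_cond_exp M (F n) (Y (Suc n)) \<omega> = Y n \<omega>" for n
  proof -
    interpret finite_measure_subalgebra M "F n" by unfold_locales (rule subalg)
    have 1: "AE \<omega> in M. real_cond_exp M (F n) (\<lambda>\<omega>. Y n \<omega> + c n * (X (Suc n) \<omega> - X n \<omega>)) \<omega>
        = real_cond_exp M (F n) (Y n) \<omega> + real_cond_exp M (F n) (\<lambda>\<omega>. c n * (X (Suc n) \<omega> - X n \<omega>)) \<omega>"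
      using intX by (intro real_cond_exp_add) auto
    have 2: "AE \<omega> in M. real_cond_exp M (F n) (\<lambda>\<omega>. c n * (X (Suc n) \<omega> - X n \<omega>)) \<omega>
        = c n * real_cond_exp M (F n) (\<lambda>\<omega>. X (Suc n) \<omega> - X n \<omega>) \<omega>"
      using intX by (intro real_cond_exp_cmult) auto
    have 3: "AE \<omega> in M. real_cond_exp M (F n) (\<lambda>\<omega>. X (Suc n) \<omega> - X n \<omega>) \<omega>
        = real_cond_exp M (F n) (X (Suc n)) \<omega> - real_cond_exp M (F n) (X n) \<omega>"
      using intX by (intro real_cond_exp_diff) auto
    have 4: "AE \<omega> in M. real_cond_exp M (F n) (X n) \<omega> = X n \<omega>"
      "AE \<omega> in M. real_cond_exp M (F n) (Y n) \<omega> = Y n \<omega>"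
      using intX X_meas YF by (auto intro!: real_cond_exp_F_meas)
    have 5: "AE \<omega> in M. real_cond_exp M (F n) (X (Suc n)) \<omega> = X n \<omega>"
      using mart by (simp add: martingale_def)
    show ?thesis unfolding YS using 1 2 3 4 5 by eventually_elim simp
  qed
  show L: "L2_martingale M F Y"
    by unfold_locales (auto simp: martingale_def intX YF ce sqY intro: subalg filt[THEN subsetD])
  show "(\<integral>\<omega>. (Y n \<omega>)\<^sup>2 \<partial>M) = (\<Sum>k<n. (c k)\<^sup>2 * ((\<integral>\<omega>. (X (Suc k) \<omega>)\<^sup>2 \<partial>M) - (\<integral>\<omega>. (X k \<omega>)\<^sup>2 \<partial>M)))"
  proof (induction n)
    case 0 then show ?case by (simp add: Y_def)
  next
    case (Suc n)
    have "(\<integral>\<omega>. (Y (Suc n) \<omega>)\<^sup>2 \<partial>M) - (\<integral>\<omega>. (Y n \<omega>)\<^sup>2 \<partial>M) = (\<integral>\<omega>. (Y (Suc n) \<omega> - Y n \<omega>)\<^sup>2 \<partial>M)"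
      using L2_martingale.second_moment_increment[OF L, of n "Suc n"] by simp
    also have "\<dots> = (c n)\<^sup>2 * (\<integral>\<omega>. (X (Suc n) \<omega> - X n \<omega>)\<^sup>2 \<partial>M)"
      by (simp add: YS power_mult_distrib)
    finally show ?case using Suc second_moment_increment[of n "Suc n"] by simp
  qed
qed

lemma converges_in_L2_scaled:
  assumes "prob_space M" "converges_in_L2 M X V" and c: "c \<longlonglongrightarrow> a"
  shows "converges_in_L2 M (\<lambda>n \<omega>. c n * X n \<omega>) (\<lambda>\<omega>. a * V \<omega>)"
proof -
  interpret prob_space M by fact
  have sq: "\<And>n. square_integrable M (X n)" "square_integrable M V"
    and lim: "(\<lambda>n. \<integral>\<omega>. (X n \<omega> - V \<omega>)\<^sup>2 \<partial>M) \<longlonglongrightarrow> 0"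
    using assms(2) by (auto simp: converges_in_L2_def)
  have le: "(\<integral>\<omega>. (c n * X n \<omega> - a * V \<omega>)\<^sup>2 \<partial>M)
      \<le> 2 * (c n)\<^sup>2 * (\<integral>\<omega>. (X n \<omega> - V \<omega>)\<^sup>2 \<partial>M) + 2 * (c n - a)\<^sup>2 * (\<integral>\<omega>. (V \<omega>)\<^sup>2 \<partial>M)" for n
  proof -
    have i1: "integrable M (\<lambda>\<omega>. (X n \<omega> - V \<omega>)\<^sup>2)" "integrable M (\<lambda>\<omega>. (V \<omega>)\<^sup>2)"
      using square_integrable_diff[OF sq] sq by (auto simp: square_integrable_def)
    have i2: "integrable M (\<lambda>\<omega>. (c n * X n \<omega> - a * V \<omega>)\<^sup>2)"
      using square_integrable_diff[OF square_integrable_cmult[OF sq(1)] square_integrable_cmult[OF sq(2)]]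
      by (auto simp: square_integrable_def)
    have "(\<integral>\<omega>. (c n * X n \<omega> - a * V \<omega>)\<^sup>2 \<partial>M)
        \<le> (\<integral>\<omega>. 2 * (c n)\<^sup>2 * (X n \<omega> - V \<omega>)\<^sup>2 + 2 * (c n - a)\<^sup>2 * (V \<omega>)\<^sup>2 \<partial>M)"
    proof (rule integral_mono)
      fix \<omega>
      have "(x + y)\<^sup>2 \<le> 2 * x\<^sup>2 + 2 * y\<^sup>2" for x y :: real
        using sum_squares_bound[of x y] by (simp add: power2_sum)
      moreover have "c n * X n \<omega> - a * V \<omega> = c n * (X n \<omega> - V \<omega>) + (c n - a) * V \<omega>"
        by (simp add: algebra_simps)
      ultimately have "(c n * X n \<omega> - a * V \<omega>)\<^sup>2
          \<le> 2 * (c n * (X n \<omega> - V \<omega>))\<^sup>2 + 2 * ((c n - a) * V \<omega>)\<^sup>2" by presburger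
      then
      show "(c n * X n \<omega> - a * V \<omega>)\<^sup>2 \<le> 2 * (c n)\<^sup>2 * (X n \<omega> - V \<omega>)\<^sup>2 + 2 * (c n - a)\<^sup>2 * (V \<omega>)\<^sup>2"
        by (simp only: power_mult_distrib mult.assoc)
    qed (use i1 i2 in auto)
    then show ?thesis using i1 by simp
  qed
  have up: "(\<lambda>n. 2 * (c n)\<^sup>2 * (\<integral>\<omega>. (X n \<omega> - V \<omega>)\<^sup>2 \<partial>M) + 2 * (c n - a)\<^sup>2 * (\<integral>\<omega>. (V \<omega>)\<^sup>2 \<partial>M))
      \<longlonglongrightarrow> 2 * a\<^sup>2 * 0 + 2 * (a - a)\<^sup>2 * (\<integral>\<omega>. (V \<omega>)\<^sup>2 \<partial>M)"
    by (intro tendsto_intros c lim)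
  have "(\<lambda>n. \<integral>\<omega>. (c n * X n \<omega> - a * V \<omega>)\<^sup>2 \<partial>M) \<longlonglongrightarrow> 2 * a\<^sup>2 * 0 + 2 * (a - a)\<^sup>2 * (\<integral>\<omega>. (V \<omega>)\<^sup>2 \<partial>M)"
    by (rule tendsto_sandwich[OF always_eventually always_eventually _ up, of "\<lambda>_. 0"])
      (use le in \<open>auto intro: Bochner_Integration.integral_nonneg\<close>)
  then have "(\<lambda>n. \<integral>\<omega>. (c n * X n \<omega> - a * V \<omega>)\<^sup>2 \<partial>M) \<longlonglongrightarrow> 0" by simp
  then show ?thesis using sq by (auto simp: converges_in_L2_def intro: square_integrable_cmult)
qed

lemma converges_in_L2_expectation:
  assumes "prob_space M" "converges_in_L2 M X V"
  shows "(\<lambda>n. \<integral>\<omega>. X n \<omega> \<partial>M) \<longlonglongrightarrow> (\<integral>\<omega>. V \<omega> \<partial>M)"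
proof -
  interpret prob_space M by fact
  have sq: "\<And>n. square_integrable M (X n)" "square_integrable M V"
    and lim: "(\<lambda>n. \<integral>\<omega>. (X n \<omega> - V \<omega>)\<^sup>2 \<partial>M) \<longlonglongrightarrow> 0"
    using assms(2) by (auto simp: converges_in_L2_def)
  have int: "integrable M (X n)" "integrable M V" for n
    using sq square_integrable_integrable[OF prob_space_axioms] by auto
  have bound: "\<bar>expectation (X n) - expectation V\<bar> \<le> sqrt (\<integral>\<omega>. (X n \<omega> - V \<omega>)\<^sup>2 \<partial>M)" for n
  proof -
    have "0 \<le> variance (\<lambda>\<omega>. X n \<omega> - V \<omega>)" by simp
    also have "\<dots> = (\<integral>\<omega>. (X n \<omega> - V \<omega>)\<^sup>2 \<partial>M) - (expectation (\<lambda>\<omega>. X n \<omega> - V \<omega>))\<^sup>2"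
      using square_integrable_diff[OF sq] int by (intro variance_eq) (auto simp: square_integrable_def)
    also have "expectation (\<lambda>\<omega>. X n \<omega> - V \<omega>) = expectation (X n) - expectation V" using int by simp
    finally have "(expectation (X n) - expectation V)\<^sup>2 \<le> (\<integral>\<omega>. (X n \<omega> - V \<omega>)\<^sup>2 \<partial>M)" by simp
    then show ?thesis by (metis real_sqrt_abs real_sqrt_le_mono)
  qed
  have "(\<lambda>n. sqrt (\<integral>\<omega>. (X n \<omega> - V \<omega>)\<^sup>2 \<partial>M)) \<longlonglongrightarrow> 0"
    using tendsto_real_sqrt[OF lim] by simp
  then have "(\<lambda>n. expectation (X n) - expectation V) \<longlonglongrightarrow> 0"
    by (rule Lim_null_comparison[OF always_eventually, rotated]) (use bound in auto)
  then show ?thesis by (rule LIM_zero_cancel)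
qed

section \<open>The urn as a finite-valued Markov chain\<close>

lemma integrable_simple_fun:
  fixes f :: "'a \<Rightarrow> 'b :: {banach, second_countable_topology}"
  assumes "prob_space M" "simple_function M f" shows "integrable M f"
proof -
  interpret prob_space M by fact
  show ?thesis
    by (rule integrable_simple_function[OF assms(2)]) (simp add: emeasure_eq_measure)
qed

context urn_process
begin

lemma content_nonneg_total:
  assumes "\<omega> \<in> space M"
  shows "(\<forall>i. 0 \<le> C n \<omega> $ i) \<and> (\<Sum>i\<in>UNIV. C n \<omega> $ i) = real (Suc n)"
proof (induction n)
  case 0
  then show ?case using initial assms by (simp add: C_0 probability_vector_def)
next
  case (Suc n)
  have "probability_vector (row (draw (Suc n) \<omega>) R)"
    using stochastic by (simp add: stochastic_matrix_def)
  then show ?case using Suc assms by (simp add: C_Suc probability_vector_def sum.distrib)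
qed

lemma draw_sets: "{\<omega>\<in>space M. draw (Suc n) \<omega> = i} \<in> sets M"
  using measurable_sets[OF draw_measurable[of n], of "{i}"] by (simp add: vimage_def Int_def conj_commute)

lemma C_measurable [measurable]: "C n \<in> borel_measurable M"
proof (induction n)
  case 0
  have "C 0 \<in> borel_measurable M \<longleftrightarrow> (\<lambda>_. c\<^sub>0) \<in> borel_measurable M"
    by (rule measurable_cong) (simp add: C_0)
  then show ?case by simp
next
  case (Suc n)
  have "(\<lambda>\<omega>. row (draw (Suc n) \<omega>) R) \<in> borel_measurable M"
    using measurable_compose[OF draw_measurable[of n], of "\<lambda>i. row i R" borel] by simp
  then have "(\<lambda>\<omega>. C n \<omega> + row (draw (Suc n) \<omega>) R) \<in> borel_measurable M"
    using Suc by simp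
  then show ?case
    using measurable_cong[of M "C (Suc n)" "\<lambda>\<omega>. C n \<omega> + row (draw (Suc n) \<omega>) R" borel]
    by (simp add: C_Suc)
qed

lemma C_finite_range: "finite (C n ` space M)"
proof (induction n)
  case 0
  have "C 0 ` space M \<subseteq> {c\<^sub>0}" by (auto simp: C_0)
  then show ?case using finite_subset by blast
next
  case (Suc n)
  have "C (Suc n) ` space M \<subseteq> (\<lambda>(c, i). c + row i R) ` (C n ` space M \<times> UNIV)"
    by (force simp: C_Suc)
  then show ?case using Suc by (meson finite finite_SigmaI finite_imageI finite_subset)
qed

abbreviation F :: "nat \<Rightarrow> 'a measure" where "F \<equiv> natural_filtration M C"

lemma space_F: "space (F n) = space M"
  unfolding natural_filtration_def by (rule space_measure_of) auto

lemma sets_F: "sets (F n) = sigma_sets (space M) (\<Union>k\<in>{..n}. {C k -` A \<inter> space M | A. A \<in> sets borel})"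
  unfolding natural_filtration_def by (rule sets_measure_of) auto

lemma F_mono: "m \<le> n \<Longrightarrow> sets (F m) \<subseteq> sets (F n)"
  unfolding sets_F by (intro sigma_sets_mono') force

lemma F_subalgebra: "subalgebra M (F n)"
proof -
  have "(\<Union>k\<in>{..n}. {C k -` A \<inter> space M | A. A \<in> sets borel}) \<subseteq> sets M"
    using measurable_sets[OF C_measurable] by blast
  then have "sets (F n) \<subseteq> sets M" unfolding sets_F by (rule sets.sigma_sets_subset)
  then show ?thesis by (simp add: subalgebra_def space_F)
qed

lemma C_F_measurable: "m \<le> n \<Longrightarrow> C m \<in> borel_measurable (F n)"
  by (rule measurableI) (auto simp: space_F sets_F intro!: sigma_sets.Basic)

text \<open>The content takes finitely many values at each time, so all functions of it are measurable and
  integrable.\<close>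

lemma C_simple_F: "m \<le> n \<Longrightarrow> simple_function (F n) (C m)"
  by (rule simple_function_borel_measurable) (auto simp: C_F_measurable space_F C_finite_range)

lemma C_simple: "simple_function M (C n)"
  by (rule simple_function_borel_measurable) (auto simp: C_finite_range)

lemma measurable_fun_C_F: "m \<le> n \<Longrightarrow> (\<lambda>\<omega>. f (C m \<omega>)) \<in> borel_measurable (F n)"
  by (rule borel_measurable_simple_function[OF simple_function_compose1[OF C_simple_F]])

lemma integrable_fun_C: "integrable M (\<lambda>\<omega>. f (C n \<omega>) :: 'c :: {banach, second_countable_topology})"
  by (rule integrable_simple_fun[OF prob_space_axioms simple_function_compose1[OF C_simple]])

lemma measurable_fun_C: "(\<lambda>\<omega>. f (C n \<omega>)) \<in> borel_measurable M"
  by (rule borel_measurable_simple_function[OF simple_function_compose1[OF C_simple]])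

lemma square_integrable_fun_C: "square_integrable M (\<lambda>\<omega>. f (C n \<omega>))"
  using integrable_fun_C[of "\<lambda>c. (f c)\<^sup>2" n] measurable_fun_C[of f n] by (simp add: square_integrable_def)

text \<open>One-step transition: decompose over the colour drawn; given the past, each summand is a
  known quantity times the indicator of that colour.\<close>

lemma cond_exp_Suc:
  fixes f :: "real^'k \<Rightarrow> real"
  shows "AE \<omega> in M. real_cond_exp M (F n) (\<lambda>\<omega>. f (C (Suc n) \<omega>)) \<omega>
    = (\<Sum>i\<in>UNIV. C n \<omega> $ i / real (Suc n) * f (C n \<omega> + row i R))"
proof -
  interpret finite_measure_subalgebra M "F n" by unfold_locales (rule F_subalgebra)
  define I where "I i = (indicator {\<omega>\<in>space M. draw (Suc n) \<omega> = i} :: 'a \<Rightarrow> real)" for i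
  define g where "g i \<omega> = f (C n \<omega> + row i R) * I i \<omega>" for i \<omega>
  have I [measurable]: "I i \<in> borel_measurable M" for i
    using draw_sets by (simp add: I_def)
  have gF: "(\<lambda>\<omega>. f (C n \<omega> + row i R)) \<in> borel_measurable (F n)" for i
    using measurable_fun_C_F[of n n "\<lambda>c. f (c + row i R)"] by simp
  have gi: "integrable M (g i)" for i
    using integrable_real_mult_indicator[OF draw_sets[of n i] integrable_fun_C[of "\<lambda>c. f (c + row i R)" n]]
    by (simp add: g_def[abs_def] I_def)
  have [measurable]: "g i \<in> borel_measurable M" for i using gi by auto
  have [measurable]: "(\<lambda>\<omega>. f (C (Suc n) \<omega>)) \<in> borel_measurable M" by (rule measurable_fun_C)
  have "f (C (Suc n) \<omega>) = (\<Sum>i\<in>UNIV. g i \<omega>)" if "\<omega> \<in> space M" for \<omega>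
  proof -
    have "(\<Sum>i\<in>UNIV. g i \<omega>) = (\<Sum>i\<in>UNIV. if i = draw (Suc n) \<omega> then f (C n \<omega> + row i R) else 0)"
      using that by (intro sum.cong) (auto simp: g_def I_def)
    then show ?thesis using that by (simp add: C_Suc)
  qed
  then have "AE \<omega> in M. real_cond_exp M (F n) (\<lambda>\<omega>. f (C (Suc n) \<omega>)) \<omega>
      = real_cond_exp M (F n) (\<lambda>\<omega>. \<Sum>i\<in>UNIV. g i \<omega>) \<omega>"
    by (intro real_cond_exp_cong) auto
  moreover have "AE \<omega> in M. real_cond_exp M (F n) (\<lambda>\<omega>. \<Sum>i\<in>UNIV. g i \<omega>) \<omega>
      = (\<Sum>i\<in>UNIV. real_cond_exp M (F n) (g i) \<omega>)"
    using gi by (rule real_cond_exp_sum)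
  moreover have "AE \<omega> in M. \<forall>i. real_cond_exp M (F n) (g i) \<omega> = f (C n \<omega> + row i R) * (C n \<omega> $ i / real (Suc n))"
  proof (subst AE_all_countable, rule allI)
    fix i
    have "AE \<omega> in M. real_cond_exp M (F n) (\<lambda>\<omega>. f (C n \<omega> + row i R) * I i \<omega>) \<omega>
        = f (C n \<omega> + row i R) * real_cond_exp M (F n) (I i) \<omega>"
      using gF gi by (intro real_cond_exp_mult) (auto simp: g_def[abs_def])
    then show "AE \<omega> in M. real_cond_exp M (F n) (g i) \<omega> = f (C n \<omega> + row i R) * (C n \<omega> $ i / real (Suc n))"
      using draw_prob[of n i] by eventually_elim (simp add: g_def[abs_def] I_def)
  qed
  ultimately show ?thesis by eventually_elim (simp add: mult.commute)
qed

lemma expectation_Suc: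
  fixes f :: "real^'k \<Rightarrow> real"
  shows "expectation (\<lambda>\<omega>. f (C (Suc n) \<omega>))
    = expectation (\<lambda>\<omega>. \<Sum>i\<in>UNIV. C n \<omega> $ i / real (Suc n) * f (C n \<omega> + row i R))"
proof -
  interpret finite_measure_subalgebra M "F n" by unfold_locales (rule F_subalgebra)
  have "expectation (\<lambda>\<omega>. f (C (Suc n) \<omega>)) = expectation (real_cond_exp M (F n) (\<lambda>\<omega>. f (C (Suc n) \<omega>)))"
    by (rule real_cond_exp_int(2)[symmetric, OF integrable_fun_C])
  also have "\<dots> = expectation (\<lambda>\<omega>. \<Sum>i\<in>UNIV. C n \<omega> $ i / real (Suc n) * f (C n \<omega> + row i R))"
    by (intro integral_cong_AE cond_exp_Suc
        measurable_fun_C[of "\<lambda>c. \<Sum>i\<in>UNIV. c $ i / real (Suc n) * f (c + row i R)" n]) auto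
  finally show ?thesis .
qed

lemma expectation_Suc_complex:
  fixes f :: "real^'k \<Rightarrow> complex"
  shows "(\<integral>\<omega>. f (C (Suc n) \<omega>) \<partial>M)
    = (\<integral>\<omega>. (\<Sum>i\<in>UNIV. of_real (C n \<omega> $ i / real (Suc n)) * f (C n \<omega> + row i R)) \<partial>M)"
proof -
  define h where "h c = (\<Sum>i\<in>UNIV. of_real (c $ i / real (Suc n)) * f (c + row i R))" for c
  note int = integrable_fun_C[of f "Suc n"] integrable_fun_C[of h n]
  have part: "Re (h c) = (\<Sum>i\<in>UNIV. c $ i / real (Suc n) * Re (f (c + row i R)))"
    "Im (h c) = (\<Sum>i\<in>UNIV. c $ i / real (Suc n) * Im (f (c + row i R)))" for c
    by (simp_all add: h_def del: of_nat_Suc of_real_divide)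
  show ?thesis
    unfolding h_def[symmetric]
    by (rule complex_eqI)
      (simp_all only: integral_Re[OF int(1), symmetric] integral_Im[OF int(1), symmetric]
        integral_Re[OF int(2), symmetric] integral_Im[OF int(2), symmetric] part
        expectation_Suc[of "\<lambda>c. Re (f c)"] expectation_Suc[of "\<lambda>c. Im (f c)"])
qed

end

section \<open>Linear functionals of the white and black balls\<close>

lemma nongreen_nth [simp]: "nongreen c $ 1 = c $ 1" "nongreen c $ 2 = c $ 2"
  by (simp_all add: nongreen_def)

lemma nongreen_inner: "nongreen c \<bullet> \<eta> = c $ 1 * \<eta> $ 1 + c $ 2 * \<eta> $ 2"
  by (simp add: inner_vec_def sum_2)

lemma one_nth [simp]: "(1 :: real^'k) $ i = 1"
  by (simp add: one_vec_def)

lemma stochastic_ones: "stochastic_matrix Q \<Longrightarrow> Q *v 1 = (1 :: real^'k)"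
  by (auto simp: vec_eq_iff matrix_vector_mult_def stochastic_matrix_def probability_vector_def row_def)

text \<open>Green balls never produce white or black ones, and a white or black ball \<open>i\<close> adds
  \<open>s\<close> times row \<open>i\<close> of \<open>Q\<close>; paired with an eigenvector \<open>\<eta>\<close>, this row only sees the coordinate \<open>i\<close>
  of \<open>\<eta>\<close>.\<close>

lemma nongreen_row:
  assumes "Q *v \<eta> = \<mu> *\<^sub>R \<eta>"
  shows "nongreen (c + row 1 (triangular_matrix s Q)) \<bullet> \<eta> = nongreen c \<bullet> \<eta> + s * \<mu> * \<eta> $ 1"
    and "nongreen (c + row 2 (triangular_matrix s Q)) \<bullet> \<eta> = nongreen c \<bullet> \<eta> + s * \<mu> * \<eta> $ 2"
    and "nongreen (c + row 3 (triangular_matrix s Q)) \<bullet> \<eta> = nongreen c \<bullet> \<eta>"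
proof -
  have e: "Q $ 1 $ 1 * \<eta> $ 1 + Q $ 1 $ 2 * \<eta> $ 2 = \<mu> * \<eta> $ 1" "Q $ 2 $ 1 * \<eta> $ 1 + Q $ 2 $ 2 * \<eta> $ 2 = \<mu> * \<eta> $ 2"
    using assms by (simp_all add: vec_eq_iff forall_2 matrix_vector_mult_def sum_2)
  show "nongreen (c + row 1 (triangular_matrix s Q)) \<bullet> \<eta> = nongreen c \<bullet> \<eta> + s * \<mu> * \<eta> $ 1"
    using arg_cong[OF e(1), of "\<lambda>x. s * x"] by (simp add: nongreen_inner row_def triangular_matrix_def algebra_simps)
  show "nongreen (c + row 2 (triangular_matrix s Q)) \<bullet> \<eta> = nongreen c \<bullet> \<eta> + s * \<mu> * \<eta> $ 2"
    using arg_cong[OF e(2), of "\<lambda>x. s * x"] by (simp add: nongreen_inner row_def triangular_matrix_def algebra_simps)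
  show "nongreen (c + row 3 (triangular_matrix s Q)) \<bullet> \<eta> = nongreen c \<bullet> \<eta>"
    by (simp add: nongreen_inner row_def triangular_matrix_def)
qed

text \<open>All quantities of interest are pairings \<open>X \<eta>\<close> of the white and black content with a right
  eigenvector \<open>\<eta>\<close> of \<open>Q\<close>. The total mass \<open>T\<close> of white and black is the special case of the eigenvector
  \<open>1\<close> with eigenvalue \<open>1\<close>, so that one theorem yields its limit and that of the
  supercritical centred functional.\<close>

locale triangular_urn = urn_process M "triangular_matrix s Q" c\<^sub>0 draw C
  for M :: "'a measure" and s :: real and Q :: "real^2^2" and c\<^sub>0 :: "real^3"
    and draw :: "nat \<Rightarrow> 'a \<Rightarrow> 3" and C :: "nat \<Rightarrow> 'a \<Rightarrow> real^3" +
  assumes s_pos: "0 < s" and s_less: "s < 1"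
    and Q_stochastic: "stochastic_matrix Q"
    and nongreen_init: "0 < nongreen c\<^sub>0 \<bullet> 1"
begin

abbreviation X :: "real^2 \<Rightarrow> nat \<Rightarrow> 'a \<Rightarrow> real" where
  "X \<eta> n \<omega> \<equiv> nongreen (C n \<omega>) \<bullet> \<eta>"

abbreviation T :: "nat \<Rightarrow> 'a \<Rightarrow> real" where
  "T n \<omega> \<equiv> X 1 n \<omega>"

abbreviation T0 :: real where "T0 \<equiv> nongreen c\<^sub>0 \<bullet> 1"

lemma content_coords:
  assumes "\<omega> \<in> space M"
  shows "0 \<le> C n \<omega> $ 1" "0 \<le> C n \<omega> $ 2" "0 \<le> C n \<omega> $ 3"
    "C n \<omega> $ 1 + C n \<omega> $ 2 + C n \<omega> $ 3 = real (Suc n)"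
  using content_nonneg_total[OF assms, of n] by (auto simp: sum_3)

lemma T_eq: "T n \<omega> = C n \<omega> $ 1 + C n \<omega> $ 2"
  by (simp add: nongreen_inner)

lemma T0_le_1: "T0 \<le> 1"
proof -
  obtain \<omega> where "\<omega> \<in> space M" using not_empty by auto
  from content_coords[OF this, of 0] show ?thesis by (simp add: nongreen_inner C_0[OF \<open>\<omega> \<in> space M\<close>])
qed

lemma ones_eigenvector: "Q *v 1 = 1 *\<^sub>R 1"
  using stochastic_ones[OF Q_stochastic] by simp

lemma T_bounds:
  assumes "\<omega> \<in> space M"
  shows "0 \<le> T n \<omega>" "T n \<omega> \<le> real (Suc n)" "T0 \<le> T n \<omega>" "T (Suc n) \<omega> \<le> T n \<omega> + s"
proof -
  show "0 \<le> T n \<omega>" "T n \<omega> \<le> real (Suc n)"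
    using content_coords[OF assms, of n] by (simp_all add: T_eq)
  have step: "T n \<omega> \<le> T (Suc n) \<omega> \<and> T (Suc n) \<omega> \<le> T n \<omega> + s" for n
    using exhaust_3[of "draw (Suc n) \<omega>"] s_pos
    by (auto simp: C_Suc[OF assms] nongreen_row[OF ones_eigenvector])
  then show "T (Suc n) \<omega> \<le> T n \<omega> + s" by blast
  have "T 0 \<omega> \<le> T n \<omega>"
    using lift_Suc_mono_le[of "\<lambda>n. T n \<omega>" 0 n] step by blast
  then show "T0 \<le> T n \<omega>" by (simp add: C_0[OF assms])
qed

lemma transition_X:
  assumes \<eta>: "Q *v \<eta> = \<mu> *\<^sub>R \<eta>" and \<omega>: "\<omega> \<in> space M"
  shows "(\<Sum>i\<in>UNIV. C n \<omega> $ i / real (Suc n) * (nongreen (C n \<omega> + row i (triangular_matrix s Q)) \<bullet> \<eta>))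
      = X \<eta> n \<omega> * (1 + s * \<mu> / real (Suc n))"
    and "(\<Sum>i\<in>UNIV. C n \<omega> $ i / real (Suc n) * (nongreen (C n \<omega> + row i (triangular_matrix s Q)) \<bullet> \<eta>)\<^sup>2)
      = (X \<eta> n \<omega>)\<^sup>2 * (1 + 2 * (s * \<mu>) / real (Suc n)) + (s * \<mu>)\<^sup>2 / real (Suc n) * X (\<chi> i. (\<eta> $ i)\<^sup>2) n \<omega>"
proof -
  define N where "N = real (Suc n)"
  have N: "N > 0" by (simp add: N_def)
  note c = content_coords[OF \<omega>, of n, folded N_def]
  have c3: "C n \<omega> $ 3 = N - C n \<omega> $ 1 - C n \<omega> $ 2" using c(4) by simp
  show "(\<Sum>i\<in>UNIV. C n \<omega> $ i / real (Suc n) * (nongreen (C n \<omega> + row i (triangular_matrix s Q)) \<bullet> \<eta>))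
      = X \<eta> n \<omega> * (1 + s * \<mu> / real (Suc n))"
    unfolding N_def[symmetric] sum_3 nongreen_row[OF \<eta>] unfolding c3 nongreen_inner
    using N by (simp add: field_simps)
  show "(\<Sum>i\<in>UNIV. C n \<omega> $ i / real (Suc n) * (nongreen (C n \<omega> + row i (triangular_matrix s Q)) \<bullet> \<eta>)\<^sup>2)
      = (X \<eta> n \<omega>)\<^sup>2 * (1 + 2 * (s * \<mu>) / real (Suc n)) + (s * \<mu>)\<^sup>2 / real (Suc n) * X (\<chi> i. (\<eta> $ i)\<^sup>2) n \<omega>"
    unfolding N_def[symmetric] sum_3 nongreen_row[OF \<eta>] unfolding c3 nongreen_inner
    using N by (simp add: power2_eq_square field_simps)
qed

lemma expectation_X_Suc:
  assumes \<eta>: "Q *v \<eta> = \<mu> *\<^sub>R \<eta>"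
  shows "expectation (X \<eta> (Suc n)) = expectation (X \<eta> n) * (1 + s * \<mu> / real (Suc n))"
    and "expectation (\<lambda>\<omega>. (X \<eta> (Suc n) \<omega>)\<^sup>2) = expectation (\<lambda>\<omega>. (X \<eta> n \<omega>)\<^sup>2) * (1 + 2 * (s * \<mu>) / real (Suc n))
      + (s * \<mu>)\<^sup>2 / real (Suc n) * expectation (X (\<chi> i. (\<eta> $ i)\<^sup>2) n)"
proof -
  have "expectation (X \<eta> (Suc n)) = expectation (\<lambda>\<omega>. X \<eta> n \<omega> * (1 + s * \<mu> / real (Suc n)))"
    unfolding expectation_Suc[of "\<lambda>c. nongreen c \<bullet> \<eta>"]
    by (intro Bochner_Integration.integral_cong refl transition_X(1)[OF \<eta>])
  then show "expectation (X \<eta> (Suc n)) = expectation (X \<eta> n) * (1 + s * \<mu> / real (Suc n))" by simp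
  note i1 = integrable_fun_C[of "\<lambda>c. (nongreen c \<bullet> \<eta>)\<^sup>2" n]
    and i2 = integrable_fun_C[of "\<lambda>c. nongreen c \<bullet> (\<chi> i. (\<eta> $ i)\<^sup>2)" n]
  have "expectation (\<lambda>\<omega>. (X \<eta> (Suc n) \<omega>)\<^sup>2) = expectation (\<lambda>\<omega>. (X \<eta> n \<omega>)\<^sup>2 * (1 + 2 * (s * \<mu>) / real (Suc n))
      + (s * \<mu>)\<^sup>2 / real (Suc n) * X (\<chi> i. (\<eta> $ i)\<^sup>2) n \<omega>)"
    unfolding expectation_Suc[of "\<lambda>c. (nongreen c \<bullet> \<eta>)\<^sup>2"]
    by (intro Bochner_Integration.integral_cong refl transition_X(2)[OF \<eta>])
  also have "\<dots> = expectation (\<lambda>\<omega>. (X \<eta> n \<omega>)\<^sup>2) * (1 + 2 * (s * \<mu>) / real (Suc n))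
      + (s * \<mu>)\<^sup>2 / real (Suc n) * expectation (X (\<chi> i. (\<eta> $ i)\<^sup>2) n)"
    using i1 i2 by simp
  finally show "expectation (\<lambda>\<omega>. (X \<eta> (Suc n) \<omega>)\<^sup>2) = \<dots>" .
qed

lemma expectation_initial: "expectation (\<lambda>\<omega>. f (C 0 \<omega>)) = f c\<^sub>0" for f :: "real^3 \<Rightarrow> real"
proof -
  have "expectation (\<lambda>\<omega>. f (C 0 \<omega>)) = expectation (\<lambda>_. f c\<^sub>0)"
    by (rule Bochner_Integration.integral_cong) (auto simp: C_0)
  then show ?thesis by (simp add: prob_space)
qed

lemma expectation_X:
  assumes \<eta>: "Q *v \<eta> = \<mu> *\<^sub>R \<eta>"
  shows "expectation (X \<eta> n) = (nongreen c\<^sub>0 \<bullet> \<eta>) * Pi_prod n (s * \<mu>)"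
proof (induction n)
  case 0
  then show ?case using expectation_initial[of "\<lambda>c. nongreen c \<bullet> \<eta>"] by simp
next
  case (Suc n)
  then show ?case using expectation_X_Suc(1)[OF \<eta>, of n] by (simp add: Pi_prod_Suc del: of_nat_Suc)
qed

lemma expectation_T: "expectation (T n) = T0 * Pi_prod n s"
  using expectation_X[OF ones_eigenvector] by simp

lemma martingale_X:
  assumes \<eta>: "Q *v \<eta> = \<mu> *\<^sub>R \<eta>" and \<mu>: "s * \<mu> > - 1"
  shows "L2_martingale M F (\<lambda>n \<omega>. X \<eta> n \<omega> / Pi_prod n (s * \<mu>))"
proof (unfold_locales, goal_cases)
  case (1 n) show ?case by (rule F_subalgebra)
next
  case (2 m n) then show ?case by (rule F_mono)
next
  case 3
  show ?case unfolding martingale_def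
  proof (intro allI conjI)
    fix n
    show "(\<lambda>\<omega>. X \<eta> n \<omega> / Pi_prod n (s * \<mu>)) \<in> borel_measurable (F n)"
      using measurable_fun_C_F[of n n "\<lambda>c. nongreen c \<bullet> \<eta> / Pi_prod n (s * \<mu>)"] by simp
    show "integrable M (\<lambda>\<omega>. X \<eta> n \<omega> / Pi_prod n (s * \<mu>))"
      by (rule integrable_fun_C)
    have P: "Pi_prod (Suc n) (s * \<mu>) = Pi_prod n (s * \<mu>) * (1 + s * \<mu> / real (Suc n))"
      by (rule Pi_prod_Suc)
    have pos: "Pi_prod n (s * \<mu>) > 0" "1 + s * \<mu> / real (Suc n) > 0"
      using \<mu> by (auto intro: Pi_prod_pos Pi_factor_pos simp del: of_nat_Suc)
    have "AE \<omega> in M. real_cond_exp M (F n) (\<lambda>\<omega>. X \<eta> (Suc n) \<omega> / Pi_prod (Suc n) (s * \<mu>)) \<omega>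
        = (\<Sum>i\<in>UNIV. C n \<omega> $ i / real (Suc n)
            * (nongreen (C n \<omega> + row i (triangular_matrix s Q)) \<bullet> \<eta> / Pi_prod (Suc n) (s * \<mu>)))"
      by (rule cond_exp_Suc)
    with AE_space
    show "AE \<omega> in M. real_cond_exp M (F n) (\<lambda>\<omega>. X \<eta> (Suc n) \<omega> / Pi_prod (Suc n) (s * \<mu>)) \<omega>
        = X \<eta> n \<omega> / Pi_prod n (s * \<mu>)"
    proof eventually_elim
      fix \<omega> assume \<omega>: "\<omega> \<in> space M"
        and ce: "real_cond_exp M (F n) (\<lambda>\<omega>. X \<eta> (Suc n) \<omega> / Pi_prod (Suc n) (s * \<mu>)) \<omega>
        = (\<Sum>i\<in>UNIV. C n \<omega> $ i / real (Suc n)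
            * (nongreen (C n \<omega> + row i (triangular_matrix s Q)) \<bullet> \<eta> / Pi_prod (Suc n) (s * \<mu>)))"
      show "real_cond_exp M (F n) (\<lambda>\<omega>. X \<eta> (Suc n) \<omega> / Pi_prod (Suc n) (s * \<mu>)) \<omega> = X \<eta> n \<omega> / Pi_prod n (s * \<mu>)"
        unfolding ce unfolding times_divide_eq_right sum_divide_distrib[symmetric]
        unfolding times_divide_eq_left[symmetric] transition_X(1)[OF \<eta> \<omega>] P
        using pos by simp
    qed
  qed
next
  case (4 n)
  show ?case using square_integrable_fun_C[of "\<lambda>c. nongreen c \<bullet> \<eta> / Pi_prod n (s * \<mu>)" n] by simp
qed

abbreviation sum_sq :: "real^2 \<Rightarrow> real" where
  "sum_sq \<eta> \<equiv> (\<eta> $ 1)\<^sup>2 + (\<eta> $ 2)\<^sup>2"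

lemma X_squares_bounds:
  assumes "\<omega> \<in> space M"
  shows "0 \<le> X (\<chi> i. (\<eta> $ i)\<^sup>2) n \<omega>" "X (\<chi> i. (\<eta> $ i)\<^sup>2) n \<omega> \<le> sum_sq \<eta> * T n \<omega>"
  using content_coords[OF assms, of n] by (auto simp: nongreen_inner algebra_simps)

lemma second_moment_step:
  assumes \<eta>: "Q *v \<eta> = \<mu> *\<^sub>R \<eta>"
  shows "expectation (\<lambda>\<omega>. (X \<eta> (Suc n) \<omega>)\<^sup>2)
    \<le> expectation (\<lambda>\<omega>. (X \<eta> n \<omega>)\<^sup>2) * (1 + 2 * (s * \<mu>) / real (Suc n))
      + (s * \<mu>)\<^sup>2 * sum_sq \<eta> * T0 * (Pi_prod n s / real (Suc n))"
proof -
  have "expectation (X (\<chi> i. (\<eta> $ i)\<^sup>2) n) \<le> expectation (\<lambda>\<omega>. sum_sq \<eta> * T n \<omega>)"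
    by (intro integral_mono integrable_fun_C integrable_mult_right X_squares_bounds)
  also have "\<dots> = sum_sq \<eta> * T0 * Pi_prod n s" by (simp add: expectation_T)
  finally have "(s * \<mu>)\<^sup>2 / real (Suc n) * expectation (X (\<chi> i. (\<eta> $ i)\<^sup>2) n)
      \<le> (s * \<mu>)\<^sup>2 / real (Suc n) * (sum_sq \<eta> * T0 * Pi_prod n s)"
    by (intro mult_left_mono) auto
  then show ?thesis unfolding expectation_X_Suc(2)[OF \<eta>] by (simp add: algebra_simps)
qed

text \<open>The squared conditional mean of an increment is dropped; its conditional second moment is at
  most a multiple of the probability \<open>T n / (n + 1)\<close> of drawing a white or black ball.\<close>

lemma martingale_second_moment_step:
  assumes \<eta>: "Q *v \<eta> = \<mu> *\<^sub>R \<eta>" and \<mu>: "s * \<mu> > - 1"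
  shows "expectation (\<lambda>\<omega>. (X \<eta> (Suc n) \<omega> / Pi_prod (Suc n) (s * \<mu>))\<^sup>2)
      - expectation (\<lambda>\<omega>. (X \<eta> n \<omega> / Pi_prod n (s * \<mu>))\<^sup>2)
    \<le> (s * \<mu>)\<^sup>2 * sum_sq \<eta> * T0 * (Pi_prod n s / (real (Suc n) * (Pi_prod (Suc n) (s * \<mu>))\<^sup>2))"
proof -
  define P where "P = Pi_prod n (s * \<mu>)"
  define q where "q = 1 + s * \<mu> / real (Suc n)"
  define x where "x = expectation (\<lambda>\<omega>. (X \<eta> n \<omega>)\<^sup>2)"
  have pos: "P > 0" "q > 0" using \<mu> by (auto simp: P_def q_def intro: Pi_prod_pos Pi_factor_pos simp del: of_nat_Suc)
  have P': "Pi_prod (Suc n) (s * \<mu>) = P * q" by (simp add: P_def q_def Pi_prod_Suc)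
  have x0: "x \<ge> 0" by (simp add: x_def)
  have "1 + 2 * (s * \<mu>) / real (Suc n) \<le> q\<^sup>2"
    by (simp add: q_def power2_sum)
  then have "x * (1 + 2 * (s * \<mu>) / real (Suc n)) \<le> x * q\<^sup>2" using x0 by (rule mult_left_mono)
  then have "expectation (\<lambda>\<omega>. (X \<eta> (Suc n) \<omega>)\<^sup>2) - x * q\<^sup>2
      \<le> (s * \<mu>)\<^sup>2 * sum_sq \<eta> * T0 * (Pi_prod n s / real (Suc n))"
    using second_moment_step[OF \<eta>, of n] unfolding x_def by linarith
  then have "(expectation (\<lambda>\<omega>. (X \<eta> (Suc n) \<omega>)\<^sup>2) - x * q\<^sup>2) / (P * q)\<^sup>2
      \<le> ((s * \<mu>)\<^sup>2 * sum_sq \<eta> * T0 * (Pi_prod n s / real (Suc n))) / (P * q)\<^sup>2"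
    by (rule divide_right_mono) simp
  moreover have "(expectation (\<lambda>\<omega>. (X \<eta> (Suc n) \<omega>)\<^sup>2) - x * q\<^sup>2) / (P * q)\<^sup>2
      = expectation (\<lambda>\<omega>. (X \<eta> (Suc n) \<omega> / Pi_prod (Suc n) (s * \<mu>))\<^sup>2)
      - expectation (\<lambda>\<omega>. (X \<eta> n \<omega> / Pi_prod n (s * \<mu>))\<^sup>2)"
    using pos by (simp add: P' P_def[symmetric] x_def power_divide diff_divide_distrib power_mult_distrib)
  ultimately show ?thesis by (simp add: P' mult.assoc)
qed

text \<open>The terms are of order \<open>n\<close> to the power \<open>s - 1 - 2 s \<mu>\<close>: the threshold \<open>1/2\<close> for the eigenvalue
  is where this exponent passes \<open>- 1\<close>.\<close>

lemma summable_variance_bound: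
  assumes "\<mu> > 1/2"
  shows "summable (\<lambda>n. Pi_prod n s / (real (Suc n) * (Pi_prod (Suc n) (s * \<mu>))\<^sup>2))"
proof -
  have sl: "s * \<mu> > 0" using s_pos assms by simp
  obtain b where b: "b > 0" "\<And>n. Pi_prod n s \<le> b * real (n + 1) powr s"
    using Pi_prod_bounds[of s] s_pos by (metis less_trans neg_less_0_iff_less zero_less_one)
  obtain a where a: "a > 0" "\<And>n. a * real (n + 1) powr (s * \<mu>) \<le> Pi_prod n (s * \<mu>)"
    using Pi_prod_bounds[of "s * \<mu>"] sl by (metis less_trans neg_less_0_iff_less zero_less_one)
  have ex: "s - 1 - 2 * (s * \<mu>) < - 1"
    using assms s_pos by (simp add: field_simps)
  have "summable (\<lambda>n. real (Suc n) powr (s - 1 - 2 * (s * \<mu>)))"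
    using ex by (subst summable_Suc_iff) (simp add: summable_real_powr_iff)
  then have "summable (\<lambda>n. b / a\<^sup>2 * real (Suc n) powr (s - 1 - 2 * (s * \<mu>)))"
    by (rule summable_mult)
  then show ?thesis
  proof (rule summable_comparison_test'[where N = 0])
    fix n :: nat
    define y where "y = real (Suc n)"
    have y: "y > 0" by (simp add: y_def)
    have 1: "Pi_prod n s \<le> b * y powr s" using b(2)[of n] by (simp add: y_def add.commute)
    have "a * y powr (s * \<mu>) \<le> Pi_prod n (s * \<mu>)" using a(2)[of n] by (simp add: y_def add.commute)
    also have "\<dots> \<le> Pi_prod (Suc n) (s * \<mu>)" using sl by (intro Pi_prod_mono) auto
    finally have 2: "(a * y powr (s * \<mu>))\<^sup>2 \<le> (Pi_prod (Suc n) (s * \<mu>))\<^sup>2"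
      using a(1) by (intro power_mono) auto
    have "Pi_prod n s / (y * (Pi_prod (Suc n) (s * \<mu>))\<^sup>2) \<le> b * y powr s / (y * (a * y powr (s * \<mu>))\<^sup>2)"
      using 1 2 a(1) y b(1) by (intro frac_le mult_mono mult_pos_pos) auto
    also have "\<dots> = b / a\<^sup>2 * y powr (s - 1 - 2 * (s * \<mu>))"
    proof -
      have "y powr (s - 1 - 2 * (s * \<mu>)) = y powr s / (y * (y powr (s * \<mu>))\<^sup>2)"
        unfolding powr_diff mult_2 powr_add power2_eq_square using y by (simp add: mult.assoc)
      then show ?thesis by (simp add: power_mult_distrib)
    qed
    finally have "Pi_prod n s / (y * (Pi_prod (Suc n) (s * \<mu>))\<^sup>2) \<le> b / a\<^sup>2 * y powr (s - 1 - 2 * (s * \<mu>))" .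
    moreover have "0 \<le> Pi_prod n s / (y * (Pi_prod (Suc n) (s * \<mu>))\<^sup>2)"
      using y Pi_prod_pos[of s n] s_pos by simp
    ultimately show "norm (Pi_prod n s / (real (Suc n) * (Pi_prod (Suc n) (s * \<mu>))\<^sup>2))
        \<le> b / a\<^sup>2 * real (Suc n) powr (s - 1 - 2 * (s * \<mu>))"
      unfolding y_def[symmetric] by (simp only: real_norm_def abs_of_nonneg)
  qed
qed

lemma martingale_X_L2_bounded:
  assumes \<eta>: "Q *v \<eta> = \<mu> *\<^sub>R \<eta>" and \<mu>: "\<mu> > 1/2"
  obtains B where "\<And>n. expectation (\<lambda>\<omega>. (X \<eta> n \<omega> / Pi_prod n (s * \<mu>))\<^sup>2) \<le> B"
proof -
  define v where "v n = expectation (\<lambda>\<omega>. (X \<eta> n \<omega> / Pi_prod n (s * \<mu>))\<^sup>2)" for n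
  define K where "K = (s * \<mu>)\<^sup>2 * sum_sq \<eta> * T0"
  define g where "g n = Pi_prod n s / (real (Suc n) * (Pi_prod (Suc n) (s * \<mu>))\<^sup>2)" for n
  have sl: "s * \<mu> > - 1" using s_pos \<mu> mult_pos_pos[of s \<mu>] by linarith
  have K: "K \<ge> 0" using nongreen_init by (simp add: K_def)
  have g: "g n \<ge> 0" for n using Pi_prod_pos[of s n] s_pos by (simp add: g_def)
  have "v n \<le> v 0 + K * (\<Sum>k<n. g k)" for n
  proof (induction n)
    case (Suc n)
    then show ?case using martingale_second_moment_step[OF \<eta> sl, of n]
      by (simp add: v_def K_def g_def distrib_left)
  qed simp
  moreover have "(\<Sum>k<n. g k) \<le> suminf g" for n
    using summable_variance_bound[OF \<mu>] g unfolding g_def by (intro sum_le_suminf) auto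
  ultimately have "v n \<le> v 0 + K * suminf g" for n
    using K by (meson add_left_mono mult_left_mono order_trans)
  then show ?thesis using that unfolding v_def by blast
qed

text \<open>The second draw already has positive conditional variance: by then the urn contains green
  balls as well as others, since \<open>0 < T 1 \<le> 1 + s < 2\<close>, and the Cauchy--Schwarz inequality
  \<open>(\<Sum>i. S i \<eta> i)\<^sup>2 \<le> (\<Sum>i. S i) (\<Sum>i. S i (\<eta> i)\<^sup>2)\<close> shows that the squared conditional mean of the
  increment is a proper fraction of its conditional second moment.\<close>

lemma second_moment_strict:
  assumes \<eta>: "Q *v \<eta> = \<mu> *\<^sub>R \<eta>" and \<mu>: "s * \<mu> > - 1" "\<mu> \<noteq> 0" and nz: "\<eta> $ 1 \<noteq> 0" "\<eta> $ 2 \<noteq> 0"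
  shows "expectation (\<lambda>\<omega>. (X \<eta> 1 \<omega> / Pi_prod 1 (s * \<mu>))\<^sup>2)
      < expectation (\<lambda>\<omega>. (X \<eta> 2 \<omega> / Pi_prod 2 (s * \<mu>))\<^sup>2)"
proof -
  define m where "m = min ((\<eta> $ 1)\<^sup>2) ((\<eta> $ 2)\<^sup>2)"
  have m: "m > 0" using nz by (simp add: m_def)
  define E2 where "E2 = expectation (X (\<chi> i. (\<eta> $ i)\<^sup>2) 1)"
  define x where "x = expectation (\<lambda>\<omega>. (X \<eta> 1 \<omega>)\<^sup>2)"
  have i: "integrable M (X (\<chi> i. (\<eta> $ i)\<^sup>2) 1)" "integrable M (\<lambda>\<omega>. (X \<eta> 1 \<omega>)\<^sup>2)"
    using integrable_fun_C[of "\<lambda>c. nongreen c \<bullet> (\<chi> i. (\<eta> $ i)\<^sup>2)" 1]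
      integrable_fun_C[of "\<lambda>c. (nongreen c \<bullet> \<eta>)\<^sup>2" 1] by auto
  have "(1 - s) * m * T0 = expectation (\<lambda>_. (1 - s) * m * T0)" by (simp add: prob_space)
  also have "\<dots> \<le> expectation (\<lambda>\<omega>. 2 * X (\<chi> i. (\<eta> $ i)\<^sup>2) 1 \<omega> - (X \<eta> 1 \<omega>)\<^sup>2)"
  proof (rule integral_mono)
    fix \<omega> assume \<omega>: "\<omega> \<in> space M"
    define a b where "a = C 1 \<omega> $ 1" and "b = C 1 \<omega> $ 2"
    have ab: "a \<ge> 0" "b \<ge> 0" using content_coords[OF \<omega>, of 1] by (auto simp: a_def b_def)
    have T1: "a + b \<le> 1 + s"
      using T_bounds(4)[OF \<omega>, of 0] T0_le_1 by (simp add: nongreen_inner a_def b_def C_0[OF \<omega>])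
    have T1': "T0 \<le> a + b" using T_bounds(3)[OF \<omega>, of 1] by (simp add: nongreen_inner a_def b_def)
    define y where "y = a * (\<eta> $ 1)\<^sup>2 + b * (\<eta> $ 2)\<^sup>2"
    have "(a + b) * y - (a * \<eta> $ 1 + b * \<eta> $ 2)\<^sup>2 = a * b * (\<eta> $ 1 - \<eta> $ 2)\<^sup>2"
      by (simp add: y_def power2_eq_square algebra_simps)
    also have "\<dots> \<ge> 0" using ab by simp
    finally have cs: "(a * \<eta> $ 1 + b * \<eta> $ 2)\<^sup>2 \<le> (a + b) * y" by simp
    have "m * (a + b) \<le> y"
      using mult_left_mono[OF min.cobounded1[of "(\<eta> $ 1)\<^sup>2" "(\<eta> $ 2)\<^sup>2"] ab(1)]
        mult_left_mono[OF min.cobounded2[of "(\<eta> $ 1)\<^sup>2" "(\<eta> $ 2)\<^sup>2"] ab(2)]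
      by (simp add: y_def m_def algebra_simps)
    moreover have "m * T0 \<le> m * (a + b)" using T1' m by (intro mult_left_mono) auto
    ultimately have y: "m * T0 \<le> y" by simp
    have y0: "y \<ge> 0" using ab by (simp add: y_def)
    have "(1 - s) * m * T0 \<le> (1 - s) * y" using y s_less by (simp add: mult.assoc mult_left_mono)
    also have "\<dots> \<le> (2 - (a + b)) * y" using T1 y0 by (intro mult_right_mono) auto
    also have "\<dots> \<le> 2 * y - (a * \<eta> $ 1 + b * \<eta> $ 2)\<^sup>2" using cs by (simp add: algebra_simps)
    finally show "(1 - s) * m * T0 \<le> 2 * X (\<chi> i. (\<eta> $ i)\<^sup>2) 1 \<omega> - (X \<eta> 1 \<omega>)\<^sup>2"
      by (simp add: nongreen_inner a_def b_def y_def)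
  qed (use i in auto)
  also have "\<dots> = 2 * E2 - x" using i by (simp add: E2_def x_def)
  finally have gap: "2 * E2 - x > 0"
    using m nongreen_init s_less by (smt (verit) mult_pos_pos)
  define P where "P = Pi_prod 1 (s * \<mu>)"
  define q where "q = 1 + s * \<mu> / 2"
  have P': "Pi_prod 2 (s * \<mu>) = P * q"
    by (simp add: P_def q_def Pi_prod_Suc numeral_2_eq_2)
  have pos: "P > 0" "q > 0" using \<mu> by (auto simp: P_def q_def Pi_prod_pos)
  have "expectation (\<lambda>\<omega>. (X \<eta> 2 \<omega>)\<^sup>2) = x * (1 + s * \<mu>) + (s * \<mu>)\<^sup>2 / 2 * E2"
    using expectation_X_Suc(2)[OF \<eta>, of 1] by (simp add: x_def E2_def numeral_2_eq_2)
  also have "\<dots> = x * q\<^sup>2 + (s * \<mu>)\<^sup>2 / 4 * (2 * E2 - x)"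
    by (simp add: q_def power2_eq_square field_simps)
  also have "\<dots> > x * q\<^sup>2" using gap \<mu> s_pos by simp
  finally have "x * q\<^sup>2 / (P * q)\<^sup>2 < expectation (\<lambda>\<omega>. (X \<eta> 2 \<omega>)\<^sup>2) / (P * q)\<^sup>2"
    using pos by (intro divide_strict_right_mono) auto
  moreover have "x * q\<^sup>2 / (P * q)\<^sup>2 = x / P\<^sup>2" using pos by (simp add: power_mult_distrib)
  ultimately show ?thesis unfolding P' P_def[symmetric] power_divide
    by (simp add: x_def del: One_nat_def)
qed

theorem eigenvector_functional_limit:
  assumes \<eta>: "Q *v \<eta> = \<mu> *\<^sub>R \<eta>" and \<mu>: "\<mu> > 1/2" and nz: "\<eta> $ 1 \<noteq> 0" "\<eta> $ 2 \<noteq> 0"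
  obtains V where "V \<in> borel_measurable M"
    "AE \<omega> in M. (\<lambda>n. X \<eta> n \<omega> / Pi_prod n (s * \<mu>)) \<longlonglongrightarrow> V \<omega>"
    "converges_in_L2 M (\<lambda>n \<omega>. X \<eta> n \<omega> / Pi_prod n (s * \<mu>)) V"
    "expectation V = nongreen c\<^sub>0 \<bullet> \<eta>" "nondegenerate M V"
proof -
  define Z where "Z n \<omega> = X \<eta> n \<omega> / Pi_prod n (s * \<mu>)" for n \<omega>
  have sl: "s * \<mu> > - 1" using s_pos \<mu> mult_pos_pos[of s \<mu>] by linarith
  interpret Z: L2_martingale M F Z
    unfolding Z_def[abs_def] by (rule martingale_X[OF \<eta> sl])
  obtain B where "\<And>n. expectation (\<lambda>\<omega>. (Z n \<omega>)\<^sup>2) \<le> B"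
    using martingale_X_L2_bounded[OF \<eta> \<mu>] unfolding Z_def by metis
  then obtain V where V: "V \<in> borel_measurable M" "AE \<omega> in M. (\<lambda>n. Z n \<omega>) \<longlonglongrightarrow> V \<omega>" "converges_in_L2 M Z V"
    by (rule Z.L2_bounded_converges)
  have Z0: "expectation (Z 0) = nongreen c\<^sub>0 \<bullet> \<eta>" "expectation (\<lambda>\<omega>. (Z 0 \<omega>)\<^sup>2) = (nongreen c\<^sub>0 \<bullet> \<eta>)\<^sup>2"
    using expectation_initial[of "\<lambda>c. nongreen c \<bullet> \<eta>"] expectation_initial[of "\<lambda>c. (nongreen c \<bullet> \<eta>)\<^sup>2"]
    by (simp_all add: Z_def[abs_def])
  have EZ: "expectation (Z n) = nongreen c\<^sub>0 \<bullet> \<eta>" for n using Z.expectation_eq Z0(1) by simp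
  then have EV: "expectation V = nongreen c\<^sub>0 \<bullet> \<eta>"
    using converges_in_L2_expectation[OF prob_space_axioms V(3)] by (simp add: LIMSEQ_const_iff)
  have "nondegenerate M V"
  proof (unfold nondegenerate_def, rule notI)
    assume "\<exists>c. AE \<omega> in M. V \<omega> = c"
    then obtain c where c: "AE \<omega> in M. V \<omega> = c" by blast
    have "expectation V = expectation (\<lambda>_. c)"
      using c V(1) by (intro integral_cong_AE) auto
    then have c_eq: "c = nongreen c\<^sub>0 \<bullet> \<eta>" using EV by (simp add: prob_space)
    \<comment> \<open>the distance to a constant limit would be the variance, which cannot decrease\<close>
    have dist: "(\<integral>\<omega>. (Z n \<omega> - V \<omega>)\<^sup>2 \<partial>M) = expectation (\<lambda>\<omega>. (Z n \<omega>)\<^sup>2) - c\<^sup>2" for n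
    proof -
      have i: "integrable M (Z n)" "integrable M (\<lambda>\<omega>. (Z n \<omega>)\<^sup>2)"
        using square_integrable_integrable[OF prob_space_axioms Z.sq[of n]] Z.sq[of n]
        by (simp_all only: square_integrable_def)
      have "(\<integral>\<omega>. (Z n \<omega> - V \<omega>)\<^sup>2 \<partial>M) = variance (Z n)"
      proof (rule integral_cong_AE)
        show "AE \<omega> in M. (Z n \<omega> - V \<omega>)\<^sup>2 = (Z n \<omega> - expectation (Z n))\<^sup>2"
          using c by eventually_elim (simp only: EZ c_eq)
      qed (use V(1) i in auto)
      then show ?thesis unfolding variance_eq[OF i] unfolding EZ c_eq .
    qed
    have "expectation (\<lambda>\<omega>. (Z 2 \<omega>)\<^sup>2) - c\<^sup>2 \<le> 0"
    proof (rule LIMSEQ_le_const)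
      show "(\<lambda>n. \<integral>\<omega>. (Z n \<omega> - V \<omega>)\<^sup>2 \<partial>M) \<longlonglongrightarrow> 0" using V(3) by (simp add: converges_in_L2_def)
      show "\<exists>N. \<forall>n\<ge>N. expectation (\<lambda>\<omega>. (Z 2 \<omega>)\<^sup>2) - c\<^sup>2 \<le> (\<integral>\<omega>. (Z n \<omega> - V \<omega>)\<^sup>2 \<partial>M)"
        unfolding dist using Z.second_moment_mono by (intro exI[of _ 2]) simp
    qed
    moreover have "expectation (\<lambda>\<omega>. (Z 0 \<omega>)\<^sup>2) \<le> expectation (\<lambda>\<omega>. (Z 1 \<omega>)\<^sup>2)"
      by (rule Z.second_moment_mono) simp
    moreover have "expectation (\<lambda>\<omega>. (Z 1 \<omega>)\<^sup>2) < expectation (\<lambda>\<omega>. (Z 2 \<omega>)\<^sup>2)"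
      unfolding Z_def by (rule second_moment_strict[OF \<eta> sl _ nz]) (use \<mu> in auto)
    ultimately show False using Z0 c_eq by simp
  qed
  then show ?thesis using that V EV unfolding Z_def[abs_def] by blast
qed

end

section \<open>Positivity of the limit of the white and black mass\<close>

text \<open>Log-convexity of \<open>\<Gamma>\<close> on the segment from \<open>x - e\<close> to \<open>x - e + 1\<close>, which contains \<open>x\<close>; the
  functional equation makes the bound explicit.\<close>

lemma Gamma_ratio_lower_bound:
  fixes x e :: real
  assumes e: "0 < e" "e < 1" and x: "e < x"
  shows "x powr (- e) \<le> Gamma (x - e) / Gamma x"
proof -
  have pos: "Gamma x > 0" "Gamma (x - e) > 0" using e x by (auto intro: Gamma_real_pos)
  have G1: "Gamma (x - e + 1) = (x - e) * Gamma (x - e)"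
    using x by (intro Gamma_plus1) auto
  have "(ln \<circ> Gamma) ((1 - e) *\<^sub>R (x - e) + e *\<^sub>R (x - e + 1))
      \<le> (1 - e) * (ln \<circ> Gamma) (x - e) + e * (ln \<circ> Gamma) (x - e + 1)"
    by (rule convex_onD[OF log_convex_Gamma_real]) (use e x in auto)
  also have "(1 - e) *\<^sub>R (x - e) + e *\<^sub>R (x - e + 1) = x" by (simp add: algebra_simps)
  also have "(1 - e) * (ln \<circ> Gamma) (x - e) + e * (ln \<circ> Gamma) (x - e + 1)
      = ln (Gamma (x - e)) + e * ln (x - e)"
  proof -
    have "ln (Gamma (x - e + 1)) = ln (x - e) + ln (Gamma (x - e))"
      unfolding G1 by (rule ln_mult_pos) (use x pos in auto)
    then show ?thesis by (simp only: o_def) (simp add: algebra_simps)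
  qed
  also have "\<dots> \<le> ln (Gamma (x - e)) + e * ln x" using e x by (intro add_left_mono mult_left_mono) auto
  also have "\<dots> = ln (Gamma (x - e) * x powr e)"
  proof -
    have "ln (Gamma (x - e) * x powr e) = ln (Gamma (x - e)) + ln (x powr e)"
      by (rule ln_mult_pos) (use x e pos in auto)
    then show ?thesis using x e by (simp add: ln_powr)
  qed
  finally have "Gamma x \<le> Gamma (x - e) * x powr e"
    using pos x e by (simp add: ln_le_cancel_iff)
  then show ?thesis using pos x e by (simp add: powr_minus field_simps)
qed

text \<open>Factor by factor, \<open>(1 + x)\<^sup>e (1 - e x) \<le> exp (e x) exp (- e x)\<close>.\<close>

lemma Pi_prod_powr_le_1:
  assumes "0 < s" "s < 1" "0 < e" "e < 1"
  shows "Pi_prod n s powr e * Pi_prod n (- (s * e)) \<le> 1"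
proof (induction n)
  case (Suc n)
  define x where "x = s / real (Suc n)"
  have x: "x \<ge> 0" using assms by (simp add: x_def)
  have se: "- (s * e) > - 1" using assms mult_strict_mono[of s 1 e 1] by simp
  have pos: "Pi_prod n s > 0" "Pi_prod n (- (s * e)) > 0" using Pi_prod_pos[of s n] Pi_prod_pos[OF se] assms by auto
  have f: "1 + - (s * e) / real (Suc n) = 1 - e * x" by (simp add: x_def)
  have f0: "1 - e * x > 0" using Pi_factor_pos[OF se, of n] unfolding f .
  have "(1 + x) powr e = exp (e * ln (1 + x))" using x by (simp add: powr_def)
  also have "\<dots> \<le> exp (e * x)" using assms x ln_add_one_self_le_self[of x] by simp
  finally have "(1 + x) powr e * (1 - e * x) \<le> exp (e * x) * exp (- (e * x))"
    using exp_ge_add_one_self[of "- (e * x)"] f0 by (intro mult_mono) auto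
  then have le: "(1 + x) powr e * (1 - e * x) \<le> 1" by (simp add: exp_minus)
  have "Pi_prod (Suc n) s powr e * Pi_prod (Suc n) (- (s * e))
      = (Pi_prod n s powr e * Pi_prod n (- (s * e))) * ((1 + x) powr e * (1 - e * x))"
    unfolding Pi_prod_Suc f x_def[symmetric] using pos x by (simp add: powr_mult)
  also have "\<dots> \<le> 1 * 1" using Suc le pos f0 by (intro mult_mono) auto
  finally show ?case by simp
qed simp

context triangular_urn
begin

text \<open>In the units \<open>x = T / s\<close> a draw increases \<open>x\<close> by \<open>1\<close> with probability \<open>s x / (n + 1)\<close>, and
  \<open>h x = \<Gamma>(x - e) / \<Gamma>(x)\<close> satisfies \<open>h (x + 1) - h x = - e h x / x\<close>. Hence \<open>h\<close>, which is comparable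
  to \<open>x\<^sup>-\<^sup>e\<close>, has an explicit expectation: \<open>T\<close> has a negative moment of the right order.\<close>

lemma expectation_Gamma_ratio:
  assumes e: "0 < e" "e < T0 / s"
  shows "expectation (\<lambda>\<omega>. Gamma (T n \<omega> / s - e) / Gamma (T n \<omega> / s))
    = Gamma (T0 / s - e) / Gamma (T0 / s) * Pi_prod n (- (s * e))"
proof (induction n)
  case 0
  then show ?case
    using expectation_initial[of "\<lambda>c. Gamma (nongreen c \<bullet> 1 / s - e) / Gamma (nongreen c \<bullet> 1 / s)"] by simp
next
  case (Suc n)
  define h where "h x = Gamma (x - e) / Gamma x" for x :: real
  have "expectation (\<lambda>\<omega>. h (T (Suc n) \<omega> / s))
      = expectation (\<lambda>\<omega>. \<Sum>i\<in>UNIV. C n \<omega> $ i / real (Suc n)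
          * h (nongreen (C n \<omega> + row i (triangular_matrix s Q)) \<bullet> 1 / s))"
    by (rule expectation_Suc)
  also have "\<dots> = expectation (\<lambda>\<omega>. h (T n \<omega> / s) * (1 + - (s * e) / real (Suc n)))"
  proof (rule Bochner_Integration.integral_cong[OF refl])
    fix \<omega> assume \<omega>: "\<omega> \<in> space M"
    define N where "N = real (Suc n)"
    have N: "N > 0" by (simp add: N_def)
    note c = content_coords[OF \<omega>, of n, folded N_def]
    define x where "x = T n \<omega> / s"
    have xe: "x > e"
      using e(2) divide_right_mono[OF T_bounds(3)[OF \<omega>, of n], of s] s_pos by (simp add: x_def)
    have h: "h (x + 1) = h x * (1 - e / x)"
    proof -
      have "Gamma (x + 1) = x * Gamma x" "Gamma (x - e + 1) = (x - e) * Gamma (x - e)"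
        using xe e by (auto intro!: Gamma_plus1)
      then show ?thesis using xe e by (simp add: h_def field_simps)
    qed
    have x1: "(T n \<omega> + s * 1 * (1 :: real^2) $ i) / s = x + 1" for i using s_pos by (simp add: x_def add_divide_distrib)
    have c12: "C n \<omega> $ 1 + C n \<omega> $ 2 = s * x" using s_pos by (simp add: x_def T_eq)
    have c3: "C n \<omega> $ 3 = N - s * x" using c(4) c12 by simp
    have "(\<Sum>i\<in>UNIV. C n \<omega> $ i / N * h (nongreen (C n \<omega> + row i (triangular_matrix s Q)) \<bullet> 1 / s))
        = (C n \<omega> $ 1 + C n \<omega> $ 2) / N * h (x + 1) + C n \<omega> $ 3 / N * h x"
      unfolding sum_3 nongreen_row[OF ones_eigenvector]
      unfolding x1 x_def[symmetric] by (simp add: add_divide_distrib distrib_right)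
    also have "\<dots> = h x * (1 + - (s * e) / N)"
      unfolding c12 c3 h using N xe e by (simp add: field_simps)
    finally show "(\<Sum>i\<in>UNIV. C n \<omega> $ i / real (Suc n) * h (nongreen (C n \<omega> + row i (triangular_matrix s Q)) \<bullet> 1 / s))
        = h (T n \<omega> / s) * (1 + - (s * e) / real (Suc n))"
      by (simp only: N_def x_def)
  qed
  also have "\<dots> = expectation (\<lambda>\<omega>. h (T n \<omega> / s)) * (1 + - (s * e) / real (Suc n))" by simp
  finally show ?case using Suc.IH by (simp add: h_def Pi_prod_Suc del: of_nat_Suc)
qed

text \<open>The negative moment bounds the Laplace transform of the limit by a multiple of \<open>\<theta>\<^sup>-\<^sup>e\<close>, and the
  Laplace transform dominates the mass at \<open>0\<close>.\<close>

lemma mass_limit_positive: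
  assumes U: "U \<in> borel_measurable M" and lim: "AE \<omega> in M. (\<lambda>n. T n \<omega> / Pi_prod n s) \<longlonglongrightarrow> U \<omega>"
  shows "AE \<omega> in M. 0 < U \<omega>"
proof -
  \<comment> \<open>below \<open>T0 / s\<close> for positive arguments of \<open>\<Gamma>\<close>, below \<open>1\<close> for log-convexity\<close>
  define e where "e = min (T0 / s) 1 / 2"
  have e: "0 < e" "e < T0 / s" "e < 1" using nongreen_init s_pos by (auto simp: e_def min_def field_simps)
  define K where "K = Gamma (T0 / s - e) / Gamma (T0 / s) / s powr e"
  have K0: "K \<ge> 0" using e by (auto simp: K_def intro!: divide_nonneg_nonneg less_imp_le Gamma_real_pos)
  have Ppos: "Pi_prod n s > 0" for n using s_pos by (intro Pi_prod_pos) simp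
  have neg: "expectation (\<lambda>\<omega>. exp (- \<theta> * (T n \<omega> / Pi_prod n s))) \<le> \<theta> powr (- e) * K" if \<theta>: "\<theta> > 0" for \<theta> n
  proof -
    have pw: "exp (- \<theta> * (T n \<omega> / Pi_prod n s))
        \<le> \<theta> powr (- e) / s powr e * Pi_prod n s powr e * (Gamma (T n \<omega> / s - e) / Gamma (T n \<omega> / s))"
      if \<omega>: "\<omega> \<in> space M" for \<omega>
    proof -
      have Tp: "T n \<omega> > 0" using T_bounds(3)[OF \<omega>, of n] nongreen_init by simp
      define y where "y = \<theta> * (T n \<omega> / Pi_prod n s)"
      have y: "y > 0" using \<theta> Tp Ppos by (simp add: y_def)
      have "y powr e \<le> exp y"
      proof (cases "y \<le> 1")
        case True
        then have "y powr e \<le> 1" using y e powr_mono2[of e y 1] by simp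
        then show ?thesis using y one_le_exp_iff[of y] by linarith
      next
        case False
        then have "y powr e \<le> y powr 1" using e by (intro powr_mono) auto
        then have "y powr e \<le> y" using y by simp
        then show ?thesis using exp_ge_add_one_self[of y] by linarith
      qed
      then have "exp (- y) \<le> y powr (- e)" using y by (simp add: exp_minus powr_minus le_imp_inverse_le)
      also have "y powr (- e) = \<theta> powr (- e) * (T n \<omega> / s * (s / Pi_prod n s)) powr (- e)"
      proof -
        have "y = \<theta> * (T n \<omega> / s * (s / Pi_prod n s))" using s_pos by (simp add: y_def)
        then show ?thesis using \<theta> Tp Ppos[of n] s_pos by (subst powr_mult[symmetric]) auto
      qed
      also have "(T n \<omega> / s * (s / Pi_prod n s)) powr (- e) = (T n \<omega> / s) powr (- e) * (s / Pi_prod n s) powr (- e)"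
        using Tp Ppos[of n] s_pos by (subst powr_mult) auto
      also have "(s / Pi_prod n s) powr (- e) = Pi_prod n s powr e / s powr e"
        using Ppos[of n] s_pos by (simp add: powr_minus powr_divide)
      also have "\<theta> powr (- e) * ((T n \<omega> / s) powr (- e) * (Pi_prod n s powr e / s powr e))
          \<le> \<theta> powr (- e) * (Gamma (T n \<omega> / s - e) / Gamma (T n \<omega> / s) * (Pi_prod n s powr e / s powr e))"
        using e divide_right_mono[OF T_bounds(3)[OF \<omega>, of n], of s] s_pos
        by (intro mult_left_mono mult_right_mono Gamma_ratio_lower_bound) auto
      finally have "exp (- y) \<le> \<theta> powr (- e) * (Gamma (T n \<omega> / s - e) / Gamma (T n \<omega> / s) * (Pi_prod n s powr e / s powr e))" .
      then show ?thesis by (simp add: y_def mult_ac)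
    qed
    have "expectation (\<lambda>\<omega>. exp (- \<theta> * (T n \<omega> / Pi_prod n s)))
        \<le> expectation (\<lambda>\<omega>. \<theta> powr (- e) / s powr e * Pi_prod n s powr e * (Gamma (T n \<omega> / s - e) / Gamma (T n \<omega> / s)))"
      by (intro integral_mono integrable_mult_right integrable_fun_C pw)
    also have "\<dots> = \<theta> powr (- e) * K * (Pi_prod n s powr e * Pi_prod n (- (s * e)))"
      unfolding integral_mult_right_zero expectation_Gamma_ratio[OF e(1,2)] K_def by (simp add: mult_ac)
    also have "\<dots> \<le> \<theta> powr (- e) * K * 1"
      using Pi_prod_powr_le_1[OF s_pos s_less e(1,3)] K0 by (intro mult_left_mono) auto
    finally show ?thesis by simp
  qed
  have tail: "prob {\<omega>\<in>space M. U \<omega> \<le> 0} \<le> \<theta> powr (- e) * K" if \<theta>: "\<theta> > 0" for \<theta>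
  proof -
    define G where "G n \<omega> = exp (- \<theta> * (T n \<omega> / Pi_prod n s))" for n \<omega>
    define E where "E \<omega> = exp (- \<theta> * U \<omega>)" for \<omega>
    have G1: "norm (G n \<omega>) \<le> 1" if "\<omega> \<in> space M" for n \<omega>
      using T_bounds(1)[OF that, of n] \<theta> Ppos[of n] by (simp add: G_def)
    have Glim: "AE \<omega> in M. (\<lambda>n. G n \<omega>) \<longlonglongrightarrow> E \<omega>"
      using lim unfolding G_def E_def
      by eventually_elim (intro tendsto_exp tendsto_mult tendsto_const)
    have Gm: "G n \<in> borel_measurable M" for n
      unfolding G_def[abs_def] by (rule measurable_fun_C)
    have Em: "E \<in> borel_measurable M" using U by (simp add: E_def[abs_def])
    have dom: "integrable M E" "(\<lambda>n. expectation (G n)) \<longlonglongrightarrow> expectation E"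
      using integral_dominated_convergence[OF Em Gm _ Glim, of "\<lambda>_. 1"]
        integrable_dominated_convergence[OF Em Gm _ Glim, of "\<lambda>_. 1"] G1 by auto
    have "prob {\<omega>\<in>space M. U \<omega> \<le> 0} = expectation (indicator {\<omega>\<in>space M. U \<omega> \<le> 0})"
      using U by simp
    also have "\<dots> \<le> expectation E"
    proof (rule integral_mono)
      show "integrable M (indicat_real {\<omega>\<in>space M. U \<omega> \<le> 0})"
        using U by (intro integrable_real_indicator) (auto simp: emeasure_eq_measure)
      show "indicat_real {\<omega>\<in>space M. U \<omega> \<le> 0} \<omega> \<le> E \<omega>" for \<omega>
        using \<theta> by (auto simp: indicator_def E_def mult_nonneg_nonpos)
    qed (rule dom(1))
    also have "\<dots> \<le> \<theta> powr (- e) * K"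
      by (rule LIMSEQ_le_const2[OF dom(2)]) (use neg[OF \<theta>] in \<open>auto simp: G_def[abs_def]\<close>)
    finally show ?thesis .
  qed
  have "((\<lambda>\<theta>. \<theta> powr (- e) * K) \<longlongrightarrow> 0) at_top" using e(1) by real_asymp
  then have "prob {\<omega>\<in>space M. U \<omega> \<le> 0} \<le> 0"
    by (rule tendsto_lowerbound) (use tail in \<open>auto intro: eventually_mono[OF eventually_gt_at_top[of 0]]\<close>)
  then have "prob {\<omega>\<in>space M. U \<omega> \<le> 0} = 0" by (simp add: measure_le_0_iff)
  then have "AE \<omega> in M. \<omega> \<notin> {\<omega>\<in>space M. U \<omega> \<le> 0}" using U by (subst prob_eq_0[symmetric]) auto
  with AE_space show ?thesis by eventually_elim auto
qed

section \<open>Functionals negligible against the mass\<close>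

text \<open>The second moment is at most of order \<open>n\<close> to the power \<open>s max 1 (2 \<mu>)\<close>, with a logarithmic
  factor when \<open>\<mu> = 1/2\<close>. Any exponent \<open>s \<kappa>\<close> with \<open>\<kappa>\<close> strictly between \<open>max 1 (2 \<mu>)\<close> and \<open>2\<close> absorbs this factor and
  is still below that of the squared mass.\<close>

lemma second_moment_growth:
  assumes \<eta>: "Q *v \<eta> = \<mu> *\<^sub>R \<eta>" and \<mu>: "\<mu> < 1"
  obtains c \<kappa> where "1 < \<kappa>" "\<kappa> < 2" "0 \<le> c" "\<And>n. expectation (\<lambda>\<omega>. (X \<eta> n \<omega>)\<^sup>2) \<le> c * Pi_prod n (s * \<kappa>)"
proof -
  define \<nu> where "\<nu> = max (2 * \<mu>) 1"
  define \<kappa> where "\<kappa> = (\<nu> + 2) / 2"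
  have \<kappa>: "1 \<le> \<nu>" "2 * \<mu> \<le> \<nu>" "\<nu> < \<kappa>" "\<kappa> < 2" using \<mu> by (auto simp: \<nu>_def \<kappa>_def)
  define K where "K = (s * \<mu>)\<^sup>2 * sum_sq \<eta> * T0"
  have K: "K \<ge> 0" using nongreen_init by (simp add: K_def)
  define c where "c = (nongreen c\<^sub>0 \<bullet> \<eta>)\<^sup>2 + K / (s * (\<kappa> - \<nu>))"
  have sk: "s * (\<kappa> - \<nu>) > 0" using s_pos \<kappa> by simp
  have c0: "c \<ge> (nongreen c\<^sub>0 \<bullet> \<eta>)\<^sup>2" "c \<ge> 0" using K sk by (auto simp: c_def)
  have cK: "K \<le> c * (s * (\<kappa> - \<nu>))"
  proof -
    have "K / (s * (\<kappa> - \<nu>)) \<le> c" by (simp add: c_def)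
    then show ?thesis using sk by (simp only: pos_divide_le_eq)
  qed
  have Pk: "Pi_prod n (s * \<kappa>) > 0" "Pi_prod n s \<le> Pi_prod n (s * \<kappa>)" for n
  proof -
    have "s * \<kappa> > 0" using s_pos \<kappa> by simp
    then show "Pi_prod n (s * \<kappa>) > 0" by (intro Pi_prod_pos) simp
    show "Pi_prod n s \<le> Pi_prod n (s * \<kappa>)"
      unfolding Pi_prod_def using s_pos \<kappa> by (intro prod_mono) (auto intro!: divide_right_mono)
  qed
  have "expectation (\<lambda>\<omega>. (X \<eta> n \<omega>)\<^sup>2) \<le> c * Pi_prod n (s * \<kappa>)" for n
  proof (induction n)
    case 0
    then show ?case using expectation_initial[of "\<lambda>c. (nongreen c \<bullet> \<eta>)\<^sup>2"] c0 by simp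
  next
    case (Suc n)
    define N where "N = real (Suc n)"
    define y where "y = expectation (\<lambda>\<omega>. (X \<eta> n \<omega>)\<^sup>2)"
    define P where "P = Pi_prod n (s * \<kappa>)"
    have N: "N > 0" by (simp add: N_def)
    have y0: "y \<ge> 0" by (simp add: y_def)
    have "expectation (\<lambda>\<omega>. (X \<eta> (Suc n) \<omega>)\<^sup>2) \<le> y * (1 + 2 * (s * \<mu>) / N) + K * (Pi_prod n s / N)"
      using second_moment_step[OF \<eta>, of n] by (simp only: y_def N_def K_def)
    also have "\<dots> \<le> y * (1 + s * \<nu> / N) + K * (P / N)"
      using y0 N K \<kappa> s_pos Pk(2)[of n]
      by (intro add_mono mult_left_mono divide_right_mono) (auto simp: P_def)
    also have "\<dots> \<le> c * P * (1 + s * \<nu> / N) + c * (s * (\<kappa> - \<nu>)) * (P / N)"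
      using Suc N s_pos \<kappa> cK Pk(1)[of n]
      by (intro add_mono mult_right_mono) (auto simp: y_def P_def)
    also have "\<dots> = c * P * (1 + s * \<kappa> / N)" using N by (simp add: field_simps)
    finally show ?case by (simp only: Pi_prod_Suc P_def N_def mult.assoc)
  qed
  then show ?thesis using that[of \<kappa> c] \<kappa> c0 by simp
qed

lemma expectation_abs_X_negligible:
  assumes \<eta>: "Q *v \<eta> = \<mu> *\<^sub>R \<eta>" and \<mu>: "\<mu> < 1"
  shows "(\<lambda>n. expectation (\<lambda>\<omega>. \<bar>X \<eta> n \<omega>\<bar>) / Pi_prod n s) \<longlonglongrightarrow> 0"
proof -
  obtain c \<kappa> where c: "1 < \<kappa>" "\<kappa> < 2" "0 \<le> c" "\<And>n. expectation (\<lambda>\<omega>. (X \<eta> n \<omega>)\<^sup>2) \<le> c * Pi_prod n (s * \<kappa>)"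
    using second_moment_growth[OF \<eta> \<mu>] by metis
  have s1: "s > - 1" "s * \<kappa> > - 1" using s_pos c by (simp_all add: less_trans[of "-1" 0])
  have Ps: "Pi_prod n s > 0" for n using s1 by (intro Pi_prod_pos)
  have bound: "\<bar>expectation (\<lambda>\<omega>. \<bar>X \<eta> n \<omega>\<bar>) / Pi_prod n s\<bar> \<le> sqrt (c * Pi_prod n (s * \<kappa>) / (Pi_prod n s)\<^sup>2)" for n
  proof -
    have "0 \<le> variance (\<lambda>\<omega>. \<bar>X \<eta> n \<omega>\<bar>)" by simp
    also have "\<dots> = expectation (\<lambda>\<omega>. \<bar>X \<eta> n \<omega>\<bar>\<^sup>2) - (expectation (\<lambda>\<omega>. \<bar>X \<eta> n \<omega>\<bar>))\<^sup>2"
      by (rule variance_eq[OF integrable_fun_C integrable_fun_C])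
    finally have "(expectation (\<lambda>\<omega>. \<bar>X \<eta> n \<omega>\<bar>))\<^sup>2 \<le> c * Pi_prod n (s * \<kappa>)"
      using c(4)[of n] by simp
    then have "(expectation (\<lambda>\<omega>. \<bar>X \<eta> n \<omega>\<bar>) / Pi_prod n s)\<^sup>2 \<le> c * Pi_prod n (s * \<kappa>) / (Pi_prod n s)\<^sup>2"
      by (simp add: power_divide divide_right_mono)
    then show ?thesis by (metis real_sqrt_le_mono real_sqrt_abs)
  qed
  have "(\<lambda>n. c * ((Pi_prod n (s * \<kappa>) / real (n + 1) powr (s * \<kappa>)) / (Pi_prod n s / real (n + 1) powr s)\<^sup>2)
      * real (n + 1) powr (s * \<kappa> - 2 * s)) \<longlonglongrightarrow> c * ((1 / Gamma (1 + s * \<kappa>)) / (1 / Gamma (1 + s))\<^sup>2) * 0"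
  proof (rule tendsto_mult[OF tendsto_mult[OF tendsto_const tendsto_divide[OF
        Pi_prod_asymptotic_Suc[OF s1(2)] tendsto_power[OF Pi_prod_asymptotic_Suc[OF s1(1)]]]]])
    show "(1 / Gamma (1 + s))\<^sup>2 \<noteq> 0" using Gamma_pos[OF s1(1)] by simp
    have "s * \<kappa> - 2 * s < 0" using s_pos c by simp
    then show "(\<lambda>n. real (n + 1) powr (s * \<kappa> - 2 * s)) \<longlonglongrightarrow> 0" by real_asymp
  qed
  moreover have "c * ((Pi_prod n (s * \<kappa>) / real (n + 1) powr (s * \<kappa>)) / (Pi_prod n s / real (n + 1) powr s)\<^sup>2)
      * real (n + 1) powr (s * \<kappa> - 2 * s) = c * Pi_prod n (s * \<kappa>) / (Pi_prod n s)\<^sup>2" for n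
  proof -
    have "real (n + 1) powr (s * \<kappa> - 2 * s) = real (n + 1) powr (s * \<kappa>) / (real (n + 1) powr s)\<^sup>2"
      unfolding powr_diff mult_2 powr_add power2_eq_square ..
    then show ?thesis using Ps[of n] by (simp add: power_divide)
  qed
  ultimately have "(\<lambda>n. c * Pi_prod n (s * \<kappa>) / (Pi_prod n s)\<^sup>2) \<longlonglongrightarrow> 0" by simp
  then have "(\<lambda>n. sqrt (c * Pi_prod n (s * \<kappa>) / (Pi_prod n s)\<^sup>2)) \<longlonglongrightarrow> sqrt 0" by (rule tendsto_real_sqrt)
  then have lim: "(\<lambda>n. sqrt (c * Pi_prod n (s * \<kappa>) / (Pi_prod n s)\<^sup>2)) \<longlonglongrightarrow> 0" by simp
  show ?thesis
    by (rule Lim_null_comparison[OF always_eventually lim]) (use bound in auto)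
qed

text \<open>The martingale \<open>X / \<Pi>(s \<mu>)\<close> need not be bounded in mean square, but its increments divided by
  \<open>\<Pi>(s) / \<Pi>(s \<mu>)\<close> add up to one that is; Kronecker's lemma does the rest.\<close>

lemma X_negligible_AE:
  assumes \<eta>: "Q *v \<eta> = \<mu> *\<^sub>R \<eta>" and \<mu>: "\<mu> < 1" "s * \<mu> > - 1"
  shows "AE \<omega> in M. (\<lambda>n. X \<eta> n \<omega> / Pi_prod n s) \<longlonglongrightarrow> 0"
proof -
  define Z where "Z n \<omega> = X \<eta> n \<omega> / Pi_prod n (s * \<mu>)" for n \<omega>
  define a where "a n = Pi_prod n s / Pi_prod n (s * \<mu>)" for n
  have Ps: "Pi_prod n s > 0" "Pi_prod n (s * \<mu>) > 0" for n
    using s_pos \<mu> by (auto intro: Pi_prod_pos)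
  have apos: "a n > 0" for n using Ps by (simp add: a_def)
  have inc: "a n < a (Suc n)" for n
  proof -
    define N where "N = real (Suc n)"
    have N: "N > 0" by (simp add: N_def)
    have q: "1 + s * \<mu> / N > 0" unfolding N_def by (rule Pi_factor_pos[OF \<mu>(2)])
    have "s * \<mu> < s" using s_pos \<mu> by simp
    then have "1 + s * \<mu> / N < 1 + s / N" using N by (simp add: divide_strict_right_mono)
    then have "1 < (1 + s / N) / (1 + s * \<mu> / N)" using q by simp
    then have "a n * 1 < a n * ((1 + s / N) / (1 + s * \<mu> / N))" using apos by (intro mult_strict_left_mono)
    then show ?thesis unfolding a_def Pi_prod_Suc N_def by simp
  qed
  have div: "filterlim a at_top sequentially"
  proof -
    obtain b1 where b1: "b1 > 0" "\<And>n. b1 * real (n + 1) powr s \<le> Pi_prod n s"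
      using Pi_prod_bounds[of s] s_pos by (metis less_trans neg_less_0_iff_less zero_less_one)
    obtain b2 where b2: "b2 > 0" "\<And>n. Pi_prod n (s * \<mu>) \<le> b2 * real (n + 1) powr (s * \<mu>)"
      using Pi_prod_bounds[of "s * \<mu>"] \<mu> by metis
    have "b1 / b2 * real (n + 1) powr (s - s * \<mu>) \<le> a n" for n
    proof -
      have "b1 / b2 * real (n + 1) powr (s - s * \<mu>) = (b1 * real (n + 1) powr s) / (b2 * real (n + 1) powr (s * \<mu>))"
        by (simp add: powr_diff)
      also have "\<dots> \<le> a n" unfolding a_def using b1 b2 Ps by (intro frac_le) (auto intro: less_imp_le)
      finally show ?thesis .
    qed
    moreover have "s - s * \<mu> > 0" using s_pos \<mu> by simp
    then have "filterlim (\<lambda>n. b1 / b2 * real (n + 1) powr (s - s * \<mu>)) at_top sequentially"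
      using divide_pos_pos[OF b1(1) b2(1)] by real_asymp
    ultimately show ?thesis by (intro filterlim_at_top_mono[of _ _ a]) auto
  qed
  interpret Z: L2_martingale M F Z
    unfolding Z_def[abs_def] by (rule martingale_X[OF \<eta> \<mu>(2)])
  define Y where "Y n \<omega> = (\<Sum>k<n. 1 / a (Suc k) * (Z (Suc k) \<omega> - Z k \<omega>))" for n \<omega>
  interpret Y: L2_martingale M F Y
    unfolding Y_def[abs_def] by (rule Z.weighted_martingale(1))
  define K where "K = (s * \<mu>)\<^sup>2 * sum_sq \<eta> * T0"
  have K: "K \<ge> 0" using nongreen_init by (simp add: K_def)
  define g where "g n = Pi_prod n s / (real (Suc n) * (Pi_prod (Suc n) (s * 1))\<^sup>2)" for n
  have g0: "g n \<ge> 0" for n using Ps(1)[of n] by (simp add: g_def)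
  have gs: "summable g" unfolding g_def[abs_def] by (rule summable_variance_bound) simp
  have "expectation (\<lambda>\<omega>. (Y n \<omega>)\<^sup>2) \<le> K * suminf g" for n
  proof -
    have "expectation (\<lambda>\<omega>. (Y n \<omega>)\<^sup>2)
        = (\<Sum>k<n. (1 / a (Suc k))\<^sup>2 * (expectation (\<lambda>\<omega>. (Z (Suc k) \<omega>)\<^sup>2) - expectation (\<lambda>\<omega>. (Z k \<omega>)\<^sup>2)))"
      unfolding Y_def by (rule Z.weighted_martingale(2))
    also have "\<dots> \<le> (\<Sum>k<n. K * g k)"
    proof (rule sum_mono)
      fix k
      have "(1 / a (Suc k))\<^sup>2 * (expectation (\<lambda>\<omega>. (Z (Suc k) \<omega>)\<^sup>2) - expectation (\<lambda>\<omega>. (Z k \<omega>)\<^sup>2))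
          \<le> (1 / a (Suc k))\<^sup>2 * (K * (Pi_prod k s / (real (Suc k) * (Pi_prod (Suc k) (s * \<mu>))\<^sup>2)))"
        unfolding K_def Z_def by (intro mult_left_mono martingale_second_moment_step[OF \<eta> \<mu>(2)]) simp
      also have "\<dots> = K * g k"
        using Ps[of "Suc k"] by (simp add: a_def g_def power_divide del: of_nat_Suc)
      finally show "(1 / a (Suc k))\<^sup>2 * (expectation (\<lambda>\<omega>. (Z (Suc k) \<omega>)\<^sup>2) - expectation (\<lambda>\<omega>. (Z k \<omega>)\<^sup>2)) \<le> K * g k" .
    qed
    also have "\<dots> = K * (\<Sum>k<n. g k)" by (simp add: sum_distrib_left)
    also have "\<dots> \<le> K * suminf g" using K gs g0 by (intro mult_left_mono sum_le_suminf) auto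
    finally show ?thesis .
  qed
  then obtain V where "AE \<omega> in M. (\<lambda>n. Y n \<omega>) \<longlonglongrightarrow> V \<omega>"
    by (rule Y.L2_bounded_converges)
  then show ?thesis
  proof eventually_elim
    fix \<omega> assume "(\<lambda>n. Y n \<omega>) \<longlonglongrightarrow> V \<omega>"
    then have "convergent (\<lambda>n. \<Sum>k<n. (Z (Suc k) \<omega> - Z k \<omega>) / a (Suc k))"
      by (auto simp: convergent_def Y_def)
    from kronecker_lemma[OF inc div apos this] have "(\<lambda>n. Z n \<omega> / a n) \<longlonglongrightarrow> 0" .
    moreover have "Z n \<omega> / a n = X \<eta> n \<omega> / Pi_prod n s" for n
      using Ps[of n] by (simp add: Z_def a_def)
    ultimately show "(\<lambda>n. X \<eta> n \<omega> / Pi_prod n s) \<longlonglongrightarrow> 0" by simp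
  qed
qed

end

section \<open>Characteristic function of the centred mass\<close>

lemma exp_taylor_left:
  assumes "Re z \<le> 0"
  shows "cmod (exp z - (\<Sum>k\<le>n. z ^ k / fact k)) \<le> cmod z ^ Suc n / fact n"
proof -
  have "cmod (exp z - (\<Sum>k\<le>n. exp 0 * (z - 0) ^ k / fact k)) \<le> 1 * cmod (z - 0) ^ Suc n / fact n"
  proof (rule complex_Taylor[of "{z. Re z \<le> 0}" n "\<lambda>_. exp" 1 0 z])
    show "convex {z. Re z \<le> 0}" by (rule convex_halfspace_Re_le)
  qed (use assms in \<open>auto intro: DERIV_subset[OF DERIV_exp]\<close>)
  then show ?thesis by simp
qed

text \<open>One draw, with probabilities \<open>p1\<close> and \<open>p2\<close> of white and black and the corresponding jumps
  \<open>g1\<close> and \<open>g2\<close>. The numbers \<open>v\<close> and \<open>d\<close> are such that \<open>g\<^sup>2 = v + d g\<close> on both jumps; then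
  the second order term of the expansion is again a combination of \<open>p1 + p2\<close> and of the
  mean jump \<open>r\<close>, and the last exponential cancels everything but higher order terms.\<close>

lemma exp_step_bound:
  fixes p1 p2 g1 g2 a b \<sigma> v d g B :: real
  defines "p \<equiv> p1 + p2" and "r \<equiv> p1 * g1 + p2 * g2"
  assumes p: "0 \<le> p1" "0 \<le> p2" "p \<le> 1"
    and g: "\<bar>g1\<bar> \<le> g" "\<bar>g2\<bar> \<le> g" and vd: "g1\<^sup>2 = v + d * g1" "g2\<^sup>2 = v + d * g2" "0 \<le> v"
    and a: "\<bar>a\<bar> \<le> 1" and b: "0 \<le> b" "b \<le> B" and \<sigma>: "0 \<le> \<sigma>"
  shows "cmod (of_real p1 * exp (Complex (- (b * \<sigma>)) (a * g1)) + of_real p2 * exp (Complex (- (b * \<sigma>)) (a * g2))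
        + of_real (1 - p) - exp (Complex (- ((b * \<sigma> + a\<^sup>2 * v / 2) * p)) (a * r)))
    \<le> (2 * (g ^ 3 + B * \<sigma> ^ 3) + (g + 2 * \<sigma>\<^sup>2 + v\<^sup>2) + (\<bar>d\<bar> + \<sigma> * g + \<sigma>\<^sup>2))
        * ((\<bar>a\<bar> ^ 3 + b\<^sup>2 + \<bar>a\<bar> * b) * p + a\<^sup>2 * \<bar>r\<bar>)"
proof -
  define E where "E = (\<bar>a\<bar> ^ 3 + b\<^sup>2 + \<bar>a\<bar> * b) * p + a\<^sup>2 * \<bar>r\<bar>"
  define z where "z h = Complex (- (b * \<sigma>)) (a * h)" for h
  define w where "w = Complex (- ((b * \<sigma> + a\<^sup>2 * v / 2) * p)) (a * r)"
  have g0: "g \<ge> 0" using g(1) by linarith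
  have B0: "B \<ge> 0" using b by linarith
  have p0: "p \<ge> 0" using p by (simp add: p_def)
  have E: "\<bar>a\<bar> ^ 3 * p \<le> E" "b\<^sup>2 * p \<le> E" "\<bar>a\<bar> * b * p \<le> E" "a\<^sup>2 * \<bar>r\<bar> \<le> E" "0 \<le> E"
    using p0 b by (auto simp: E_def algebra_simps)
  have rp: "\<bar>r\<bar> \<le> g * p"
  proof -
    have "\<bar>r\<bar> \<le> p1 * \<bar>g1\<bar> + p2 * \<bar>g2\<bar>"
      using abs_triangle_ineq[of "p1 * g1" "p2 * g2"] p by (simp add: r_def abs_mult)
    also have "\<dots> \<le> p1 * g + p2 * g" using p g by (intro add_mono mult_left_mono) auto
    finally show ?thesis by (simp add: p_def algebra_simps)
  qed
  have R1: "cmod (exp (z h) - 1 - z h - (z h)\<^sup>2 / 2) * q \<le> 2 * (g ^ 3 * \<bar>a\<bar> ^ 3 + B * \<sigma> ^ 3 * b\<^sup>2) * q"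
    if h: "\<bar>h\<bar> \<le> g" and q: "q \<ge> 0" for h q
  proof (rule mult_right_mono[OF _ q])
    define x y where "x = \<bar>a\<bar> * g" and "y = b * \<sigma>"
    have xy: "x \<ge> 0" "y \<ge> 0" using g0 b \<sigma> by (auto simp: x_def y_def)
    have re: "Re (z h) \<le> 0" using b \<sigma> by (simp add: z_def)
    have eq: "exp (z h) - 1 - z h - (z h)\<^sup>2 / 2 = exp (z h) - (\<Sum>k\<le>2. z h ^ k / fact k)"
      by (simp add: numeral_2_eq_2)
    have "cmod (exp (z h) - 1 - z h - (z h)\<^sup>2 / 2) \<le> cmod (z h) ^ 3 / 2"
      unfolding eq using exp_taylor_left[OF re, of 2] by (simp add: fact_numeral)
    also have "cmod (z h) ^ 3 \<le> (x + y) ^ 3"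
    proof (rule power_mono)
      have "cmod (z h) \<le> \<bar>a * h\<bar> + \<bar>b * \<sigma>\<bar>" using cmod_le[of "z h"] by (simp add: z_def)
      also have "\<dots> \<le> x + y" using h b \<sigma> by (simp add: x_def y_def abs_mult mult_left_mono)
      finally show "cmod (z h) \<le> x + y" .
    qed simp
    also have "(x + y) ^ 3 \<le> 4 * (x ^ 3 + y ^ 3)"
    proof -
      have "4 * (x ^ 3 + y ^ 3) - (x + y) ^ 3 = 3 * ((x + y) * (x - y)\<^sup>2)"
        by (simp add: power2_eq_square power3_eq_cube algebra_simps)
      also have "\<dots> \<ge> 0" using xy by simp
      finally show ?thesis by simp
    qed
    also have "y ^ 3 \<le> B * \<sigma> ^ 3 * b\<^sup>2"
    proof -
      have "y ^ 3 = b * (\<sigma> ^ 3 * b\<^sup>2)" by (simp add: y_def power2_eq_square power3_eq_cube)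
      also have "\<dots> \<le> B * (\<sigma> ^ 3 * b\<^sup>2)" using b \<sigma> by (intro mult_right_mono) auto
      finally show ?thesis by simp
    qed
    finally show "cmod (exp (z h) - 1 - z h - (z h)\<^sup>2 / 2) \<le> 2 * (g ^ 3 * \<bar>a\<bar> ^ 3 + B * \<sigma> ^ 3 * b\<^sup>2)"
      by (simp add: x_def power_mult_distrib algebra_simps)
  qed
  have R2: "cmod (exp w - 1 - w) \<le> (g + 2 * \<sigma>\<^sup>2 + v\<^sup>2) * E"
  proof -
    define u where "u = b * \<sigma> + a\<^sup>2 * v / 2"
    have u0: "u \<ge> 0" using b \<sigma> vd by (simp add: u_def)
    have "Re w \<le> 0" using mult_nonneg_nonneg[OF u0 p0] by (simp add: w_def u_def)
    then have "cmod (exp w - 1 - w) \<le> (cmod w)\<^sup>2"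
      using exp_taylor_left[of w 1] by (simp add: power2_eq_square diff_diff_eq)
    also have "\<dots> = (a * r)\<^sup>2 + (u * p)\<^sup>2" by (simp add: cmod_power2 w_def u_def)
    also have "(a * r)\<^sup>2 \<le> g * E"
    proof -
      have "g * p \<le> g" using mult_left_mono[OF p(3) g0] by simp
      then have "\<bar>r\<bar> \<le> g" using rp by linarith
      then have "(a\<^sup>2 * \<bar>r\<bar>) * \<bar>r\<bar> \<le> (a\<^sup>2 * \<bar>r\<bar>) * g" by (intro mult_left_mono) auto
      also have "\<dots> \<le> E * g" using E g0 by (intro mult_right_mono) auto
      finally show ?thesis by (simp add: power2_eq_square mult.commute mult.left_commute flip: abs_mult)
    qed
    also have "(u * p)\<^sup>2 \<le> (2 * \<sigma>\<^sup>2 + v\<^sup>2) * E"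
    proof -
      have "a\<^sup>2 * a\<^sup>2 \<le> \<bar>a\<bar> ^ 3"
        using power_decreasing[of 3 4 "\<bar>a\<bar>"] a by (simp add: power4_eq_xxxx power2_eq_square)
      then have a4: "v\<^sup>2 * (a\<^sup>2 * a\<^sup>2) \<le> v\<^sup>2 * \<bar>a\<bar> ^ 3" by (intro mult_left_mono) auto
      have "u\<^sup>2 \<le> 2 * (b * \<sigma>)\<^sup>2 + 2 * (a\<^sup>2 * v / 2)\<^sup>2"
        using sum_squares_bound[of "b * \<sigma>" "a\<^sup>2 * v / 2"] by (simp add: u_def power2_sum)
      also have "\<dots> = 2 * \<sigma>\<^sup>2 * b\<^sup>2 + v\<^sup>2 * (a\<^sup>2 * a\<^sup>2) / 2"
        by (simp add: power2_eq_square)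
      also have "\<dots> \<le> 2 * \<sigma>\<^sup>2 * b\<^sup>2 + v\<^sup>2 * \<bar>a\<bar> ^ 3"
      proof -
        have "0 \<le> v\<^sup>2 * (a\<^sup>2 * a\<^sup>2)" by simp
        then show ?thesis using a4 by linarith
      qed
      finally have u2: "u\<^sup>2 \<le> 2 * \<sigma>\<^sup>2 * b\<^sup>2 + v\<^sup>2 * \<bar>a\<bar> ^ 3" .
      have "(u * p)\<^sup>2 = u\<^sup>2 * (p * p)" by (simp add: power2_eq_square)
      also have "\<dots> \<le> u\<^sup>2 * p" using p0 p(3) mult_left_mono[of p 1 p] by (intro mult_left_mono) auto
      also have "\<dots> \<le> (2 * \<sigma>\<^sup>2 * b\<^sup>2 + v\<^sup>2 * \<bar>a\<bar> ^ 3) * p" using u2 p0 by (rule mult_right_mono)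
      also have "\<dots> = 2 * \<sigma>\<^sup>2 * (b\<^sup>2 * p) + v\<^sup>2 * (\<bar>a\<bar> ^ 3 * p)" by (simp add: algebra_simps)
      also have "\<dots> \<le> 2 * \<sigma>\<^sup>2 * E + v\<^sup>2 * E" using E by (intro add_mono mult_left_mono) auto
      finally show ?thesis by (simp add: algebra_simps)
    qed
    finally show ?thesis by (simp add: algebra_simps)
  qed
  define D where "D = of_real p1 * (z g1 + (z g1)\<^sup>2 / 2) + of_real p2 * (z g2 + (z g2)\<^sup>2 / 2) - w"
  have R3: "cmod D \<le> (\<bar>d\<bar> + \<sigma> * g + \<sigma>\<^sup>2) * E"
  proof -
    have quad: "p1 * g1\<^sup>2 + p2 * g2\<^sup>2 = v * p + d * r" unfolding vd p_def r_def by (simp add: algebra_simps)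
    have "Re D = (b * \<sigma>)\<^sup>2 * p / 2 - a\<^sup>2 * (p1 * g1\<^sup>2 + p2 * g2\<^sup>2) / 2 + a\<^sup>2 * v * p / 2"
      by (simp add: D_def z_def w_def p_def power2_eq_square field_simps)
    also have "\<dots> = \<sigma>\<^sup>2 * (b\<^sup>2 * p) / 2 - a\<^sup>2 * d * r / 2"
      unfolding quad by (simp add: power_mult_distrib field_simps)
    finally have "\<bar>Re D\<bar> \<le> \<bar>\<sigma>\<^sup>2 * (b\<^sup>2 * p) / 2\<bar> + \<bar>a\<^sup>2 * d * r / 2\<bar>" by (simp only: abs_triangle_ineq4)
    also have "\<dots> \<le> \<sigma>\<^sup>2 * (b\<^sup>2 * p) + \<bar>d\<bar> * (a\<^sup>2 * \<bar>r\<bar>)"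
      using p0 by (intro add_mono) (auto simp: abs_mult)
    also have "\<dots> \<le> \<sigma>\<^sup>2 * E + \<bar>d\<bar> * E" using E by (intro add_mono mult_left_mono) auto
    finally have re: "\<bar>Re D\<bar> \<le> \<sigma>\<^sup>2 * E + \<bar>d\<bar> * E" .
    have "Im D = - (a * b * \<sigma> * r)"
      by (simp add: D_def z_def w_def r_def power2_eq_square field_simps)
    then have "\<bar>Im D\<bar> = \<bar>a\<bar> * b * \<sigma> * \<bar>r\<bar>" using b \<sigma> by (simp add: abs_mult)
    also have "\<dots> \<le> \<bar>a\<bar> * b * \<sigma> * (g * p)" using rp b \<sigma> by (intro mult_left_mono) auto
    also have "\<dots> = \<sigma> * g * (\<bar>a\<bar> * b * p)" by simp
    also have "\<dots> \<le> \<sigma> * g * E" using E \<sigma> g0 by (intro mult_left_mono) auto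
    finally show ?thesis using re cmod_le[of D] by (simp add: algebra_simps)
  qed
  have "of_real p1 * exp (z g1) + of_real p2 * exp (z g2) + of_real (1 - p) - exp w
      = of_real p1 * (exp (z g1) - 1 - z g1 - (z g1)\<^sup>2 / 2) + of_real p2 * (exp (z g2) - 1 - z g2 - (z g2)\<^sup>2 / 2)
        - (exp w - 1 - w) + D"
    by (simp add: D_def p_def algebra_simps)
  also have "cmod \<dots> \<le> cmod (exp (z g1) - 1 - z g1 - (z g1)\<^sup>2 / 2) * p1
      + cmod (exp (z g2) - 1 - z g2 - (z g2)\<^sup>2 / 2) * p2 + cmod (exp w - 1 - w) + cmod D"
  proof -
    define e1 e2 where "e1 = exp (z g1) - 1 - z g1 - (z g1)\<^sup>2 / 2" and "e2 = exp (z g2) - 1 - z g2 - (z g2)\<^sup>2 / 2"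
    define e3 where "e3 = exp w - 1 - w"
    define x y where "x = of_real p1 * e1" and "y = of_real p2 * e2"
    have "cmod (x + y - e3 + D) \<le> cmod x + cmod y + cmod e3 + cmod D"
      using norm_triangle_ineq[of "x + y - e3" D] norm_triangle_ineq4[of "x + y" e3] norm_triangle_ineq[of x y]
      by linarith
    moreover have "cmod x = cmod e1 * p1" "cmod y = cmod e2 * p2"
      using p by (simp_all add: x_def y_def norm_mult)
    ultimately show ?thesis by (simp only: x_def y_def e1_def e2_def e3_def)
  qed
  also have "\<dots> \<le> 2 * (g ^ 3 * \<bar>a\<bar> ^ 3 + B * \<sigma> ^ 3 * b\<^sup>2) * p1 + 2 * (g ^ 3 * \<bar>a\<bar> ^ 3 + B * \<sigma> ^ 3 * b\<^sup>2) * p2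
      + (g + 2 * \<sigma>\<^sup>2 + v\<^sup>2) * E + (\<bar>d\<bar> + \<sigma> * g + \<sigma>\<^sup>2) * E"
    using g p by (intro add_mono R1 R2 R3) auto
  also have "2 * (g ^ 3 * \<bar>a\<bar> ^ 3 + B * \<sigma> ^ 3 * b\<^sup>2) * p1 + 2 * (g ^ 3 * \<bar>a\<bar> ^ 3 + B * \<sigma> ^ 3 * b\<^sup>2) * p2
      = 2 * (g ^ 3 * (\<bar>a\<bar> ^ 3 * p) + B * \<sigma> ^ 3 * (b\<^sup>2 * p))"
    by (simp add: p_def algebra_simps)
  also have "\<dots> \<le> 2 * (g ^ 3 * E + B * \<sigma> ^ 3 * E)"
    using E g0 B0 \<sigma> by (intro mult_left_mono add_mono) auto
  finally show ?thesis
    unfolding E_def[symmetric] z_def w_def by (simp add: algebra_simps)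
qed

context triangular_urn
begin

text \<open>A Fourier factor in the centred functional and a Laplace factor in the mass: the first carries
  the fluctuation accumulated so far, the second the conditional variance still to come.\<close>

definition wave :: "real^2 \<Rightarrow> real \<Rightarrow> real \<Rightarrow> real^3 \<Rightarrow> complex" where
  "wave \<xi> a b c = exp (Complex (- (b * (nongreen c \<bullet> 1))) (a * (nongreen c \<bullet> \<xi>)))"

lemma norm_wave_le_1: "\<omega> \<in> space M \<Longrightarrow> 0 \<le> b \<Longrightarrow> cmod (wave \<xi> a b (C n \<omega>)) \<le> 1"
  using T_bounds(1)[of \<omega> n] by (simp add: wave_def)

text \<open>Going back one draw, \<open>a\<close> and \<open>b\<close> are multiplied by the mean growth of the functional and of the mass,
  and \<open>b\<close> takes up half the conditional variance of the draw, which is proportional to the mass except for a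
  multiple of \<open>X \<xi> n\<close>. What is left is of higher order in \<open>a\<close> and \<open>b\<close> or is this multiple.\<close>

lemma expectation_wave_step:
  assumes \<xi>: "Q *v \<xi> = \<mu> *\<^sub>R \<xi>" and opposite: "\<xi> $ 1 * \<xi> $ 2 \<le> 0"
  obtains K where "0 \<le> K" "\<And>n a b. \<bar>a\<bar> \<le> 1 \<Longrightarrow> 0 \<le> b \<Longrightarrow> b \<le> B \<Longrightarrow>
    cmod ((\<integral>\<omega>. wave \<xi> a b (C (Suc n) \<omega>) \<partial>M)
        - (\<integral>\<omega>. wave \<xi> (a * (1 + s * \<mu> / real (Suc n)))
              (b * (1 + s / real (Suc n)) + a\<^sup>2 * (- ((s * \<mu>)\<^sup>2 * (\<xi> $ 1 * \<xi> $ 2))) / 2 / real (Suc n)) (C n \<omega>) \<partial>M))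
    \<le> K * ((\<bar>a\<bar> ^ 3 + b\<^sup>2 + \<bar>a\<bar> * b) * (T0 * Pi_prod n s) / real (Suc n)
        + a\<^sup>2 * expectation (\<lambda>\<omega>. \<bar>X \<xi> n \<omega>\<bar>) / real (Suc n))"
proof -
  define v where "v = - ((s * \<mu>)\<^sup>2 * (\<xi> $ 1 * \<xi> $ 2))"
  define g1 g2 where "g1 = s * \<mu> * \<xi> $ 1" and "g2 = s * \<mu> * \<xi> $ 2"
  \<comment> \<open>\<open>g1\<close> and \<open>g2\<close> are the roots of \<open>g\<^sup>2 = d g + v\<close>\<close>
  define d where "d = g1 + g2"
  define g where "g = \<bar>g1\<bar> + \<bar>g2\<bar>"
  define K where "K = 2 * (g ^ 3 + \<bar>B\<bar> * s ^ 3) + (g + 2 * s\<^sup>2 + v\<^sup>2) + (\<bar>d\<bar> + s * g + s\<^sup>2)"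
  have g0: "g \<ge> 0" by (simp add: g_def)
  have K0: "K \<ge> 0" using g0 s_pos by (simp add: K_def)
  have v0: "v \<ge> 0" using opposite by (simp add: v_def mult_nonneg_nonpos)
  have vd: "g1\<^sup>2 = v + d * g1" "g2\<^sup>2 = v + d * g2"
    by (simp_all add: v_def d_def g1_def g2_def power2_eq_square algebra_simps)
  have "cmod ((\<integral>\<omega>. wave \<xi> a b (C (Suc n) \<omega>) \<partial>M)
        - (\<integral>\<omega>. wave \<xi> (a * (1 + s * \<mu> / real (Suc n)))
              (b * (1 + s / real (Suc n)) + a\<^sup>2 * v / 2 / real (Suc n)) (C n \<omega>) \<partial>M))
    \<le> K * (1 + s * \<bar>\<mu>\<bar>) * ((\<bar>a\<bar> ^ 3 + b\<^sup>2 + \<bar>a\<bar> * b) * (T0 * Pi_prod n s) / real (Suc n)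
        + a\<^sup>2 * expectation (\<lambda>\<omega>. \<bar>X \<xi> n \<omega>\<bar>) / real (Suc n))"
    if a: "\<bar>a\<bar> \<le> 1" and b: "0 \<le> b" "b \<le> B" for n a b
  proof -
    define N where "N = real (Suc n)"
    have N: "N > 0" by (simp add: N_def)
    define A where "A = \<bar>a\<bar> ^ 3 + b\<^sup>2 + \<bar>a\<bar> * b"
    have A0: "A \<ge> 0" using b by (simp add: A_def)
    define a' b' where "a' = a * (1 + s * \<mu> / N)" and "b' = b * (1 + s / N) + a\<^sup>2 * v / 2 / N"
    define S where "S c = (\<Sum>i\<in>UNIV. of_real (c $ i / N) * wave \<xi> a b (c + row i (triangular_matrix s Q)))" for c
    have pw: "cmod (S (C n \<omega>) - wave \<xi> a' b' (C n \<omega>)) \<le> K * (A * (T n \<omega> / N) + a\<^sup>2 * (s * \<bar>\<mu>\<bar> * \<bar>X \<xi> n \<omega>\<bar> / N))"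
      if \<omega>: "\<omega> \<in> space M" for \<omega>
    proof -
      note c = content_coords[OF \<omega>, of n, folded N_def]
      define p1 p2 where "p1 = C n \<omega> $ 1 / N" and "p2 = C n \<omega> $ 2 / N"
      define p r where "p = p1 + p2" and "r = p1 * g1 + p2 * g2"
      have p_eq: "p = T n \<omega> / N" by (simp add: p_def p1_def p2_def T_eq add_divide_distrib)
      have r_eq: "r = s * \<mu> * X \<xi> n \<omega> / N"
        by (simp add: r_def p1_def p2_def g1_def g2_def nongreen_inner add_divide_distrib algebra_simps)
      have p3: "C n \<omega> $ 3 / N = 1 - p" using c(4) N by (simp add: p_def p1_def p2_def field_simps)
      define W where "W = wave \<xi> a b (C n \<omega>)"
      have w1: "wave \<xi> a b (C n \<omega> + row 1 (triangular_matrix s Q)) = W * exp (Complex (- (b * s)) (a * g1))"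
        and w2: "wave \<xi> a b (C n \<omega> + row 2 (triangular_matrix s Q)) = W * exp (Complex (- (b * s)) (a * g2))"
        and w3: "wave \<xi> a b (C n \<omega> + row 3 (triangular_matrix s Q)) = W"
        unfolding wave_def W_def nongreen_row[OF \<xi>] nongreen_row[OF ones_eigenvector]
        by (simp_all add: exp_add[symmetric] complex_eq_iff g1_def g2_def algebra_simps
            del: exp_add) (simp_all add: complex_add algebra_simps)
      have w': "wave \<xi> a' b' (C n \<omega>) = W * exp (Complex (- ((b * s + a\<^sup>2 * v / 2) * p)) (a * r))"
        unfolding wave_def W_def exp_add[symmetric] complex_add p_eq r_eq a'_def b'_def
        by (simp add: algebra_simps)
      have "S (C n \<omega>) - wave \<xi> a' b' (C n \<omega>) = W * (of_real p1 * exp (Complex (- (b * s)) (a * g1))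
          + of_real p2 * exp (Complex (- (b * s)) (a * g2)) + of_real (1 - p)
          - exp (Complex (- ((b * s + a\<^sup>2 * v / 2) * p)) (a * r)))"
        unfolding S_def sum_3 w1 w2 w3 w' p3 p1_def[symmetric] p2_def[symmetric] by (simp add: algebra_simps)
      then have "cmod (S (C n \<omega>) - wave \<xi> a' b' (C n \<omega>))
          \<le> 1 * cmod (of_real p1 * exp (Complex (- (b * s)) (a * g1))
          + of_real p2 * exp (Complex (- (b * s)) (a * g2)) + of_real (1 - p)
          - exp (Complex (- ((b * s + a\<^sup>2 * v / 2) * p)) (a * r)))"
        unfolding W_def using norm_wave_le_1[OF \<omega> b(1)] by (simp only: norm_mult mult_right_mono norm_ge_zero)
      also have "\<dots> \<le> 1 * (K * ((\<bar>a\<bar> ^ 3 + b\<^sup>2 + \<bar>a\<bar> * b) * p + a\<^sup>2 * \<bar>r\<bar>))"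
        unfolding K_def p_def r_def
      proof (intro mult_left_mono exp_step_bound)
        show "p1 + p2 \<le> 1"
          using T_bounds(2)[OF \<omega>, of n] N unfolding p_def[symmetric] p_eq by (simp add: N_def del: of_nat_Suc)
        show "0 \<le> p1" "0 \<le> p2" using c N by (auto simp: p1_def p2_def)
        show "b \<le> \<bar>B\<bar>" using b by simp
      qed (use a b vd v0 s_pos in \<open>auto simp: g_def\<close>)
      also have "\<bar>r\<bar> = s * \<bar>\<mu>\<bar> * \<bar>X \<xi> n \<omega>\<bar> / N" using N s_pos by (simp add: r_eq abs_mult)
      finally show ?thesis by (simp add: A_def p_eq)
    qed
    have i1: "integrable M (\<lambda>\<omega>. S (C n \<omega>))" "integrable M (\<lambda>\<omega>. wave \<xi> a' b' (C n \<omega>))"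
      by (rule integrable_fun_C)+
    have "(\<integral>\<omega>. wave \<xi> a b (C (Suc n) \<omega>) \<partial>M) = (\<integral>\<omega>. S (C n \<omega>) \<partial>M)"
      unfolding S_def N_def by (rule expectation_Suc_complex)
    then have "cmod ((\<integral>\<omega>. wave \<xi> a b (C (Suc n) \<omega>) \<partial>M) - (\<integral>\<omega>. wave \<xi> a' b' (C n \<omega>) \<partial>M))
        = cmod (\<integral>\<omega>. S (C n \<omega>) - wave \<xi> a' b' (C n \<omega>) \<partial>M)"
      using i1 by simp
    also have "\<dots> \<le> (\<integral>\<omega>. cmod (S (C n \<omega>) - wave \<xi> a' b' (C n \<omega>)) \<partial>M)"
      by (rule integral_norm_bound)
    also have "\<dots> \<le> (\<integral>\<omega>. K * (A * (T n \<omega> / N) + a\<^sup>2 * (s * \<bar>\<mu>\<bar> * \<bar>X \<xi> n \<omega>\<bar> / N)) \<partial>M)"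
      using integrable_fun_C[of "\<lambda>c. cmod (S c - wave \<xi> a' b' c)" n]
        integrable_fun_C[of "\<lambda>c. K * (A * ((nongreen c \<bullet> 1) / N) + a\<^sup>2 * (s * \<bar>\<mu>\<bar> * \<bar>nongreen c \<bullet> \<xi>\<bar> / N))" n]
      by (intro integral_mono pw)
    also have "\<dots> = K * (A * (expectation (T n) / N) + a\<^sup>2 * (s * \<bar>\<mu>\<bar> * expectation (\<lambda>\<omega>. \<bar>X \<xi> n \<omega>\<bar>) / N))"
      using integrable_fun_C[of "\<lambda>c. nongreen c \<bullet> 1" n] integrable_fun_C[of "\<lambda>c. \<bar>nongreen c \<bullet> \<xi>\<bar>" n] by simp
    also have "\<dots> \<le> K * ((1 + s * \<bar>\<mu>\<bar>) * (A * (T0 * Pi_prod n s) / N + a\<^sup>2 * expectation (\<lambda>\<omega>. \<bar>X \<xi> n \<omega>\<bar>) / N))"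
    proof (rule mult_left_mono[OF _ K0])
      define y where "y = a\<^sup>2 * expectation (\<lambda>\<omega>. \<bar>X \<xi> n \<omega>\<bar>) / N"
      define x where "x = A * (T0 * Pi_prod n s) / N"
      have "y \<ge> 0" "x \<ge> 0"
        using N A0 nongreen_init Pi_prod_pos[of s n] s_pos by (auto simp: y_def x_def)
      then have "x + s * \<bar>\<mu>\<bar> * y \<le> (1 + s * \<bar>\<mu>\<bar>) * (x + y)"
        using s_pos by (simp add: algebra_simps)
      then show "A * (expectation (T n) / N) + a\<^sup>2 * (s * \<bar>\<mu>\<bar> * expectation (\<lambda>\<omega>. \<bar>X \<xi> n \<omega>\<bar>) / N)
          \<le> (1 + s * \<bar>\<mu>\<bar>) * (A * (T0 * Pi_prod n s) / N + a\<^sup>2 * expectation (\<lambda>\<omega>. \<bar>X \<xi> n \<omega>\<bar>) / N)"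
        by (simp add: expectation_T x_def y_def mult_ac)
    qed
    finally show ?thesis by (simp only: a'_def b'_def N_def A_def mult.assoc)
  qed
  moreover have "0 \<le> K * (1 + s * \<bar>\<mu>\<bar>)" using K0 s_pos by simp
  ultimately show ?thesis using that unfolding v_def by blast
qed

end

context triangular_urn
begin

text \<open>The recursion says that \<open>\<alpha> n k X \<xi> k\<close> is the conditional mean of \<open>\<alpha> n n X \<xi> n\<close> at time \<open>k\<close>. Running the coefficient \<open>\<beta> n\<close> of the mass backwards from \<open>\<beta> n n = 0\<close> turns the
  characteristic function of \<open>X \<xi> n\<close> at \<open>\<alpha> n n\<close>, up to errors summed from time \<open>m\<close> on, into
  \<open>E exp (- \<beta> n m T m)\<close>. Letting first \<open>n\<close> and then \<open>m\<close> tend to infinity replaces \<open>T m\<close> by the limit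
  variable: this is where the random variance comes from.\<close>

theorem characteristic_function_limit:
  fixes \<alpha> :: "nat \<Rightarrow> nat \<Rightarrow> real"
  assumes \<xi>: "Q *v \<xi> = \<mu> *\<^sub>R \<xi>" and \<mu>: "\<mu> < 1" and opposite: "\<xi> $ 1 * \<xi> $ 2 \<le> 0"
    and \<alpha>_rec: "\<And>n k. k < n \<Longrightarrow> \<alpha> n k = \<alpha> n (Suc k) * (1 + s * \<mu> / real (Suc k))"
    and \<alpha>_small: "\<And>e. 0 < e \<Longrightarrow> \<exists>N. \<forall>n\<ge>N. \<forall>k\<le>n. \<bar>\<alpha> n k\<bar> \<le> e"
    and \<alpha>_sum: "(\<lambda>n. \<Sum>j<n. (\<alpha> n (Suc j))\<^sup>2 * Pi_prod j s / real (Suc j)) \<longlonglongrightarrow> \<kappa>"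
    and U: "U \<in> borel_measurable M" "AE \<omega> in M. (\<lambda>n. T n \<omega> / Pi_prod n s) \<longlonglongrightarrow> U \<omega>"
  shows "(\<lambda>n. \<integral>\<omega>. iexp (\<alpha> n n * X \<xi> n \<omega>) \<partial>M)
    \<longlonglongrightarrow> (\<integral>\<omega>. of_real (exp (- ((s * \<mu>)\<^sup>2 * - (\<xi> $ 1 * \<xi> $ 2) / 2 * \<kappa> * U \<omega>))) \<partial>M)"
proof -
  define v where "v = (s * \<mu>)\<^sup>2 * - (\<xi> $ 1 * \<xi> $ 2)"
  have v0: "v \<ge> 0" using opposite by (simp add: v_def mult_nonneg_nonpos)
  have Ps: "Pi_prod n s > 0" "Pi_prod n s \<ge> 1" for n
    using s_pos by (auto intro: Pi_prod_pos Pi_prod_ge_1)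
  define g where "g n j = (\<alpha> n (Suc j))\<^sup>2 * Pi_prod j s / real (Suc j)" for n j
  have g0: "g n j \<ge> 0" for n j using Ps(1)[of j] by (simp add: g_def)
  have "Bseq (\<lambda>n. \<Sum>j<n. g n j)"
    using \<alpha>_sum unfolding g_def by (intro convergent_imp_Bseq) (rule convergentI)
  then obtain G where G: "G > 0" "\<And>n. (\<Sum>j<n. g n j) \<le> G"
    by (auto simp: Bseq_def abs_le_iff)
  have G': "(\<Sum>j=m..<n. g n j) \<le> G" for m n
    by (rule order_trans[OF sum_mono2 G(2)[of n]]) (use g0 in auto)
  define \<beta> where "\<beta> n k = v / 2 * (\<Sum>j=k..<n. g n j) / Pi_prod k s" for n k
  have \<beta>0: "\<beta> n k \<ge> 0" for n k
    using v0 g0 Ps(1)[of k] by (auto simp: \<beta>_def intro!: divide_nonneg_nonneg mult_nonneg_nonneg sum_nonneg)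
  define B where "B = v / 2 * G"
  have B0: "B \<ge> 0" using v0 G by (simp add: B_def)
  have \<beta>B: "\<beta> n k \<le> B / Pi_prod k s" for n k
    unfolding \<beta>_def B_def using G'[of n k] v0 Ps(1)[of k] by (intro divide_right_mono mult_left_mono) auto
  have \<beta>B': "\<beta> n k \<le> B" for n k
    using \<beta>B[of n k] B0 Ps(2)[of k] by (smt (verit) divide_le_eq_1 frac_le div_by_1)
  have \<beta>_rec: "\<beta> n k = \<beta> n (Suc k) * (1 + s / real (Suc k)) + (\<alpha> n (Suc k))\<^sup>2 * v / 2 / real (Suc k)"
    if "k < n" for n k
  proof -
    define q where "q = 1 + s / real (Suc k)"
    have q: "q > 0" using s_pos by (simp add: q_def add_pos_nonneg)
    have P: "Pi_prod (Suc k) s = Pi_prod k s * q" by (simp add: Pi_prod_Suc q_def)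
    have "\<beta> n (Suc k) * q = v / 2 * (\<Sum>j=Suc k..<n. g n j) / Pi_prod k s"
      unfolding \<beta>_def P using q by simp
    moreover have "(\<alpha> n (Suc k))\<^sup>2 * v / 2 / real (Suc k) = v / 2 * g n k / Pi_prod k s"
      using Ps(1)[of k] by (simp add: g_def)
    moreover have "\<beta> n k = v / 2 * (g n k + (\<Sum>j=Suc k..<n. g n j)) / Pi_prod k s"
      unfolding \<beta>_def using that by (simp add: sum.atLeast_Suc_lessThan)
    ultimately have "\<beta> n k = \<beta> n (Suc k) * q + (\<alpha> n (Suc k))\<^sup>2 * v / 2 / real (Suc k)"
      by (simp only: distrib_left add_divide_distrib)
    then show ?thesis by (simp only: q_def)
  qed
  define \<Phi> where "\<Phi> n k = (\<integral>\<omega>. wave \<xi> (\<alpha> n k) (\<beta> n k) (C k \<omega>) \<partial>M)" for n k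
  define L where "L = (\<integral>\<omega>. of_real (exp (- (v / 2 * \<kappa> * U \<omega>))) \<partial>M :: complex)"
  obtain K where K: "0 \<le> K" "\<And>n a b. \<bar>a\<bar> \<le> 1 \<Longrightarrow> 0 \<le> b \<Longrightarrow> b \<le> B \<Longrightarrow>
    cmod ((\<integral>\<omega>. wave \<xi> a b (C (Suc n) \<omega>) \<partial>M)
        - (\<integral>\<omega>. wave \<xi> (a * (1 + s * \<mu> / real (Suc n)))
              (b * (1 + s / real (Suc n)) + a\<^sup>2 * (- ((s * \<mu>)\<^sup>2 * (\<xi> $ 1 * \<xi> $ 2))) / 2 / real (Suc n)) (C n \<omega>) \<partial>M))
    \<le> K * ((\<bar>a\<bar> ^ 3 + b\<^sup>2 + \<bar>a\<bar> * b) * (T0 * Pi_prod n s) / real (Suc n)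
        + a\<^sup>2 * expectation (\<lambda>\<omega>. \<bar>X \<xi> n \<omega>\<bar>) / real (Suc n))"
    using expectation_wave_step[OF \<xi> opposite, of B] by metis
  define h where "h k = Pi_prod k s / (real (Suc k) * (Pi_prod (Suc k) (s * 1))\<^sup>2)" for k
  have hs: "summable h" unfolding h_def[abs_def] by (rule summable_variance_bound) simp
  define \<eta> where "\<eta> k = expectation (\<lambda>\<omega>. \<bar>X \<xi> k \<omega>\<bar>) / Pi_prod k s" for k
  have \<eta>_lim: "\<eta> \<longlonglongrightarrow> 0"
    unfolding \<eta>_def[abs_def] by (rule expectation_abs_X_negligible[OF \<xi> \<mu>])
  have step: "cmod (\<Phi> n (Suc k) - \<Phi> n k)
      \<le> K * ((2 * T0 * \<delta> + \<delta>) * g n k + (1 + 1 / \<delta>) * T0 * B\<^sup>2 * h k)"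
    if \<delta>: "0 < \<delta>" "\<delta> \<le> 1" and k: "k < n" and small: "\<bar>\<alpha> n (Suc k)\<bar> \<le> \<delta>" and \<eta>k: "\<eta> k \<le> \<delta>" for \<delta> n k
  proof -
    define N where "N = real (Suc k)"
    have N: "N > 0" by (simp add: N_def)
    define a b where "a = \<alpha> n (Suc k)" and "b = \<beta> n (Suc k)"
    have a: "\<bar>a\<bar> \<le> \<delta>" using small by (simp add: a_def)
    have b: "0 \<le> b" "b \<le> B" "b \<le> B / Pi_prod (Suc k) s" using \<beta>0 \<beta>B \<beta>B' by (auto simp: b_def)
    have "\<Phi> n k = (\<integral>\<omega>. wave \<xi> (a * (1 + s * \<mu> / N)) (b * (1 + s / N) + a\<^sup>2 * v / 2 / N) (C k \<omega>) \<partial>M)"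
      unfolding \<Phi>_def \<alpha>_rec[OF k] \<beta>_rec[OF k] a_def b_def N_def ..
    then have "cmod (\<Phi> n (Suc k) - \<Phi> n k)
        \<le> K * ((\<bar>a\<bar> ^ 3 + b\<^sup>2 + \<bar>a\<bar> * b) * (T0 * Pi_prod k s) / N + a\<^sup>2 * expectation (\<lambda>\<omega>. \<bar>X \<xi> k \<omega>\<bar>) / N)"
      using K(2)[of a b k] a \<delta> b
      by (simp add: \<Phi>_def a_def[symmetric] b_def[symmetric] N_def[symmetric] v_def del: of_nat_Suc)
    also have "\<dots> \<le> K * ((2 * T0 * \<delta> + \<delta>) * g n k + (1 + 1 / \<delta>) * T0 * B\<^sup>2 * h k)"
    proof (rule mult_left_mono[OF _ K(1)])
      have a3: "\<bar>a\<bar> ^ 3 \<le> \<delta> * a\<^sup>2"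
      proof -
        have "\<bar>a\<bar> ^ 3 = \<bar>a\<bar> * \<bar>a\<bar>\<^sup>2"
          by (simp only: power3_eq_cube power2_eq_square mult.assoc)
        then show ?thesis using mult_right_mono[OF a, of "a\<^sup>2"] by (simp only: power2_abs zero_le_power2 simp_thms)
      qed
      \<comment> \<open>the mixed term is split by Young's inequality, so that its two parts are summable on their own\<close>
      have "0 \<le> (\<delta> * \<bar>a\<bar> - b)\<^sup>2" by simp
      also have "\<dots> = \<delta> * (\<delta> * a\<^sup>2) + b\<^sup>2 - 2 * \<delta> * (\<bar>a\<bar> * b)"
        by (simp add: power2_diff power_mult_distrib) (simp add: power2_eq_square)
      finally have "\<delta> * (2 * (\<bar>a\<bar> * b)) \<le> \<delta> * (\<delta> * a\<^sup>2 + b\<^sup>2 / \<delta>)"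
        using \<delta> by (simp add: distrib_left)
      then have "2 * (\<bar>a\<bar> * b) \<le> \<delta> * a\<^sup>2 + b\<^sup>2 / \<delta>" using \<delta> by (simp only: mult_le_cancel_left_pos)
      moreover have "0 \<le> \<bar>a\<bar> * b" using b by simp
      ultimately have "\<bar>a\<bar> * b \<le> \<delta> * a\<^sup>2 + b\<^sup>2 / \<delta>" by linarith
      then have poly: "\<bar>a\<bar> ^ 3 + b\<^sup>2 + \<bar>a\<bar> * b \<le> 2 * \<delta> * a\<^sup>2 + (1 + 1 / \<delta>) * b\<^sup>2"
        using a3 by (simp add: algebra_simps)
      define y where "y = T0 * Pi_prod k s / N"
      have y0: "y \<ge> 0" using nongreen_init Ps(1)[of k] N by (simp add: y_def)
      have gy: "a\<^sup>2 * y = T0 * g n k" by (simp add: y_def g_def a_def N_def)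
      have hy: "b\<^sup>2 * y \<le> T0 * B\<^sup>2 * h k"
      proof -
        have "b\<^sup>2 \<le> (B / Pi_prod (Suc k) s)\<^sup>2" using b by (intro power_mono) auto
        then have "b\<^sup>2 * y \<le> (B / Pi_prod (Suc k) s)\<^sup>2 * y" using y0 by (rule mult_right_mono)
        also have "\<dots> = T0 * B\<^sup>2 * h k" by (simp add: y_def h_def N_def power_divide mult_ac)
        finally show ?thesis .
      qed
      have "(\<bar>a\<bar> ^ 3 + b\<^sup>2 + \<bar>a\<bar> * b) * (T0 * Pi_prod k s) / N = (\<bar>a\<bar> ^ 3 + b\<^sup>2 + \<bar>a\<bar> * b) * y"
        by (simp add: y_def)
      also have "\<dots> \<le> (2 * \<delta> * a\<^sup>2 + (1 + 1 / \<delta>) * b\<^sup>2) * y" using poly y0 by (rule mult_right_mono)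
      also have "\<dots> = 2 * \<delta> * (a\<^sup>2 * y) + (1 + 1 / \<delta>) * (b\<^sup>2 * y)" by (simp add: algebra_simps)
      also have "\<dots> \<le> 2 * \<delta> * (T0 * g n k) + (1 + 1 / \<delta>) * (T0 * B\<^sup>2 * h k)"
        using hy gy \<delta> by (intro add_mono mult_left_mono) auto
      finally have 1: "(\<bar>a\<bar> ^ 3 + b\<^sup>2 + \<bar>a\<bar> * b) * (T0 * Pi_prod k s) / N
          \<le> 2 * \<delta> * (T0 * g n k) + (1 + 1 / \<delta>) * (T0 * B\<^sup>2 * h k)" .
      have "a\<^sup>2 * expectation (\<lambda>\<omega>. \<bar>X \<xi> k \<omega>\<bar>) / N = \<eta> k * g n k"
        using Ps(1)[of k] by (simp add: \<eta>_def g_def a_def N_def)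
      also have "\<dots> \<le> \<delta> * g n k" using \<eta>k g0 by (rule mult_right_mono)
      finally show "(\<bar>a\<bar> ^ 3 + b\<^sup>2 + \<bar>a\<bar> * b) * (T0 * Pi_prod k s) / N + a\<^sup>2 * expectation (\<lambda>\<omega>. \<bar>X \<xi> k \<omega>\<bar>) / N
          \<le> (2 * T0 * \<delta> + \<delta>) * g n k + (1 + 1 / \<delta>) * T0 * B\<^sup>2 * h k"
        using 1 by (simp add: algebra_simps)
    qed
    finally show ?thesis .
  qed
  define K' where "K' = K * ((2 * T0 + 1) * G + 2 * T0 * B\<^sup>2)"
  have K'0: "K' \<ge> 0" using K nongreen_init G B0 by (simp add: K'_def)
  have telescope: "\<exists>m0. \<forall>m\<ge>m0. \<exists>N. \<forall>n\<ge>N. cmod (\<Phi> n n - \<Phi> n m) \<le> K' * \<delta>" if \<delta>: "0 < \<delta>" "\<delta> \<le> 1" for \<delta>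
  proof -
    obtain m1 where m1: "\<And>k. k \<ge> m1 \<Longrightarrow> \<eta> k < \<delta>"
      using order_tendstoD(2)[OF \<eta>_lim \<delta>(1)] by (auto simp: eventually_sequentially)
    obtain m2 where m2: "\<And>m n. m \<ge> m2 \<Longrightarrow> (\<Sum>j=m..<n. h j) < \<delta>\<^sup>2"
      by (rule summable_tail_small[OF hs, of "\<delta>\<^sup>2"]) (use \<delta> in auto)
    obtain N1 where N1: "\<And>n k. n \<ge> N1 \<Longrightarrow> k \<le> n \<Longrightarrow> \<bar>\<alpha> n k\<bar> \<le> \<delta>" using \<alpha>_small[OF \<delta>(1)] by blast
    show ?thesis
    proof (rule exI[of _ "max m1 m2"], intro allI impI)
      fix m assume m: "m \<ge> max m1 m2"
      show "\<exists>N. \<forall>n\<ge>N. cmod (\<Phi> n n - \<Phi> n m) \<le> K' * \<delta>"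
      proof (intro exI[of _ "max N1 m"] allI impI)
        fix n assume n: "n \<ge> max N1 m"
        have "\<Phi> n n - \<Phi> n m = (\<Sum>k=m..<n. \<Phi> n (Suc k) - \<Phi> n k)"
          using n by (subst sum_Suc_diff') auto
        also have "cmod \<dots> \<le> (\<Sum>k=m..<n. cmod (\<Phi> n (Suc k) - \<Phi> n k))" by (rule norm_sum)
        also have "\<dots> \<le> (\<Sum>k=m..<n. K * ((2 * T0 * \<delta> + \<delta>) * g n k + (1 + 1 / \<delta>) * T0 * B\<^sup>2 * h k))"
        proof (rule sum_mono)
          fix k assume "k \<in> {m..<n}"
          then show "cmod (\<Phi> n (Suc k) - \<Phi> n k)
              \<le> K * ((2 * T0 * \<delta> + \<delta>) * g n k + (1 + 1 / \<delta>) * T0 * B\<^sup>2 * h k)"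
            using n m m1[of k] N1[of n "Suc k"] \<delta> by (intro step) auto
        qed
        also have "\<dots> = K * ((2 * T0 * \<delta> + \<delta>) * (\<Sum>k=m..<n. g n k)
            + (1 + 1 / \<delta>) * T0 * B\<^sup>2 * (\<Sum>k=m..<n. h k))"
          by (simp only: sum_distrib_left[symmetric] sum.distrib)
        also have "\<dots> \<le> K * ((2 * T0 * \<delta> + \<delta>) * G + (1 + 1 / \<delta>) * T0 * B\<^sup>2 * \<delta>\<^sup>2)"
          using K(1) G' \<delta> nongreen_init m2[of m n] m
          by (intro mult_left_mono add_mono) (auto intro: less_imp_le)
        also have "\<dots> = K * ((2 * T0 + 1) * G * \<delta> + (\<delta> + 1) * (T0 * B\<^sup>2 * \<delta>))"
          using \<delta> by (simp add: power2_eq_square field_simps)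
        also have "\<dots> \<le> K * ((2 * T0 + 1) * G * \<delta> + 2 * (T0 * B\<^sup>2 * \<delta>))"
          using K(1) \<delta> nongreen_init by (intro mult_left_mono add_left_mono mult_right_mono) auto
        also have "\<dots> = K' * \<delta>" by (simp add: K'_def algebra_simps)
        finally show "cmod (\<Phi> n n - \<Phi> n m) \<le> K' * \<delta>" .
      qed
    qed
  qed
  define A where "A m = (\<integral>\<omega>. of_real (exp (- (v / 2 * \<kappa> * (T m \<omega> / Pi_prod m s)))) \<partial>M :: complex)" for m
  have \<kappa>0: "\<kappa> \<ge> 0"
    by (rule LIMSEQ_le_const[OF \<alpha>_sum]) (use g0 in \<open>auto simp: g_def intro!: sum_nonneg\<close>)
  have inner: "(\<lambda>n. \<Phi> n m) \<longlonglongrightarrow> A m" for m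
  proof -
    have \<alpha>0: "(\<lambda>n. \<alpha> n k) \<longlonglongrightarrow> 0" for k
    proof (rule LIMSEQ_I)
      fix e :: real assume "0 < e"
      then obtain N where "\<forall>n\<ge>N. \<forall>k\<le>n. \<bar>\<alpha> n k\<bar> \<le> e / 2" using \<alpha>_small[of "e / 2"] by auto
      then show "\<exists>no. \<forall>n\<ge>no. norm (\<alpha> n k - 0) < e"
        using \<open>0 < e\<close> by (intro exI[of _ "max N k"]) (force intro: order_le_less_trans)
    qed
    have "(\<lambda>n. \<Sum>j<m. g n j) \<longlonglongrightarrow> (\<Sum>j<m. 0\<^sup>2 * Pi_prod j s / real (Suc j))"
      unfolding g_def by (intro tendsto_sum tendsto_divide tendsto_mult tendsto_power \<alpha>0 tendsto_const) auto
    then have "(\<lambda>n. (\<Sum>j<n. g n j) - (\<Sum>j<m. g n j)) \<longlonglongrightarrow> \<kappa> - 0"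
      using \<alpha>_sum unfolding g_def by (intro tendsto_diff) auto
    moreover have "eventually (\<lambda>n. (\<Sum>j<n. g n j) - (\<Sum>j<m. g n j) = (\<Sum>j=m..<n. g n j)) sequentially"
      using eventually_ge_at_top[of m]
    proof eventually_elim
      case (elim n)
      then have "(\<Sum>j<n. g n j) = (\<Sum>j<m. g n j) + (\<Sum>j=m..<n. g n j)"
        using sum.atLeastLessThan_concat[of 0 m n "g n"] by (simp add: lessThan_atLeast0)
      then show ?case by simp
    qed
    ultimately have "(\<lambda>n. \<Sum>j=m..<n. g n j) \<longlonglongrightarrow> \<kappa> - 0" by (rule Lim_transform_eventually)
    then have \<beta>lim: "(\<lambda>n. \<beta> n m) \<longlonglongrightarrow> v / 2 * \<kappa> / Pi_prod m s"
      unfolding \<beta>_def using Ps(1)[of m] by (intro tendsto_divide tendsto_mult tendsto_const) auto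
    show ?thesis unfolding \<Phi>_def A_def
    proof (rule integral_dominated_convergence[where w = "\<lambda>_. 1"])
      show "AE \<omega> in M. cmod (wave \<xi> (\<alpha> n m) (\<beta> n m) (C m \<omega>)) \<le> 1" for n
        using norm_wave_le_1[OF _ \<beta>0] by auto
      show "(\<lambda>\<omega>. wave \<xi> (\<alpha> n m) (\<beta> n m) (C m \<omega>)) \<in> borel_measurable M" for n
        by (rule measurable_fun_C)
      show "(\<lambda>\<omega>. complex_of_real (exp (- (v / 2 * \<kappa> * (T m \<omega> / Pi_prod m s))))) \<in> borel_measurable M"
        by (rule measurable_fun_C)
      show "AE \<omega> in M. (\<lambda>n. wave \<xi> (\<alpha> n m) (\<beta> n m) (C m \<omega>))
          \<longlonglongrightarrow> complex_of_real (exp (- (v / 2 * \<kappa> * (T m \<omega> / Pi_prod m s))))"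
      proof (rule AE_I2)
        fix \<omega>
        have "(\<lambda>n. exp (Complex (- (\<beta> n m * T m \<omega>)) (\<alpha> n m * X \<xi> m \<omega>)))
            \<longlonglongrightarrow> exp (Complex (- (v / 2 * \<kappa> / Pi_prod m s * T m \<omega>)) (0 * X \<xi> m \<omega>))"
          by (intro tendsto_exp tendsto_Complex tendsto_minus tendsto_mult tendsto_const \<beta>lim \<alpha>0)
        moreover have "exp (Complex (- (v / 2 * \<kappa> / Pi_prod m s * T m \<omega>)) (0 * X \<xi> m \<omega>))
            = complex_of_real (exp (- (v / 2 * \<kappa> * (T m \<omega> / Pi_prod m s))))"
        proof -
          have "Complex (- (v / 2 * \<kappa> / Pi_prod m s * T m \<omega>)) (0 * X \<xi> m \<omega>)
              = of_real (- (v / 2 * \<kappa> * (T m \<omega> / Pi_prod m s)))"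
            by (simp add: complex_eq_iff)
          then show ?thesis by (simp only: exp_of_real)
        qed
        ultimately show "(\<lambda>n. wave \<xi> (\<alpha> n m) (\<beta> n m) (C m \<omega>))
            \<longlonglongrightarrow> complex_of_real (exp (- (v / 2 * \<kappa> * (T m \<omega> / Pi_prod m s))))"
          by (simp add: wave_def)
      qed
    qed simp
  qed
  have outer: "A \<longlonglongrightarrow> L"
    unfolding A_def[abs_def] L_def
  proof (rule integral_dominated_convergence[where w = "\<lambda>_. 1"])
    show "AE \<omega> in M. cmod (complex_of_real (exp (- (v / 2 * \<kappa> * (T m \<omega> / Pi_prod m s))))) \<le> 1" for m
    proof (rule AE_I2)
      fix \<omega> assume "\<omega> \<in> space M"
      then have "0 \<le> v / 2 * \<kappa> * (T m \<omega> / Pi_prod m s)"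
        using T_bounds(1)[of \<omega> m] Ps(1)[of m] v0 \<kappa>0 by simp
      then show "cmod (complex_of_real (exp (- (v / 2 * \<kappa> * (T m \<omega> / Pi_prod m s))))) \<le> 1"
        by (simp only: norm_of_real abs_exp_cancel exp_le_one_iff neg_le_0_iff_le)
    qed
    show "(\<lambda>\<omega>. complex_of_real (exp (- (v / 2 * \<kappa> * (T m \<omega> / Pi_prod m s))))) \<in> borel_measurable M" for m
      by (rule measurable_fun_C)
    show "(\<lambda>\<omega>. complex_of_real (exp (- (v / 2 * \<kappa> * U \<omega>)))) \<in> borel_measurable M" using U(1) by measurable
    show "AE \<omega> in M. (\<lambda>m. complex_of_real (exp (- (v / 2 * \<kappa> * (T m \<omega> / Pi_prod m s)))))
        \<longlonglongrightarrow> complex_of_real (exp (- (v / 2 * \<kappa> * U \<omega>)))"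
      using U(2) by eventually_elim (intro tendsto_of_real tendsto_exp tendsto_minus tendsto_mult tendsto_const)
  qed simp
  have "(\<lambda>n. \<Phi> n n) \<longlonglongrightarrow> L"
  proof (rule LIMSEQ_I)
    fix e :: real assume e: "0 < e"
    define \<delta> where "\<delta> = min 1 (e / (3 * (K' + 1)))"
    have \<delta>: "0 < \<delta>" "\<delta> \<le> 1" using e K'0 by (auto simp: \<delta>_def)
    have "K' * \<delta> \<le> K' * (e / (3 * (K' + 1)))" using K'0 by (intro mult_left_mono) (auto simp: \<delta>_def)
    also have "\<dots> \<le> (K' + 1) * (e / (3 * (K' + 1)))" using e K'0 by (intro mult_right_mono) auto
    also have "\<dots> = e / 3" using K'0 by (simp add: field_simps)
    finally have K\<delta>: "K' * \<delta> \<le> e / 3" .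
    obtain m0 where m0: "\<And>m. m \<ge> m0 \<Longrightarrow> \<exists>N. \<forall>n\<ge>N. cmod (\<Phi> n n - \<Phi> n m) \<le> K' * \<delta>"
      using telescope[OF \<delta>] by blast
    obtain m1 where m1: "\<And>m. m \<ge> m1 \<Longrightarrow> cmod (A m - L) < e / 3"
      using LIMSEQ_D[OF outer, of "e / 3"] e by auto
    define m where "m = max m0 m1"
    obtain N1 where N1: "\<And>n. n \<ge> N1 \<Longrightarrow> cmod (\<Phi> n n - \<Phi> n m) \<le> K' * \<delta>"
      using m0[of m] by (auto simp: m_def)
    obtain N2 where N2: "\<And>n. n \<ge> N2 \<Longrightarrow> cmod (\<Phi> n m - A m) < e / 3"
      using LIMSEQ_D[OF inner, of "e / 3"] e by auto
    show "\<exists>no. \<forall>n\<ge>no. cmod (\<Phi> n n - L) < e"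
    proof (intro exI[of _ "max N1 N2"] allI impI)
      fix n assume n: "n \<ge> max N1 N2"
      have "\<Phi> n n - L = (\<Phi> n n - \<Phi> n m) + (\<Phi> n m - A m) + (A m - L)" by simp
      also have "cmod \<dots> \<le> cmod (\<Phi> n n - \<Phi> n m) + cmod (\<Phi> n m - A m) + cmod (A m - L)"
        by (intro order_trans[OF norm_triangle_ineq] add_mono norm_triangle_ineq order_refl)
      also have "\<dots> < e / 3 + e / 3 + e / 3"
        using N1[of n] N2[of n] m1[of m] n K\<delta> by (auto simp: m_def)
      finally show "cmod (\<Phi> n n - L) < e" by simp
    qed
  qed
  moreover have "\<Phi> n n = (\<integral>\<omega>. iexp (\<alpha> n n * X \<xi> n \<omega>) \<partial>M)" for n
  proof -
    have "wave \<xi> (\<alpha> n n) (\<beta> n n) c = iexp (\<alpha> n n * (nongreen c \<bullet> \<xi>))" for c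
      by (simp add: wave_def \<beta>_def complex_eq_iff exp_eq_polar)
    then show ?thesis by (simp add: \<Phi>_def)
  qed
  ultimately show ?thesis by (simp add: L_def v_def)
qed

end

section \<open>Existence of three-colour urns\<close>

text \<open>Colour drawn from content \<open>c\<close> by a uniform random number \<open>u\<close>: the unit interval is divided in
  proportion to the content, whose total is \<open>n + 1\<close>.\<close>

definition pick :: "nat \<Rightarrow> real^3 \<Rightarrow> real \<Rightarrow> 3" where
  "pick n c u = (if u * real (Suc n) < c $ 1 then 1 else if u * real (Suc n) < c $ 1 + c $ 2 then 2 else 3)"

primrec urn_content :: "real^3^3 \<Rightarrow> real^3 \<Rightarrow> nat \<Rightarrow> (nat \<Rightarrow> real) \<Rightarrow> real^3" where
  "urn_content R c 0 \<omega> = c"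
| "urn_content R c (Suc n) \<omega> = urn_content R c n \<omega> + row (pick n (urn_content R c n \<omega>) (\<omega> n)) R"

definition drawn :: "real^3^3 \<Rightarrow> real^3 \<Rightarrow> nat \<Rightarrow> (nat \<Rightarrow> real) \<Rightarrow> 3" where
  "drawn R c n \<omega> = pick (n - 1) (urn_content R c (n - 1) \<omega>) (\<omega> (n - 1))"

abbreviation uniform01 :: "real measure" where
  "uniform01 \<equiv> uniform_measure lborel {0..1}"

lemma prob_space_uniform01: "prob_space uniform01"
  by (rule prob_space_uniform_measure) auto

lemma urn_content_nonneg_total:
  assumes "stochastic_matrix R" "probability_vector c"
  shows "(\<forall>i. 0 \<le> urn_content R c n \<omega> $ i) \<and> urn_content R c n \<omega> $ 1 + urn_content R c n \<omega> $ 2 + urn_content R c n \<omega> $ 3 = real (Suc n)"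
proof (induction n)
  case 0
  then show ?case using assms by (simp add: probability_vector_def sum_3)
next
  case (Suc n)
  have "probability_vector (row (pick n (urn_content R c n \<omega>) (\<omega> n)) R)"
    using assms by (simp add: stochastic_matrix_def)
  then show ?case using Suc by (simp add: probability_vector_def sum_3)
qed

lemma urn_content_restrict: "m \<le> n \<Longrightarrow> urn_content R c m (restrict \<omega> {..<n}) = urn_content R c m \<omega>"
  by (induction m) auto

lemma measurable_vec_nth [measurable]: "(\<lambda>x :: real^'k. x $ i) \<in> borel_measurable borel"
  by (intro borel_measurable_continuous_onI continuous_intros)

lemma urn_content_measurable:
  "{..<n} \<subseteq> I \<Longrightarrow> urn_content R c n \<in> borel_measurable (PiM I (\<lambda>_. uniform01))"
proof (induction n)
  case 0
  then show ?case by simp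
next
  case (Suc n)
  have [measurable]: "urn_content R c n \<in> borel_measurable (PiM I (\<lambda>_. uniform01))"
    by (rule Suc.IH) (use Suc.prems in auto)
  have "n \<in> I" using Suc.prems by auto
  then have [measurable]: "(\<lambda>\<omega>. \<omega> n) \<in> borel_measurable (PiM I (\<lambda>_. uniform01))"
    using measurable_component_singleton[of n I "\<lambda>_. uniform01"]
    by (simp cong: measurable_cong_sets)
  have "urn_content R c (Suc n) = (\<lambda>\<omega>. urn_content R c n \<omega> +
      (if \<omega> n * real (Suc n) < urn_content R c n \<omega> $ 1 then row 1 R
       else if \<omega> n * real (Suc n) < urn_content R c n \<omega> $ 1 + urn_content R c n \<omega> $ 2 then row 2 R else row 3 R))"
    by (auto simp: fun_eq_iff pick_def)
  then show ?case by (simp del: of_nat_Suc urn_content.simps)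
qed

lemma pick_measurable_pair:
  assumes [measurable]: "f \<in> borel_measurable N" "g \<in> borel_measurable N"
  shows "(\<lambda>x. pick n (f x) (g x)) \<in> N \<rightarrow>\<^sub>M count_space UNIV"
  unfolding pick_def by measurable

lemma prob_pick:
  assumes c: "\<forall>i. 0 \<le> c $ i" "c $ 1 + c $ 2 + c $ 3 = real (Suc n)"
  shows "measure uniform01 {u. pick n c u = i} = c $ i / real (Suc n)"
proof -
  define N where "N = real (Suc n)"
  have N: "N > 0" by (simp add: N_def)
  define x y where "x = c $ 1 / N" and "y = (c $ 1 + c $ 2) / N"
  have c0: "0 \<le> c $ 1" "0 \<le> c $ 2" "0 \<le> c $ 3" using c by auto
  have xy: "0 \<le> x" "x \<le> y" "y \<le> 1"
    using c0 c(2)[folded N_def] N by (auto simp: x_def y_def divide_right_mono)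
  have pick: "pick n c u = (if u < x then 1 else if u < y then 2 else 3)" for u
    using N by (simp add: pick_def x_def y_def N_def[symmetric] pos_less_divide_eq del: of_nat_Suc)
  have ne: "(1::3) \<noteq> 2" "(1::3) \<noteq> 3" "(2::3) \<noteq> 3" by auto
  have meas: "{u. pick n c u = i} \<in> sets lborel"
    using measurable_sets[OF pick_measurable_pair[of "\<lambda>_. c" borel "\<lambda>u. u" n], of "{i}"]
    by (simp add: vimage_def)
  have U: "measure uniform01 {u. pick n c u = i} = measure lborel ({0..1} \<inter> {u. pick n c u = i})"
    using meas by (subst measure_uniform_measure) (auto simp: measure_def)
  consider "i = 1" | "i = 2" | "i = 3" using exhaust_3 by blast
  then show ?thesis
  proof cases
    case 1
    have "{0..1} \<inter> {u. pick n c u = i} = {0..<x}" using xy ne by (auto simp: pick 1)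
    then show ?thesis unfolding U using xy by (simp add: 1 x_def N_def)
  next
    case 2
    have "{0..1} \<inter> {u. pick n c u = i} = {x..<y}" using xy ne by (auto simp: pick 2)
    then have "measure uniform01 {u. pick n c u = i} = y - x" unfolding U using xy by simp
    then show ?thesis by (simp add: 2 x_def y_def N_def add_divide_distrib)
  next
    case 3
    have "{0..1} \<inter> {u. pick n c u = i} = {y..1}" using xy ne by (auto simp: pick 3)
    then have "measure uniform01 {u. pick n c u = i} = 1 - y" unfolding U using xy by simp
    moreover have "c $ 3 = N - (c $ 1 + c $ 2)" using c(2) by (simp add: N_def)
    ultimately show ?thesis using N by (simp add: 3 y_def N_def[symmetric] diff_divide_distrib del: of_nat_Suc)
  qed
qed

text \<open>The past \<open>(\<omega> k)\<^sub>k\<^sub><\<^sub>n\<close> determines the content after \<open>n\<close> draws and is independent of \<open>\<omega> n\<close>, so the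
  conditional probability of a colour is obtained by integrating out \<open>\<omega> n\<close> alone.\<close>

lemma drawn_integral:
  fixes R :: "real^3^3"
  assumes R: "stochastic_matrix R" "probability_vector c"
    and B: "B \<in> sets (PiM {..<n} (\<lambda>_. uniform01))"
  defines "P \<equiv> PiM UNIV (\<lambda>_::nat. uniform01)"
  shows "(\<integral>\<omega>. indicator B (restrict \<omega> {..<n}) * indicator {\<omega>. drawn R c (Suc n) \<omega> = i} \<omega> \<partial>P)
    = (\<integral>\<omega>. indicator B (restrict \<omega> {..<n}) * (urn_content R c n \<omega> $ i / real (Suc n)) \<partial>P)"
proof -
  interpret U: prob_space uniform01 by (rule prob_space_uniform01)
  interpret prod: product_prob_space "\<lambda>_::nat. uniform01" UNIV by unfold_locales
  interpret PP: prob_space P unfolding P_def by (rule prob_space_PiM) (rule prob_space_uniform01)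
  let ?S = "PiM {..<n} (\<lambda>_::nat. uniform01)"
  define Z where "Z \<omega> = restrict \<omega> {..<n}" for \<omega> :: "nat \<Rightarrow> real"
  have indep: "PP.indep_vars (\<lambda>_. uniform01) (\<lambda>k \<omega>. \<omega> k) UNIV"
  proof (subst PP.indep_vars_iff_distr_eq_PiM')
    show "distr P (PiM UNIV (\<lambda>_. uniform01)) (\<lambda>x. \<lambda>k\<in>UNIV. x k) = PiM UNIV (\<lambda>k. distr P uniform01 (\<lambda>\<omega>. \<omega> k))"
      unfolding P_def using prod.PiM_component by (simp add: distr_id2 restrict_UNIV)
  qed (auto simp: P_def)
  let ?S1 = "PiM {n} (\<lambda>_::nat. uniform01)"
  define Y where "Y \<omega> = restrict \<omega> {n}" for \<omega> :: "nat \<Rightarrow> real"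
  have "PP.indep_var ?S Z ?S1 Y"
    unfolding Z_def Y_def by (rule PP.indep_var_restrict[OF indep]) auto
  then have Zm [measurable]: "Z \<in> P \<rightarrow>\<^sub>M ?S" and Ym [measurable]: "Y \<in> P \<rightarrow>\<^sub>M ?S1"
    and joint: "distr P ?S Z \<Otimes>\<^sub>M distr P ?S1 Y = distr P (?S \<Otimes>\<^sub>M ?S1) (\<lambda>\<omega>. (Z \<omega>, Y \<omega>))"
    by (auto simp: PP.indep_var_distribution_eq)
  have Y: "distr P ?S1 Y = ?S1"
    unfolding P_def Y_def by (rule prod.distr_PiM_restrict_finite) auto
  interpret S1: prob_space ?S1 by (rule prob_space_PiM) (rule prob_space_uniform01)
  have comp: "distr ?S1 uniform01 (\<lambda>y. y n) = uniform01"
    by (rule distr_PiM_component) (auto intro: prob_space_uniform01)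
  have evm: "(\<lambda>y. y n) \<in> ?S1 \<rightarrow>\<^sub>M uniform01" by simp
  define D where "D = distr P ?S Z"
  interpret D: prob_space D unfolding D_def by (rule PP.prob_space_distr) simp
  interpret pair: pair_prob_space D ?S1 ..
  have setsD [measurable_cong]: "sets D = sets ?S" by (simp add: D_def)
  have cm [measurable]: "urn_content R c n \<in> borel_measurable ?S" by (rule urn_content_measurable) simp
  define h where "h = (\<lambda>(z, y). indicat_real B z * indicator {i} (pick n (urn_content R c n z) (y n)))"
  have pm: "(\<lambda>x. pick n (urn_content R c n (fst x)) (snd x n)) \<in> (?S \<Otimes>\<^sub>M ?S1) \<rightarrow>\<^sub>M count_space UNIV"
    by (rule pick_measurable_pair) (auto intro!: measurable_compose[OF measurable_fst cm]
        measurable_compose[OF measurable_compose[OF measurable_snd evm]] cong: measurable_cong_sets)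
  have hm [measurable]: "h \<in> borel_measurable (?S \<Otimes>\<^sub>M ?S1)"
  proof -
    have "(\<lambda>x. indicat_real {i} (pick n (urn_content R c n (fst x)) (snd x n))) \<in> borel_measurable (?S \<Otimes>\<^sub>M ?S1)"
      by (rule measurable_compose[OF pm]) simp
    moreover have "(\<lambda>x. indicat_real B (fst x)) \<in> borel_measurable (?S \<Otimes>\<^sub>M ?S1)"
      using B by measurable
    ultimately show ?thesis unfolding h_def by (simp add: case_prod_beta)
  qed
  have hmD: "h \<in> borel_measurable (D \<Otimes>\<^sub>M ?S1)"
    using hm by (simp cong: measurable_cong_sets sets_pair_measure_cong add: setsD)
  have hint: "integrable (D \<Otimes>\<^sub>M ?S1) h"
    by (rule pair.integrable_const_bound[OF _ hmD, of 1]) (auto simp: h_def indicator_def)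
  have "(\<integral>\<omega>. indicator B (restrict \<omega> {..<n}) * indicator {\<omega>. drawn R c (Suc n) \<omega> = i} \<omega> \<partial>P)
      = (\<integral>\<omega>. h (Z \<omega>, Y \<omega>) \<partial>P)"
    by (intro Bochner_Integration.integral_cong refl)
      (simp add: h_def Z_def Y_def drawn_def urn_content_restrict indicator_def)
  also have "\<dots> = (\<integral>x. h x \<partial>(distr P (?S \<Otimes>\<^sub>M ?S1) (\<lambda>\<omega>. (Z \<omega>, Y \<omega>))))"
    by (subst integral_distr) auto
  also have "\<dots> = (\<integral>x. h x \<partial>(D \<Otimes>\<^sub>M ?S1))"
    by (simp only: joint[symmetric] Y D_def)
  also have "\<dots> = (\<integral>z. (\<integral>y. h (z, y) \<partial>?S1) \<partial>D)"
    by (rule pair.integral_fst'[OF hint, symmetric])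
  also have "\<dots> = (\<integral>z. indicator B z * (urn_content R c n z $ i / real (Suc n)) \<partial>D)"
  proof (rule Bochner_Integration.integral_cong[OF refl])
    fix z
    have m: "{u. pick n (urn_content R c n z) u = i} \<in> sets uniform01"
      using measurable_sets[OF pick_measurable_pair[of "\<lambda>_. urn_content R c n z" borel "\<lambda>u. u" n], of "{i}"]
      by (simp add: vimage_def)
    have "(\<integral>y. h (z, y) \<partial>?S1) = indicator B z * (\<integral>y. indicator {u. pick n (urn_content R c n z) u = i} (y n) \<partial>?S1)"
      by (simp add: h_def indicator_def)
    also have "(\<integral>y. indicator {u. pick n (urn_content R c n z) u = i} (y n) \<partial>?S1)
        = (\<integral>u. indicat_real {u. pick n (urn_content R c n z) u = i} u \<partial>uniform01)"
      by (subst (2) comp[symmetric], subst integral_distr[OF evm]) (use m in auto)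
    also have "\<dots> = urn_content R c n z $ i / real (Suc n)"
    proof -
      have "(\<integral>u. indicat_real {u. pick n (urn_content R c n z) u = i} u \<partial>uniform01)
          = measure uniform01 {u. pick n (urn_content R c n z) u = i}"
        using m by (simp del: measure_uniform_measure)
      then show ?thesis using prob_pick[of "urn_content R c n z" n i] urn_content_nonneg_total[OF R, of n z]
        by (simp del: measure_uniform_measure)
    qed
    finally show "(\<integral>y. h (z, y) \<partial>?S1) = indicator B z * (urn_content R c n z $ i / real (Suc n))" .
  qed
  also have "\<dots> = (\<integral>\<omega>. indicator B (Z \<omega>) * (urn_content R c n (Z \<omega>) $ i / real (Suc n)) \<partial>P)"
    unfolding D_def using B by (subst integral_distr) auto
  finally show ?thesis by (simp add: Z_def urn_content_restrict)
qed

theorem urn_process_exists: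
  fixes R :: "real^3^3"
  assumes R: "stochastic_matrix R" "probability_vector c"
  shows "urn_process (PiM UNIV (\<lambda>_::nat. uniform01)) R c (drawn R c) (urn_content R c)"
proof -
  define P where "P = PiM UNIV (\<lambda>_::nat. uniform01)"
  interpret PP: prob_space P unfolding P_def by (rule prob_space_PiM) (rule prob_space_uniform01)
  have cm [measurable]: "urn_content R c n \<in> borel_measurable P" for n
    unfolding P_def by (rule urn_content_measurable) simp
  have om [measurable]: "(\<lambda>\<omega>. \<omega> n) \<in> borel_measurable P" for n
    unfolding P_def using measurable_component_singleton[of n UNIV "\<lambda>_. uniform01"]
    by (simp cong: measurable_cong_sets)
  have dm: "drawn R c (Suc n) \<in> P \<rightarrow>\<^sub>M count_space UNIV" for n
    unfolding drawn_def[abs_def] by (rule pick_measurable_pair) simp_all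
  have "urn_process P R c (drawn R c) (urn_content R c)"
  proof (unfold_locales, goal_cases)
    case (6 n i)
    let ?F = "natural_filtration P (urn_content R c) n"
    have spF: "space ?F = space P"
      unfolding natural_filtration_def by (rule space_measure_of) auto
    have setsF: "sets ?F = sigma_sets (space P) (\<Union>k\<in>{..n}. {urn_content R c k -` A \<inter> space P | A. A \<in> sets borel})"
      unfolding natural_filtration_def by (rule sets_measure_of) auto
    have "(\<Union>k\<in>{..n}. {urn_content R c k -` A \<inter> space P | A. A \<in> sets borel}) \<subseteq> sets P"
      using measurable_sets[OF cm] by blast
    then have sub: "subalgebra P ?F"
      by (simp add: subalgebra_def spF setsF sets.sigma_sets_subset)
    interpret finite_measure_subalgebra P ?F by unfold_locales (rule sub)
    let ?S = "PiM {..<n} (\<lambda>_::nat. uniform01)"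
    have past: "\<exists>B\<in>sets ?S. A = (\<lambda>\<omega>. restrict \<omega> {..<n}) -` B \<inter> space P" if "A \<in> sets ?F" for A
    proof -
      let ?V = "vimage_algebra (space P) (\<lambda>\<omega>. restrict \<omega> {..<n}) ?S"
      have Z: "(\<lambda>\<omega>. restrict \<omega> {..<n}) \<in> space P \<rightarrow> space ?S"
        by (auto simp: P_def space_PiM)
      have "(\<Union>k\<in>{..n}. {urn_content R c k -` A \<inter> space P | A. A \<in> sets borel}) \<subseteq> sets ?V"
      proof (clarsimp)
        fix k and A :: "(real^3) set" assume k: "k \<le> n" and A: "A \<in> sets borel"
        have "urn_content R c k \<in> borel_measurable ?S" using k by (intro urn_content_measurable) auto
        from measurable_sets[OF measurable_compose[OF measurable_vimage_algebra1[OF Z] this] A]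
        show "urn_content R c k -` A \<inter> space P \<in> sets ?V"
          using k by (simp add: urn_content_restrict)
      qed
      then have "sets ?F \<subseteq> sets ?V"
        unfolding setsF using sets.sigma_sets_subset[of _ ?V] by simp
      then show ?thesis using that by (auto simp: sets_vimage_algebra2[OF Z])
    qed
    show ?case
    proof (rule real_cond_exp_charact)
      have ds: "{\<omega>\<in>space P. drawn R c (Suc n) \<omega> = i} \<in> sets P"
        using measurable_sets[OF dm[of n], of "{i}"] by (simp add: vimage_def Int_def conj_commute)
      then show "integrable P (indicat_real {\<omega>\<in>space P. drawn R c (Suc n) \<omega> = i})"
        by (intro integrable_real_indicator) (auto simp: PP.emeasure_eq_measure)
      have cF: "urn_content R c n \<in> borel_measurable ?F"
        by (rule measurableI) (auto simp: spF setsF intro!: sigma_sets.Basic)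
      then show "(\<lambda>\<omega>. urn_content R c n \<omega> $ i / real (Suc n)) \<in> borel_measurable ?F" by measurable
      show "integrable P (\<lambda>\<omega>. urn_content R c n \<omega> $ i / real (Suc n))"
      proof (rule PP.integrable_const_bound[of _ 1])
        have "urn_content R c n \<omega> $ i \<le> real (Suc n)" for \<omega>
          using urn_content_nonneg_total[OF R, of n \<omega>] exhaust_3[of i] by (smt (verit))
        moreover have "0 \<le> urn_content R c n \<omega> $ i" for \<omega>
          using urn_content_nonneg_total[OF R, of n \<omega>] by blast
        ultimately show "AE \<omega> in P. norm (urn_content R c n \<omega> $ i / real (Suc n)) \<le> 1" by simp
      qed measurable
      fix A assume "A \<in> sets ?F"
      then obtain B where B: "B \<in> sets ?S" "A = (\<lambda>\<omega>. restrict \<omega> {..<n}) -` B \<inter> space P"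
        using past by blast
      have "(\<integral>\<omega>\<in>A. indicat_real {\<omega>\<in>space P. drawn R c (Suc n) \<omega> = i} \<omega> \<partial>P)
          = (\<integral>\<omega>. indicator B (restrict \<omega> {..<n}) * indicator {\<omega>. drawn R c (Suc n) \<omega> = i} \<omega> \<partial>P)"
        unfolding set_lebesgue_integral_def
        by (rule Bochner_Integration.integral_cong) (auto simp: B(2) indicator_def)
      also have "\<dots> = (\<integral>\<omega>. indicator B (restrict \<omega> {..<n}) * (urn_content R c n \<omega> $ i / real (Suc n)) \<partial>P)"
        unfolding P_def by (rule drawn_integral[OF R B(1)])
      also have "\<dots> = (\<integral>\<omega>\<in>A. urn_content R c n \<omega> $ i / real (Suc n) \<partial>P)"
        unfolding set_lebesgue_integral_def
        by (rule Bochner_Integration.integral_cong) (auto simp: B(2) indicator_def)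
      finally show "(\<integral>\<omega>\<in>A. indicat_real {\<omega>\<in>space P. drawn R c (Suc n) \<omega> = i} \<omega> \<partial>P)
          = (\<integral>\<omega>\<in>A. urn_content R c n \<omega> $ i / real (Suc n) \<partial>P)" .
    qed
  qed (use R dm in \<open>auto simp: drawn_def\<close>)
  then show ?thesis by (simp add: P_def)
qed

section \<open>The quadratic variation\<close>

text \<open>The conditional variances of the normalised martingale are on average close to a constant
  multiple of \<open>\<Pi>\<^sub>j(s) / ((j + 1) \<Pi>\<^sub>j\<^sub>+\<^sub>1(s l)\<^sup>2)\<close>. These terms are, to first order, proportional to the
  increments of \<open>\<Pi>(s) / \<Pi>(s l)\<^sup>2\<close>, so Stolz--Cesaro evaluates their sum; the proportionality factor
  \<open>s (1 - 2 l)\<close> is the denominator of the subcritical variance.\<close>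

lemma Pi_ratio_step:
  assumes "- 1 < s * l"
  shows "Pi_prod (Suc n) s / (Pi_prod (Suc n) (s * l))\<^sup>2 - Pi_prod n s / (Pi_prod n (s * l))\<^sup>2
    = Pi_prod n s / (real (Suc n) * (Pi_prod (Suc n) (s * l))\<^sup>2) * (s * (1 - 2 * l) - (s * l)\<^sup>2 / real (Suc n))"
proof -
  define N where "N = real (Suc n)"
  have N: "N > 0" by (simp add: N_def)
  define A B q where "A = Pi_prod n s" and "B = Pi_prod n (s * l)" and "q = 1 + s * l / N"
  have pos: "B > 0" "q > 0" using assms unfolding B_def q_def N_def by (auto intro: Pi_prod_pos Pi_factor_pos simp del: of_nat_Suc)
  have "A * (1 + s / N) / (B * q)\<^sup>2 - A / B\<^sup>2 = A * ((1 + s / N) - q\<^sup>2) / (B * q)\<^sup>2"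
    using pos by (simp add: field_simps)
  also have "(1 + s / N) - q\<^sup>2 = (s * (1 - 2 * l) - (s * l)\<^sup>2 / N) / N"
    using N by (simp add: q_def power2_eq_square field_simps)
  finally show ?thesis
    unfolding Pi_prod_Suc N_def[symmetric] A_def[symmetric] B_def[symmetric] q_def[symmetric] by simp
qed

lemma quadratic_variation_subcritical:
  assumes s: "0 < s" "s < 1" and l: "- 1 < s * l" "l < 1/2"
  shows "(\<lambda>n. (Pi_prod n (s * l) / real n powr (s / 2))\<^sup>2
      * (\<Sum>j<n. Pi_prod j s / (real (Suc j) * (Pi_prod (Suc j) (s * l))\<^sup>2)))
    \<longlonglongrightarrow> 1 / (Gamma (1 + s) * (s * (1 - 2 * l)))"
proof -
  define q where "q j = Pi_prod j s / (real (Suc j) * (Pi_prod (Suc j) (s * l))\<^sup>2)" for j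
  define H where "H n = (\<Sum>j<n. q j)" for n
  define Y where "Y n = Pi_prod n s / (Pi_prod n (s * l))\<^sup>2" for n
  define d where "d = s * (1 - 2 * l)"
  have d: "d > 0" using s l by (simp add: d_def)
  have pos: "Pi_prod n s > 0" "Pi_prod n (s * l) > 0" for n using s l by (auto intro: Pi_prod_pos)
  have q0: "q j > 0" for j using pos[of j] pos[of "Suc j"] by (simp add: q_def)
  have step: "Y (Suc n) - Y n = q n * (d - (s * l)\<^sup>2 / real (Suc n))" for n
    unfolding Y_def q_def d_def by (rule Pi_ratio_step[OF l(1)])
  have HS: "H (Suc n) - H n = q n" for n by (simp add: H_def)
  have inc: "H n < H (Suc n)" for n using HS[of n] q0[of n] by linarith
  have YH: "Y n \<le> 1 + d * H n" for n
  proof (induction n)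
    case 0 then show ?case by (simp add: Y_def H_def)
  next
    case (Suc n)
    have "q n * (d - (s * l)\<^sup>2 / real (Suc n)) \<le> q n * d" using q0[of n] by (intro mult_left_mono) auto
    then have "Y (Suc n) \<le> Y n + d * q n" using step[of n] by (simp add: mult.commute)
    then show ?case using Suc HS[of n] by (simp add: algebra_simps)
  qed
  have Ydiv: "filterlim Y at_top sequentially"
  proof -
    obtain b1 where b1: "b1 > 0" "\<And>n. b1 * real (n + 1) powr s \<le> Pi_prod n s"
      using Pi_prod_bounds[of s] s by (metis less_trans neg_less_0_iff_less zero_less_one)
    obtain b2 where b2: "b2 > 0" "\<And>n. Pi_prod n (s * l) \<le> b2 * real (n + 1) powr (s * l)"
      using Pi_prod_bounds[of "s * l"] l by metis
    have "b1 / b2\<^sup>2 * real (n + 1) powr d \<le> Y n" for n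
    proof -
      have "real (n + 1) powr d = real (n + 1) powr s / (real (n + 1) powr (s * l))\<^sup>2"
      proof -
        have "d = s - (s * l + s * l)" by (simp add: d_def algebra_simps)
        then show ?thesis by (simp only: powr_diff powr_add power2_eq_square)
      qed
      then have "b1 / b2\<^sup>2 * real (n + 1) powr d = (b1 * real (n + 1) powr s) / (b2 * real (n + 1) powr (s * l))\<^sup>2"
        by (simp add: power_mult_distrib)
      also have "\<dots> \<le> Y n" unfolding Y_def using b1 b2 pos[of n]
        by (intro frac_le power_mono) (auto intro: less_imp_le)
      finally show ?thesis .
    qed
    moreover have "filterlim (\<lambda>n. b1 / b2\<^sup>2 * real (n + 1) powr d) at_top sequentially"
      using divide_pos_pos[OF b1(1), of "b2\<^sup>2"] b2(1) d by real_asymp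
    ultimately show ?thesis by (intro filterlim_at_top_mono[of _ _ Y]) auto
  qed
  have Hdiv: "filterlim H at_top sequentially"
  proof (subst filterlim_at_top, intro allI)
    fix z
    have "eventually (\<lambda>n. Y n \<ge> 1 + d * z) sequentially" using Ydiv by (simp add: filterlim_at_top)
    then show "eventually (\<lambda>n. z \<le> H n) sequentially"
    proof eventually_elim
      case (elim n)
      then have "d * z \<le> d * H n" using YH[of n] by linarith
      then show ?case using d by simp
    qed
  qed
  have "(\<lambda>n. Y n / H n) \<longlonglongrightarrow> d"
  proof (rule stolz_cesaro[OF inc Hdiv])
    have "(Y (Suc n) - Y n) / (H (Suc n) - H n) = d - (s * l)\<^sup>2 / real (Suc n)" for n
      unfolding step HS using q0[of n] by simp
    moreover have "(\<lambda>n. d - (s * l)\<^sup>2 / real (Suc n)) \<longlonglongrightarrow> d" by real_asymp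
    ultimately show "(\<lambda>n. (Y (Suc n) - Y n) / (H (Suc n) - H n)) \<longlonglongrightarrow> d" by simp
  qed
  then have "(\<lambda>n. (Pi_prod n s / real n powr s) / (Y n / H n)) \<longlonglongrightarrow> (1 / Gamma (1 + s)) / d"
    using d s by (intro tendsto_divide Pi_prod_asymptotic) auto
  moreover have "(Pi_prod n s / real n powr s) / (Y n / H n) = (Pi_prod n (s * l) / real n powr (s / 2))\<^sup>2 * H n" for n
  proof -
    have "real n powr s = (real n powr (s / 2))\<^sup>2"
      by (simp add: power2_eq_square flip: powr_add)
    then show ?thesis using pos[of n] by (simp add: Y_def power_divide)
  qed
  ultimately show ?thesis by (simp add: H_def q_def d_def)
qed

text \<open>For \<open>l = 1/2\<close> the factor vanishes: \<open>\<Pi>(s) / \<Pi>(s / 2)\<^sup>2\<close> converges, the terms are of order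
  \<open>1 / j\<close>, and their sum is compared with the logarithm.\<close>

lemma quadratic_variation_critical:
  assumes s: "0 < s" "s < 1"
  shows "(\<lambda>n. (Pi_prod n (s * (1/2)) / sqrt (real n powr s * ln (real n)))\<^sup>2
      * (\<Sum>j<n. Pi_prod j s / (real (Suc j) * (Pi_prod (Suc j) (s * (1/2)))\<^sup>2)))
    \<longlonglongrightarrow> 1 / Gamma (1 + s)"
proof -
  define a where "a = s * (1/2)"
  have a: "a > 0" "a > - 1" using s by (auto simp: a_def)
  define q where "q j = Pi_prod j s / (real (Suc j) * (Pi_prod (Suc j) a)\<^sup>2)" for j
  define H where "H n = (\<Sum>j<n. q j)" for n
  define Y where "Y n = Pi_prod n s / (Pi_prod n a)\<^sup>2" for n
  define y where "y = (1 / Gamma (1 + s)) / (1 / Gamma (1 + a))\<^sup>2"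
  have pos: "Pi_prod n s > 0" "Pi_prod n a > 0" for n using s a by (auto intro: Pi_prod_pos)
  have Ga: "Gamma (1 + a) > 0" by (rule Gamma_pos[OF a(2)])
  have Ylim: "Y \<longlonglongrightarrow> y"
  proof -
    have "(\<lambda>n. (Pi_prod n s / real (n + 1) powr s) / (Pi_prod n a / real (n + 1) powr a)\<^sup>2) \<longlonglongrightarrow> y"
      unfolding y_def
      by (rule tendsto_divide[OF Pi_prod_asymptotic_Suc tendsto_power[OF Pi_prod_asymptotic_Suc]])
        (use s a Ga less_imp_neq[OF Ga] in auto)
    moreover have "(Pi_prod n s / real (n + 1) powr s) / (Pi_prod n a / real (n + 1) powr a)\<^sup>2 = Y n" for n
    proof -
      have "real (n + 1) powr s = (real (n + 1) powr a)\<^sup>2"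
        by (simp add: power2_eq_square a_def flip: powr_add)
      then show ?thesis by (simp add: Y_def power_divide)
    qed
    ultimately show ?thesis by simp
  qed
  have H: "(\<lambda>n. H n / ln (real (n + 1))) \<longlonglongrightarrow> y"
  proof (rule stolz_cesaro)
    show "ln (real (n + 1)) < ln (real (Suc n + 1))" for n by simp
    show "filterlim (\<lambda>n. ln (real (n + 1))) at_top sequentially" by real_asymp
    have "(H (Suc n) - H n) / (ln (real (Suc n + 1)) - ln (real (n + 1)))
        = Y n * (1 / ((1 + a / real (Suc n))\<^sup>2 * (real (Suc n) * (ln (real (Suc n + 1)) - ln (real (n + 1))))))" for n
      by (simp add: H_def q_def Y_def Pi_prod_Suc power_mult_distrib mult_ac del: of_nat_Suc)
    moreover have "(\<lambda>n. 1 / ((1 + a / real (Suc n))\<^sup>2 * (real (Suc n) * (ln (real (Suc n + 1)) - ln (real (n + 1)))))) \<longlonglongrightarrow> 1"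
      by real_asymp
    from tendsto_mult[OF Ylim this]
    have "(\<lambda>n. Y n * (1 / ((1 + a / real (Suc n))\<^sup>2 * (real (Suc n) * (ln (real (Suc n + 1)) - ln (real (n + 1))))))) \<longlonglongrightarrow> y"
      by simp
    ultimately show "(\<lambda>n. (H (Suc n) - H n) / (ln (real (Suc n + 1)) - ln (real (n + 1)))) \<longlonglongrightarrow> y" by simp
  qed
  have "(\<lambda>n. (Pi_prod n a / real n powr a)\<^sup>2 * (H n / ln (real (n + 1))) * (ln (real (n + 1)) / ln (real n)))
      \<longlonglongrightarrow> (1 / Gamma (1 + a))\<^sup>2 * y * 1"
  proof (intro tendsto_mult tendsto_power Pi_prod_asymptotic a H)
    show "(\<lambda>n. ln (real (n + 1)) / ln (real n)) \<longlonglongrightarrow> 1" by real_asymp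
  qed
  moreover have "eventually (\<lambda>n. (Pi_prod n a / real n powr a)\<^sup>2 * (H n / ln (real (n + 1))) * (ln (real (n + 1)) / ln (real n))
      = (Pi_prod n a / sqrt (real n powr s * ln (real n)))\<^sup>2 * H n) sequentially"
    using eventually_gt_at_top[of 1]
  proof eventually_elim
    case (elim n)
    have "(real n powr a)\<^sup>2 = real n powr s" by (simp add: power2_eq_square a_def flip: powr_add)
    moreover have "(sqrt (real n powr s * ln (real n)))\<^sup>2 = real n powr s * ln (real n)" using elim by simp
    moreover have "ln (real (n + 1)) \<noteq> 0" using elim by simp
    ultimately show ?case by (simp add: power_divide)
  qed
  ultimately have "(\<lambda>n. (Pi_prod n a / sqrt (real n powr s * ln (real n)))\<^sup>2 * H n) \<longlonglongrightarrow> (1 / Gamma (1 + a))\<^sup>2 * y * 1"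
    by (rule Lim_transform_eventually)
  moreover have "(1 / Gamma (1 + a))\<^sup>2 * y * 1 = 1 / Gamma (1 + s)" using Ga by (simp add: y_def)
  ultimately show ?thesis by (simp add: H_def q_def a_def)
qed

section \<open>Mixtures of normal distributions\<close>

text \<open>Integrate out the normal variable first.\<close>

lemma char_normal_variance_mixture:
  assumes "prob_space M" and U: "U \<in> borel_measurable M" "AE \<omega> in M. 0 \<le> U \<omega>" and c: "0 \<le> c"
  shows "real_distribution (normal_variance_mixture M c U)"
    and "char (normal_variance_mixture M c U) t = (\<integral>\<omega>. of_real (exp (- (t\<^sup>2 / 2 * c * U \<omega>))) \<partial>M)"
proof -
  interpret prob_space M by fact
  interpret D: prob_space "distr M borel U" by (rule prob_space_distr) (rule U)
  interpret N: real_distribution std_normal_distribution by (rule real_dist_normal_dist)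
  interpret DN: pair_prob_space "distr M borel U" std_normal_distribution ..
  have [measurable_cong]: "sets std_normal_distribution = sets borel" by simp
  have f [measurable]: "(\<lambda>(u, z). sqrt (c * u) * z) \<in> borel_measurable (distr M borel U \<Otimes>\<^sub>M std_normal_distribution)"
    by measurable
  show "real_distribution (normal_variance_mixture M c U)"
    unfolding normal_variance_mixture_def real_distribution_def real_distribution_axioms_def
    by (auto intro!: DN.prob_space_distr)
  have gm: "(\<lambda>(u, z). iexp (t * (sqrt (c * u) * z))) \<in> borel_measurable (distr M borel U \<Otimes>\<^sub>M std_normal_distribution)"
    by measurable
  have int: "integrable (distr M borel U \<Otimes>\<^sub>M std_normal_distribution) (\<lambda>(u, z). iexp (t * (sqrt (c * u) * z)))"
    by (rule DN.integrable_const_bound[OF _ gm, of 1]) auto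
  have "char (normal_variance_mixture M c U) t
      = (\<integral>x. (\<lambda>(u, z). iexp (t * (sqrt (c * u) * z))) x \<partial>(distr M borel U \<Otimes>\<^sub>M std_normal_distribution))"
    unfolding char_def normal_variance_mixture_def
    by (subst integral_distr) (auto simp: case_prod_unfold)
  also have "\<dots> = (\<integral>u. (\<integral>z. iexp (t * (sqrt (c * u) * z)) \<partial>std_normal_distribution) \<partial>distr M borel U)"
    using DN.integral_fst'[OF int] by simp
  also have "\<dots> = (\<integral>u. char std_normal_distribution (t * sqrt (c * u)) \<partial>distr M borel U)"
    by (simp add: char_def mult.assoc)
  also have "\<dots> = (\<integral>\<omega>. of_real (exp (- ((t * sqrt (c * U \<omega>))\<^sup>2) / 2)) \<partial>M)"
    unfolding char_std_normal_distribution using U by (subst integral_distr) auto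
  also have "\<dots> = (\<integral>\<omega>. of_real (exp (- (t\<^sup>2 / 2 * c * U \<omega>))) \<partial>M)"
  proof (rule integral_cong_AE)
    show "AE \<omega> in M. complex_of_real (exp (- ((t * sqrt (c * U \<omega>))\<^sup>2) / 2)) = of_real (exp (- (t\<^sup>2 / 2 * c * U \<omega>)))"
      using U(2)
    proof eventually_elim
      case (elim \<omega>)
      have "(sqrt (c * U \<omega>))\<^sup>2 = c * U \<omega>" using elim c by simp
      then show ?case by (simp add: power_mult_distrib)
    qed
  qed (use U in \<open>simp_all\<close>)
  finally show "char (normal_variance_mixture M c U) t = (\<integral>\<omega>. of_real (exp (- (t\<^sup>2 / 2 * c * U \<omega>))) \<partial>M)" .
qed

context triangular_urn
begin

text \<open>Levy's continuity theorem. The coefficients \<open>t / \<nu> n\<close> are propagated back to time \<open>k\<close> by the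
  mean growth \<open>\<Pi>\<^sub>n(s l) / \<Pi>\<^sub>k(s l)\<close>. They are uniformly small because \<open>\<Pi>\<^sub>k(s l)\<close> is monotone in \<open>k\<close>, so
  the extreme values occur at \<open>k = 0\<close> or at \<open>k = n\<close>.\<close>

theorem functional_converges_to_mixture:
  fixes \<nu> :: "nat \<Rightarrow> real"
  assumes \<xi>: "Q *v \<xi> = l *\<^sub>R \<xi>" and l: "l < 1" "- 1 < s * l" and opposite: "\<xi> $ 1 * \<xi> $ 2 \<le> 0"
    and \<nu>0: "\<And>n. 0 \<le> \<nu> n" and small: "(\<lambda>n. 1 / \<nu> n) \<longlonglongrightarrow> 0" "(\<lambda>n. Pi_prod n (s * l) / \<nu> n) \<longlonglongrightarrow> 0"
    and qv: "(\<lambda>n. (Pi_prod n (s * l) / \<nu> n)\<^sup>2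
      * (\<Sum>j<n. Pi_prod j s / (real (Suc j) * (Pi_prod (Suc j) (s * l))\<^sup>2))) \<longlonglongrightarrow> \<kappa>"
    and U: "U \<in> borel_measurable M" "AE \<omega> in M. 0 \<le> U \<omega>"
      "AE \<omega> in M. (\<lambda>n. T n \<omega> / Pi_prod n s) \<longlonglongrightarrow> \<gamma> * U \<omega>" and \<gamma>: "0 \<le> \<gamma>"
  shows "converges_in_distribution M (\<lambda>n \<omega>. X \<xi> n \<omega> / \<nu> n)
    (normal_variance_mixture M (s\<^sup>2 * l\<^sup>2 * - (\<xi> $ 1 * \<xi> $ 2) * (\<kappa> * \<gamma>)) U)"
proof -
  define c where "c = s\<^sup>2 * l\<^sup>2 * - (\<xi> $ 1 * \<xi> $ 2) * (\<kappa> * \<gamma>)"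
  have Ppos: "Pi_prod n (s * l) > 0" "Pi_prod n s > 0" for n
    using l s_pos by (auto intro: Pi_prod_pos)
  have "\<kappa> \<ge> 0"
    by (rule LIMSEQ_le_const[OF qv])
      (use Ppos in \<open>auto intro!: mult_nonneg_nonneg sum_nonneg divide_nonneg_nonneg less_imp_le[OF Ppos(2)]\<close>)
  then have c0: "c \<ge> 0" unfolding c_def using opposite \<gamma> by (intro mult_nonneg_nonneg) auto
  note mix = char_normal_variance_mixture[OF prob_space_axioms U(1,2) c0]
  have Xm: "(\<lambda>\<omega>. X \<xi> n \<omega> / \<nu> n) \<in> borel_measurable M" for n
    by (rule measurable_fun_C)
  show ?thesis unfolding converges_in_distribution_def c_def[symmetric]
  proof (rule levy_continuity)
    show "real_distribution (distr M borel (\<lambda>\<omega>. X \<xi> n \<omega> / \<nu> n))" for n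
      by (rule real_distribution_distr[OF Xm])
    show "real_distribution (normal_variance_mixture M c U)" by (rule mix(1))
    fix t :: real
    define \<alpha> where "\<alpha> n k = t * (Pi_prod n (s * l) / (Pi_prod k (s * l) * \<nu> n))" for n k
    have "(\<lambda>n. \<integral>\<omega>. iexp (\<alpha> n n * X \<xi> n \<omega>) \<partial>M)
        \<longlonglongrightarrow> (\<integral>\<omega>. of_real (exp (- ((s * l)\<^sup>2 * - (\<xi> $ 1 * \<xi> $ 2) / 2 * (t\<^sup>2 * \<kappa>) * (\<gamma> * U \<omega>)))) \<partial>M)"
    proof (rule characteristic_function_limit[where \<alpha> = \<alpha>, OF \<xi> l(1) opposite])
      show "\<alpha> n k = \<alpha> n (Suc k) * (1 + s * l / real (Suc k))" for n k
        using Pi_factor_pos[OF l(2), of k] by (simp add: \<alpha>_def Pi_prod_Suc del: of_nat_Suc)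
      show "\<exists>N. \<forall>n\<ge>N. \<forall>k\<le>n. \<bar>\<alpha> n k\<bar> \<le> e" if e: "0 < e" for e
      proof -
        have "(\<lambda>n. \<bar>t\<bar> * (1 / \<nu> n + Pi_prod n (s * l) / \<nu> n)) \<longlonglongrightarrow> \<bar>t\<bar> * (0 + 0)"
          by (intro tendsto_mult tendsto_add tendsto_const small)
        then have "eventually (\<lambda>n. \<bar>t\<bar> * (1 / \<nu> n + Pi_prod n (s * l) / \<nu> n) < e) sequentially"
          using e by (intro order_tendstoD(2)) auto
        then obtain N where N: "\<And>n. n \<ge> N \<Longrightarrow> \<bar>t\<bar> * (1 / \<nu> n + Pi_prod n (s * l) / \<nu> n) < e"
          by (auto simp: eventually_sequentially)
        have "\<bar>\<alpha> n k\<bar> \<le> \<bar>t\<bar> * (1 / \<nu> n + Pi_prod n (s * l) / \<nu> n)" if "k \<le> n" for n k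
        proof -
          have "Pi_prod n (s * l) / Pi_prod k (s * l) \<le> 1 + Pi_prod n (s * l)"
          proof (cases "l \<ge> 0")
            case True
            then have "Pi_prod k (s * l) \<ge> 1" using s_pos by (intro Pi_prod_ge_1) simp
            then have "Pi_prod n (s * l) / Pi_prod k (s * l) \<le> Pi_prod n (s * l) / 1"
              using Ppos by (intro divide_left_mono) (auto intro: less_imp_le)
            then show ?thesis by simp
          next
            case False
            then have "Pi_prod n (s * l) \<le> Pi_prod k (s * l)"
              using s_pos l that by (intro Pi_prod_antimono) (auto simp: mult_nonneg_nonpos)
            then show ?thesis using Ppos[of n] Ppos[of k] by (simp add: field_simps add_increasing2)
          qed
          then have "Pi_prod n (s * l) / Pi_prod k (s * l) / \<nu> n \<le> (1 + Pi_prod n (s * l)) / \<nu> n"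
            using \<nu>0 by (rule divide_right_mono)
          moreover have "\<bar>\<alpha> n k\<bar> = \<bar>t\<bar> * (Pi_prod n (s * l) / Pi_prod k (s * l) / \<nu> n)"
            using Ppos[of n] Ppos[of k] \<nu>0[of n] by (simp add: \<alpha>_def abs_mult)
          ultimately show ?thesis by (simp only: add_divide_distrib mult_left_mono abs_ge_zero)
        qed
        then show ?thesis using N by (meson less_imp_le order_trans)
      qed
      have "(\<lambda>n. t\<^sup>2 * ((Pi_prod n (s * l) / \<nu> n)\<^sup>2
          * (\<Sum>j<n. Pi_prod j s / (real (Suc j) * (Pi_prod (Suc j) (s * l))\<^sup>2)))) \<longlonglongrightarrow> t\<^sup>2 * \<kappa>"
        by (intro tendsto_mult tendsto_const qv)
      moreover have "t\<^sup>2 * ((Pi_prod n (s * l) / \<nu> n)\<^sup>2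
          * (\<Sum>j<n. Pi_prod j s / (real (Suc j) * (Pi_prod (Suc j) (s * l))\<^sup>2)))
          = (\<Sum>j<n. (\<alpha> n (Suc j))\<^sup>2 * Pi_prod j s / real (Suc j))" for n
        unfolding sum_distrib_left by (rule sum.cong[OF refl]) (simp add: \<alpha>_def power_divide power_mult_distrib mult.assoc mult.commute mult.left_commute)
      ultimately show "(\<lambda>n. \<Sum>j<n. (\<alpha> n (Suc j))\<^sup>2 * Pi_prod j s / real (Suc j)) \<longlonglongrightarrow> t\<^sup>2 * \<kappa>" by simp
      show "(\<lambda>\<omega>. \<gamma> * U \<omega>) \<in> borel_measurable M" using U(1) by simp
      show "AE \<omega> in M. (\<lambda>n. T n \<omega> / Pi_prod n s) \<longlonglongrightarrow> \<gamma> * U \<omega>" by (rule U(3))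
    qed
    moreover have "char (distr M borel (\<lambda>\<omega>. X \<xi> n \<omega> / \<nu> n)) t = (\<integral>\<omega>. iexp (\<alpha> n n * X \<xi> n \<omega>) \<partial>M)" for n
    proof -
      have "\<alpha> n n = t / \<nu> n" using Ppos[of n] by (simp add: \<alpha>_def)
      then show ?thesis unfolding char_def using Xm by (subst integral_distr) auto
    qed
    moreover have "char (normal_variance_mixture M c U) t
        = (\<integral>\<omega>. of_real (exp (- ((s * l)\<^sup>2 * - (\<xi> $ 1 * \<xi> $ 2) / 2 * (t\<^sup>2 * \<kappa>) * (\<gamma> * U \<omega>)))) \<partial>M)"
      unfolding mix(2) by (simp add: c_def power_mult_distrib mult_ac)
    ultimately show "(\<lambda>n. char (distr M borel (\<lambda>\<omega>. X \<xi> n \<omega> / \<nu> n)) t) \<longlonglongrightarrow> char (normal_variance_mixture M c U) t"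
      by simp
  qed
qed

section \<open>Normalisation and dependence on the initial content\<close>

lemma normalised_functional_limit:
  assumes \<eta>: "Q *v \<eta> = \<mu> *\<^sub>R \<eta>" and \<mu>: "\<mu> > 1/2" and nz: "\<eta> $ 1 \<noteq> 0" "\<eta> $ 2 \<noteq> 0"
    and \<rho>: "(\<lambda>n. Pi_prod n (s * \<mu>) / \<rho> n) \<longlonglongrightarrow> \<gamma>" "\<gamma> \<noteq> 0"
  obtains V where "V \<in> borel_measurable M" "AE \<omega> in M. (\<lambda>n. X \<eta> n \<omega> / \<rho> n) \<longlonglongrightarrow> V \<omega>"
    "converges_in_L2 M (\<lambda>n \<omega>. X \<eta> n \<omega> / \<rho> n) V" "expectation V = \<gamma> * (nongreen c\<^sub>0 \<bullet> \<eta>)" "nondegenerate M V"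
    "AE \<omega> in M. (\<lambda>n. X \<eta> n \<omega> / Pi_prod n (s * \<mu>)) \<longlonglongrightarrow> V \<omega> / \<gamma>"
proof -
  obtain A where A: "A \<in> borel_measurable M"
    "AE \<omega> in M. (\<lambda>n. X \<eta> n \<omega> / Pi_prod n (s * \<mu>)) \<longlonglongrightarrow> A \<omega>"
    "converges_in_L2 M (\<lambda>n \<omega>. X \<eta> n \<omega> / Pi_prod n (s * \<mu>)) A"
    "expectation A = nongreen c\<^sub>0 \<bullet> \<eta>" "nondegenerate M A"
    by (rule eigenvector_functional_limit[OF \<eta> \<mu> nz])
  have P: "Pi_prod n (s * \<mu>) > 0" for n
    using s_pos \<mu> mult_pos_pos[of s \<mu>] by (intro Pi_prod_pos) linarith
  have eq: "Pi_prod n (s * \<mu>) / \<rho> n * (X \<eta> n \<omega> / Pi_prod n (s * \<mu>)) = X \<eta> n \<omega> / \<rho> n" for n \<omega>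
    using P[of n] by simp
  show ?thesis
  proof (rule that[of "\<lambda>\<omega>. \<gamma> * A \<omega>"])
    show "AE \<omega> in M. (\<lambda>n. X \<eta> n \<omega> / \<rho> n) \<longlonglongrightarrow> \<gamma> * A \<omega>"
      using A(2)
    proof eventually_elim
      case (elim \<omega>)
      from tendsto_mult[OF \<rho>(1) elim] show ?case by (simp only: eq)
    qed
    show "converges_in_L2 M (\<lambda>n \<omega>. X \<eta> n \<omega> / \<rho> n) (\<lambda>\<omega>. \<gamma> * A \<omega>)"
      using converges_in_L2_scaled[OF prob_space_axioms A(3) \<rho>(1)] by (simp only: eq)
    show "nondegenerate M (\<lambda>\<omega>. \<gamma> * A \<omega>)"
      unfolding nondegenerate_def
    proof
      assume "\<exists>a. AE \<omega> in M. \<gamma> * A \<omega> = a"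
      then obtain a where "AE \<omega> in M. \<gamma> * A \<omega> = a" by blast
      then have "AE \<omega> in M. A \<omega> = a / \<gamma>" by eventually_elim (use \<rho>(2) in \<open>auto simp: field_simps\<close>)
      then show False using A(5) by (auto simp: nondegenerate_def)
    qed
  qed (use A \<rho>(2) in auto)
qed

text \<open>The mean of the limit is proportional to the initial value of the functional, so a start with
  a different initial value gives a limit with a different mean.\<close>

lemma limit_law_depends_on_start:
  assumes \<eta>: "Q *v \<eta> = \<mu> *\<^sub>R \<eta>" and \<mu>: "\<mu> > 1/2" and nz: "\<eta> $ 1 \<noteq> 0" "\<eta> $ 2 \<noteq> 0"
    and \<rho>: "(\<lambda>n. Pi_prod n (s * \<mu>) / \<rho> n) \<longlonglongrightarrow> \<gamma>" "\<gamma> \<noteq> 0"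
    and V: "V \<in> borel_measurable M" "expectation V = \<gamma> * (nongreen c\<^sub>0 \<bullet> \<eta>)"
    and c': "probability_vector c'" "0 < nongreen c' \<bullet> 1" "nongreen c' \<bullet> \<eta> \<noteq> nongreen c\<^sub>0 \<bullet> \<eta>"
  shows "\<exists>(M' :: (nat \<Rightarrow> real) measure) draw' C' V'. urn_process M' (triangular_matrix s Q) c' draw' C' \<and>
    V' \<in> borel_measurable M' \<and> (AE \<omega> in M'. (\<lambda>n. (nongreen (C' n \<omega>) \<bullet> \<eta>) / \<rho> n) \<longlonglongrightarrow> V' \<omega>) \<and>
    distr M' borel V' \<noteq> distr M borel V"
proof -
  let ?R = "triangular_matrix s Q"
  let ?M = "PiM UNIV (\<lambda>_::nat. uniform01)"
  have urn: "urn_process ?M ?R c' (drawn ?R c') (urn_content ?R c')"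
    using stochastic c'(1) by (rule urn_process_exists)
  interpret other: triangular_urn ?M s Q c' "drawn ?R c'" "urn_content ?R c'"
    by (rule triangular_urn.intro[OF urn])
      (unfold_locales, auto intro: s_pos s_less Q_stochastic c'(2))
  obtain V' where V': "V' \<in> borel_measurable ?M"
    "AE \<omega> in ?M. (\<lambda>n. (nongreen (urn_content ?R c' n \<omega>) \<bullet> \<eta>) / \<rho> n) \<longlonglongrightarrow> V' \<omega>"
    "other.expectation V' = \<gamma> * (nongreen c' \<bullet> \<eta>)"
    by (rule other.normalised_functional_limit[OF \<eta> \<mu> nz \<rho>])
  have "distr ?M borel V' \<noteq> distr M borel V"
  proof
    assume "distr ?M borel V' = distr M borel V"
    then have "(\<integral>x. x \<partial>distr ?M borel V') = (\<integral>x. x \<partial>distr M borel V)" by simp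
    then have "other.expectation V' = expectation V"
      using V(1) V'(1) by (simp add: integral_distr)
    then show False using V(2) V'(3) c'(3) \<rho>(2) by simp
  qed
  then show ?thesis using urn V' by blast
qed

end

section \<open>Two-colour stochastic matrices\<close>

lemma stochastic_2:
  fixes Q :: "real^2^2"
  assumes "stochastic_matrix Q"
  shows "0 \<le> Q $ i $ j" "Q $ i $ 1 + Q $ i $ 2 = 1"
  using assms by (auto simp: stochastic_matrix_def probability_vector_def row_def sum_2)

text \<open>A zero off-diagonal entry persists in all powers.\<close>

lemma irreducible_2_entries:
  fixes Q :: "real^2^2"
  assumes "irreducible_matrix Q"
  shows "Q $ 1 $ 2 \<noteq> 0" "Q $ 2 $ 1 \<noteq> 0"
proof -
  show "Q $ 1 $ 2 \<noteq> 0"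
  proof
    assume z: "Q $ 1 $ 2 = 0"
    have "matrix_power Q n $ 1 $ 2 = 0" for n
      by (induction n) (simp_all add: z mat_def matrix_matrix_mult_def sum_2)
    then show False using assms unfolding irreducible_matrix_def by (metis less_irrefl)
  qed
  show "Q $ 2 $ 1 \<noteq> 0"
  proof
    assume z: "Q $ 2 $ 1 = 0"
    have "matrix_power Q n $ 2 $ 1 = 0" for n
      by (induction n) (simp_all add: z mat_def matrix_matrix_mult_def sum_2)
    then show False using assms unfolding irreducible_matrix_def by (metis less_irrefl)
  qed
qed

lemma eigenvector_2_nonzero:
  fixes Q :: "real^2^2"
  assumes "irreducible_matrix Q" "right_eigenvector Q l \<xi>"
  shows "\<xi> $ 1 \<noteq> 0" "\<xi> $ 2 \<noteq> 0"
proof -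
  have e: "Q $ 1 $ 1 * \<xi> $ 1 + Q $ 1 $ 2 * \<xi> $ 2 = l * \<xi> $ 1" "Q $ 2 $ 1 * \<xi> $ 1 + Q $ 2 $ 2 * \<xi> $ 2 = l * \<xi> $ 2"
    and nz: "\<xi> $ 1 \<noteq> 0 \<or> \<xi> $ 2 \<noteq> 0"
    using assms(2) by (auto simp: right_eigenvector_def vec_eq_iff forall_2 matrix_vector_mult_def sum_2)
  show "\<xi> $ 1 \<noteq> 0" "\<xi> $ 2 \<noteq> 0"
    using e nz irreducible_2_entries[OF assms(1)] by auto
qed

lemma eigenvalue_2_bounds:
  fixes Q :: "real^2^2"
  assumes Q: "stochastic_matrix Q" and ev: "right_eigenvector Q l \<xi>"
  shows "- 1 \<le> l" "l \<le> 1"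
proof -
  have e: "Q $ 1 $ 1 * \<xi> $ 1 + Q $ 1 $ 2 * \<xi> $ 2 = l * \<xi> $ 1" "Q $ 2 $ 1 * \<xi> $ 1 + Q $ 2 $ 2 * \<xi> $ 2 = l * \<xi> $ 2"
    and nz: "\<xi> $ 1 \<noteq> 0 \<or> \<xi> $ 2 \<noteq> 0"
    using ev by (auto simp: right_eigenvector_def vec_eq_iff forall_2 matrix_vector_mult_def sum_2)
  note q = stochastic_2[OF Q]
  have *: "\<bar>l\<bar> * \<bar>x\<bar> \<le> \<bar>x\<bar>" if "a * x + b * y = l * x" "0 \<le> a" "0 \<le> b" "a + b = 1" "\<bar>y\<bar> \<le> \<bar>x\<bar>" for a b x y
  proof -
    have "\<bar>l\<bar> * \<bar>x\<bar> = \<bar>a * x + b * y\<bar>" using that(1) by (simp add: abs_mult)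
    also have "\<dots> \<le> a * \<bar>x\<bar> + b * \<bar>y\<bar>"
      using abs_triangle_ineq[of "a * x" "b * y"] that by (simp add: abs_mult)
    also have "\<dots> \<le> a * \<bar>x\<bar> + b * \<bar>x\<bar>" using that by (intro add_left_mono mult_left_mono) auto
    also have "\<dots> = \<bar>x\<bar>" using that(4) by (simp flip: distrib_right)
    finally show ?thesis .
  qed
  have "\<bar>l\<bar> \<le> 1"
  proof (cases "\<bar>\<xi> $ 2\<bar> \<le> \<bar>\<xi> $ 1\<bar>")
    case True
    then have "\<bar>\<xi> $ 1\<bar> > 0" using nz by auto
    then show ?thesis using *[OF e(1) q(1) q(1) q(2) True] by simp
  next
    case False
    then have "\<bar>\<xi> $ 2\<bar> > 0" "\<bar>\<xi> $ 1\<bar> \<le> \<bar>\<xi> $ 2\<bar>" by auto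
    then show ?thesis using *[of "Q $ 2 $ 2" "\<xi> $ 2" "Q $ 2 $ 1" "\<xi> $ 1"] e(2) q by (simp add: add.commute)
  qed
  then show "- 1 \<le> l" "l \<le> 1" by auto
qed

text \<open>Stationarity makes \<open>\<pi>\<close> orthogonal to the other right eigenvectors. In two dimensions this gives
  \<open>\<pi> \<bullet> \<xi>\<^sup>2 = - \<xi>\<^sub>1 \<xi>\<^sub>2\<close>.\<close>

lemma stationary_2_orthogonal:
  fixes Q :: "real^2^2"
  assumes st: "stationary_distribution Q p" and ev: "right_eigenvector Q l \<xi>" "l \<noteq> 1"
  shows "p $ 1 * \<xi> $ 1 + p $ 2 * \<xi> $ 2 = 0" "p $ 1 + p $ 2 = 1" "0 \<le> p $ 1" "0 \<le> p $ 2"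
    "p \<bullet> (\<chi> i. (\<xi> $ i)\<^sup>2) = - (\<xi> $ 1 * \<xi> $ 2)" "\<xi> $ 1 * \<xi> $ 2 \<le> 0"
proof -
  have e: "Q $ 1 $ 1 * \<xi> $ 1 + Q $ 1 $ 2 * \<xi> $ 2 = l * \<xi> $ 1" "Q $ 2 $ 1 * \<xi> $ 1 + Q $ 2 $ 2 * \<xi> $ 2 = l * \<xi> $ 2"
    using ev by (auto simp: right_eigenvector_def vec_eq_iff forall_2 matrix_vector_mult_def sum_2)
  have p: "p $ 1 * Q $ 1 $ 1 + p $ 2 * Q $ 2 $ 1 = p $ 1" "p $ 1 * Q $ 1 $ 2 + p $ 2 * Q $ 2 $ 2 = p $ 2"
    using st by (auto simp: stationary_distribution_def vec_eq_iff forall_2 vector_matrix_mult_def sum_2 mult.commute)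
  show p1: "p $ 1 + p $ 2 = 1" "0 \<le> p $ 1" "0 \<le> p $ 2"
    using st by (auto simp: stationary_distribution_def probability_vector_def sum_2)
  have "p $ 1 * \<xi> $ 1 + p $ 2 * \<xi> $ 2
      = (p $ 1 * Q $ 1 $ 1 + p $ 2 * Q $ 2 $ 1) * \<xi> $ 1 + (p $ 1 * Q $ 1 $ 2 + p $ 2 * Q $ 2 $ 2) * \<xi> $ 2"
    unfolding p ..
  also have "\<dots> = p $ 1 * (Q $ 1 $ 1 * \<xi> $ 1 + Q $ 1 $ 2 * \<xi> $ 2) + p $ 2 * (Q $ 2 $ 1 * \<xi> $ 1 + Q $ 2 $ 2 * \<xi> $ 2)"
    by (simp add: algebra_simps)
  also have "\<dots> = l * (p $ 1 * \<xi> $ 1 + p $ 2 * \<xi> $ 2)" unfolding e by (simp add: algebra_simps)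
  finally show o: "p $ 1 * \<xi> $ 1 + p $ 2 * \<xi> $ 2 = 0" using ev(2) by (metis mult_cancel_right1 mult.commute)
  have "p \<bullet> (\<chi> i. (\<xi> $ i)\<^sup>2) = (p $ 1 * \<xi> $ 1 + p $ 2 * \<xi> $ 2) * (\<xi> $ 1 + \<xi> $ 2) - (p $ 1 + p $ 2) * (\<xi> $ 1 * \<xi> $ 2)"
    by (simp add: inner_vec_def sum_2 power2_eq_square algebra_simps)
  then show sq: "p \<bullet> (\<chi> i. (\<xi> $ i)\<^sup>2) = - (\<xi> $ 1 * \<xi> $ 2)" using o p1 by simp
  have "0 \<le> p \<bullet> (\<chi> i. (\<xi> $ i)\<^sup>2)" using p1 by (simp add: inner_vec_def sum_2)
  then show "\<xi> $ 1 * \<xi> $ 2 \<le> 0" using sq by simp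
qed

section \<open>The limit theorem\<close>

context triangular_urn
begin

lemma mass_limit:
  obtains U where "U \<in> borel_measurable M" "AE \<omega> in M. (\<lambda>n. T n \<omega> / real (n + 1) powr s) \<longlonglongrightarrow> U \<omega>"
    "converges_in_L2 M (\<lambda>n \<omega>. T n \<omega> / real (n + 1) powr s) U" "expectation U = T0 / Gamma (1 + s)"
    "nondegenerate M U" "AE \<omega> in M. 0 < U \<omega>"
    "AE \<omega> in M. (\<lambda>n. T n \<omega> / Pi_prod n s) \<longlonglongrightarrow> Gamma (1 + s) * U \<omega>"
proof -
  have s1: "s > - 1" using s_pos by simp
  have G: "Gamma (1 + s) > 0" by (rule Gamma_pos[OF s1])
  have \<rho>: "(\<lambda>n. Pi_prod n (s * 1) / real (n + 1) powr s) \<longlonglongrightarrow> 1 / Gamma (1 + s)"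
    using Pi_prod_asymptotic_Suc[OF s1] by simp
  obtain U where U: "U \<in> borel_measurable M" "AE \<omega> in M. (\<lambda>n. T n \<omega> / real (n + 1) powr s) \<longlonglongrightarrow> U \<omega>"
    "converges_in_L2 M (\<lambda>n \<omega>. T n \<omega> / real (n + 1) powr s) U" "expectation U = 1 / Gamma (1 + s) * T0"
    "nondegenerate M U" "AE \<omega> in M. (\<lambda>n. T n \<omega> / Pi_prod n (s * 1)) \<longlonglongrightarrow> U \<omega> / (1 / Gamma (1 + s))"
    by (rule normalised_functional_limit[OF ones_eigenvector _ _ _ \<rho>]) (use G in auto)
  have lim: "AE \<omega> in M. (\<lambda>n. T n \<omega> / Pi_prod n s) \<longlonglongrightarrow> Gamma (1 + s) * U \<omega>"
    using U(6) by eventually_elim (simp add: mult.commute)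
  have "AE \<omega> in M. 0 < Gamma (1 + s) * U \<omega>"
    by (rule mass_limit_positive[OF _ lim]) (use U(1) in simp)
  then have "AE \<omega> in M. 0 < U \<omega>" by eventually_elim (use G in \<open>simp add: zero_less_mult_iff\<close>)
  then show ?thesis using that[of U] U lim by simp
qed

text \<open>The mass of white and black grows like \<open>n\<close> to the power \<open>s < 1\<close>, the total content like \<open>n\<close>.\<close>

lemma content_limit:
  assumes "AE \<omega> in M. (\<lambda>n. T n \<omega> / real (n + 1) powr s) \<longlonglongrightarrow> U \<omega>"
  shows "AE \<omega> in M. (\<lambda>n. C n \<omega> /\<^sub>R real (n + 1)) \<longlonglongrightarrow> vector [0, 0, 1]"
  using assms AE_space
proof eventually_elim
  case (elim \<omega>)
  have "(\<lambda>n. real (n + 1) powr (s - 1)) \<longlonglongrightarrow> 0"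
  proof -
    have "s - 1 < 0" using s_less by simp
    then show ?thesis by real_asymp
  qed
  from tendsto_mult[OF elim(1) this]
  have "(\<lambda>n. T n \<omega> / real (n + 1) powr s * real (n + 1) powr (s - 1)) \<longlonglongrightarrow> 0" by simp
  moreover have "T n \<omega> / real (n + 1) powr s * real (n + 1) powr (s - 1) = T n \<omega> / real (n + 1)" for n
    by (simp add: powr_diff)
  ultimately have T: "(\<lambda>n. T n \<omega> / real (n + 1)) \<longlonglongrightarrow> 0" by simp
  have sandwich: "(\<lambda>n. x n / real (n + 1)) \<longlonglongrightarrow> 0" if "\<And>n. 0 \<le> x n" "\<And>n. x n \<le> T n \<omega>" for x
    by (rule tendsto_sandwich[OF _ _ tendsto_const T])
      (use that in \<open>auto intro!: always_eventually divide_right_mono\<close>)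
  note c = content_coords[OF elim(2)]
  show ?case
  proof (rule vec_tendstoI)
    fix i :: 3
    have 1: "(\<lambda>n. C n \<omega> $ 1 / real (n + 1)) \<longlonglongrightarrow> 0" and 2: "(\<lambda>n. C n \<omega> $ 2 / real (n + 1)) \<longlonglongrightarrow> 0"
      by (rule sandwich; use c in \<open>simp add: T_eq\<close>)+
    have "C n \<omega> $ 3 / real (n + 1) = 1 - T n \<omega> / real (n + 1)" for n
      using c(4)[of n] by (simp add: T_eq field_simps)
    then have 3: "(\<lambda>n. C n \<omega> $ 3 / real (n + 1)) \<longlonglongrightarrow> 1"
      using tendsto_diff[OF tendsto_const[of 1] T] by simp
    show "(\<lambda>n. (C n \<omega> /\<^sub>R real (n + 1)) $ i) \<longlonglongrightarrow> vector [0, 0, 1] $ i"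
      using exhaust_3[of i] 1 2 3 by (auto simp: divide_inverse_commute)
  qed
qed

lemma direction_limit:
  assumes \<xi>: "Q *v \<xi> = l *\<^sub>R \<xi>" and l: "l < 1" "- 1 < s * l"
    and p: "p $ 1 * \<xi> $ 1 + p $ 2 * \<xi> $ 2 = 0" "p $ 1 + p $ 2 = 1" and ne: "\<xi> $ 1 \<noteq> \<xi> $ 2"
    and U: "AE \<omega> in M. (\<lambda>n. T n \<omega> / real (n + 1) powr s) \<longlonglongrightarrow> U \<omega>"
  shows "AE \<omega> in M. (\<lambda>n. nongreen (C n \<omega>) /\<^sub>R (real (n + 1) powr s)) \<longlonglongrightarrow> U \<omega> *\<^sub>R p"
  using U X_negligible_AE[OF \<xi> l]
proof eventually_elim
  case (elim \<omega>)
  define D where "D = \<xi> $ 1 - \<xi> $ 2"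
  have D: "D \<noteq> 0" using ne by (simp add: D_def)
  have s1: "s > - 1" using s_pos by simp
  have Ps: "Pi_prod n s > 0" for n using s1 by (rule Pi_prod_pos)
  have "(\<lambda>n. X \<xi> n \<omega> / Pi_prod n s * (Pi_prod n s / real (n + 1) powr s)) \<longlonglongrightarrow> 0 * (1 / Gamma (1 + s))"
    by (intro tendsto_mult elim Pi_prod_asymptotic_Suc s1)
  moreover have "X \<xi> n \<omega> / Pi_prod n s * (Pi_prod n s / real (n + 1) powr s) = X \<xi> n \<omega> / real (n + 1) powr s" for n
    using Ps[of n] by simp
  ultimately have X: "(\<lambda>n. X \<xi> n \<omega> / real (n + 1) powr s) \<longlonglongrightarrow> 0" by simp
  \<comment> \<open>the two coordinates are recovered from the pairings with \<open>1\<close> and \<open>\<xi>\<close>\<close>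
  have p12: "p $ 1 = - \<xi> $ 2 / D" "p $ 2 = \<xi> $ 1 / D"
  proof -
    have "p $ 2 = 1 - p $ 1" using p(2) by simp
    moreover from this have "p $ 1 * \<xi> $ 1 + (1 - p $ 1) * \<xi> $ 2 = 0" using p(1) by simp
    then have "p $ 1 * D = - \<xi> $ 2" by (simp add: D_def algebra_simps)
    then show a: "p $ 1 = - \<xi> $ 2 / D" using D by (simp add: field_simps)
    ultimately show "p $ 2 = \<xi> $ 1 / D" using D by (simp add: D_def field_simps)
  qed
  show ?case
  proof (rule vec_tendstoI)
    fix i :: 2
    have 1: "C n \<omega> $ 1 / real (n + 1) powr s = (X \<xi> n \<omega> / real (n + 1) powr s - \<xi> $ 2 * (T n \<omega> / real (n + 1) powr s)) / D"
      and 2: "C n \<omega> $ 2 / real (n + 1) powr s = (\<xi> $ 1 * (T n \<omega> / real (n + 1) powr s) - X \<xi> n \<omega> / real (n + 1) powr s) / D" for n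
      using D by (simp_all add: nongreen_inner D_def field_simps)
    have "(\<lambda>n. C n \<omega> $ 1 / real (n + 1) powr s) \<longlonglongrightarrow> (0 - \<xi> $ 2 * U \<omega>) / D"
      unfolding 1 using D by (intro tendsto_intros X elim) 
    moreover have "(\<lambda>n. C n \<omega> $ 2 / real (n + 1) powr s) \<longlonglongrightarrow> (\<xi> $ 1 * U \<omega> - 0) / D"
      unfolding 2 using D by (intro tendsto_intros X elim)
    ultimately show "(\<lambda>n. (nongreen (C n \<omega>) /\<^sub>R (real (n + 1) powr s)) $ i) \<longlonglongrightarrow> (U \<omega> *\<^sub>R p) $ i"
      using exhaust_2[of i] by (auto simp: p12 divide_inverse mult_ac)
  qed
qed

end

theorem theorem3p1:
  fixes M :: "'a measure"
    and s l :: real and Q :: "real^2^2" and piQ \<xi> :: "real^2"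
    and c\<^sub>0 :: "real^3" and draw :: "nat \<Rightarrow> 'a \<Rightarrow> 3" and C :: "nat \<Rightarrow> 'a \<Rightarrow> real^3"
    and S :: "nat \<Rightarrow> 'a \<Rightarrow> real^2"
  assumes s: "0 < s" "s < 1"
    and Q: "stochastic_matrix Q" "irreducible_matrix Q" "aperiodic_matrix Q"
    and piQ: "stationary_distribution Q piQ"
    and eigen: "right_eigenvector Q l \<xi>" "l \<noteq> 1"
    and urn: "urn_process M (triangular_matrix s Q) c\<^sub>0 draw C"
    and init: "c\<^sub>0 $ 1 + c\<^sub>0 $ 2 > 0"
    and S: "\<And>n \<omega>. S n \<omega> = nongreen (C n \<omega>)"
  shows
    \<comment> \<open>(i)\<close>
    "(\<forall>n. \<forall>\<omega>\<in>space M. (C n \<omega> \<bullet> 1) / real (n + 1) = 1) \<and>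
    \<comment> \<open>(ii)\<close>
    (AE \<omega> in M. (\<lambda>n. C n \<omega> /\<^sub>R real (n + 1)) \<longlonglongrightarrow> vector [0, 0, 1]) \<and>
    (\<exists>U \<in> borel_measurable M.
      \<comment> \<open>(iii)\<close>
      (AE \<omega> in M. (\<lambda>n. (S n \<omega> \<bullet> 1) / real (n + 1) powr s) \<longlonglongrightarrow> U \<omega>) \<and>
      converges_in_L2 M (\<lambda>n \<omega>. (S n \<omega> \<bullet> 1) / real (n + 1) powr s) U \<and>
      nondegenerate M U \<and> (AE \<omega> in M. U \<omega> > 0) \<and>
      \<comment> \<open>(iv)\<close>
      (AE \<omega> in M. (\<lambda>n. S n \<omega> /\<^sub>R (real (n + 1) powr s)) \<longlonglongrightarrow> U \<omega> *\<^sub>R piQ) \<and>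
      \<comment> \<open>(v)\<close>
      (l < 1/2 \<longrightarrow>
        converges_in_distribution M (\<lambda>n \<omega>. (S n \<omega> \<bullet> \<xi>) / real n powr (s / 2))
          (normal_variance_mixture M
             (s\<^sup>2 * l\<^sup>2 / (s * (1 - 2 * l)) * (piQ \<bullet> (\<chi> i. (\<xi> $ i)\<^sup>2))) U)) \<and>
      \<comment> \<open>(vi)\<close>
      (l = 1/2 \<longrightarrow>
        converges_in_distribution M (\<lambda>n \<omega>. (S n \<omega> \<bullet> \<xi>) / sqrt (real n powr s * ln (real n)))
          (normal_variance_mixture M (s\<^sup>2 * l\<^sup>2 * (piQ \<bullet> (\<chi> i. (\<xi> $ i)\<^sup>2))) U)) \<and>
      \<comment> \<open>the distribution of \<open>U\<close> depends on the initial value: some other initial value gives another one\<close>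
      (\<exists>c\<^sub>0' (M' :: (nat \<Rightarrow> real) measure) draw' C' U'.
        urn_process M' (triangular_matrix s Q) c\<^sub>0' draw' C' \<and> c\<^sub>0' $ 1 + c\<^sub>0' $ 2 > 0 \<and>
        nongreen c\<^sub>0' \<noteq> nongreen c\<^sub>0 \<and> U' \<in> borel_measurable M' \<and>
        (AE \<omega> in M'. (\<lambda>n. (nongreen (C' n \<omega>) \<bullet> 1) / real (n + 1) powr s) \<longlonglongrightarrow> U' \<omega>) \<and>
        distr M' borel U' \<noteq> distr M borel U)) \<and>
    \<comment> \<open>(vii)\<close>
    (l > 1/2 \<longrightarrow>
      martingale M (natural_filtration M C) (\<lambda>n \<omega>. (S n \<omega> \<bullet> \<xi>) / Pi_prod n (s * l)) \<and>
      L2_bounded M (\<lambda>n \<omega>. (S n \<omega> \<bullet> \<xi>) / Pi_prod n (s * l)) \<and>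
      (\<exists>V \<in> borel_measurable M.
        (AE \<omega> in M. (\<lambda>n. (S n \<omega> \<bullet> \<xi>) / real n powr (s * l)) \<longlonglongrightarrow> V \<omega>) \<and>
        converges_in_L2 M (\<lambda>n \<omega>. (S n \<omega> \<bullet> \<xi>) / real n powr (s * l)) V \<and>
        nondegenerate M V \<and>
        \<comment> \<open>the distribution of \<open>V\<close> depends on the initial value\<close>
        (\<exists>c\<^sub>0' (M' :: (nat \<Rightarrow> real) measure) draw' C' V'.
          urn_process M' (triangular_matrix s Q) c\<^sub>0' draw' C' \<and> c\<^sub>0' $ 1 + c\<^sub>0' $ 2 > 0 \<and>
          nongreen c\<^sub>0' \<noteq> nongreen c\<^sub>0 \<and> V' \<in> borel_measurable M' \<and>
          (AE \<omega> in M'. (\<lambda>n. (nongreen (C' n \<omega>) \<bullet> \<xi>) / real n powr (s * l)) \<longlonglongrightarrow> V' \<omega>) \<and>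
          distr M' borel V' \<noteq> distr M borel V)))"
proof -
  have T0: "0 < nongreen c\<^sub>0 \<bullet> 1" using init by (simp add: nongreen_inner)
  interpret triangular_urn M s Q c\<^sub>0 draw C
    by (rule triangular_urn.intro[OF urn]) (unfold_locales, auto intro: s Q T0)
  have \<xi>: "Q *v \<xi> = l *\<^sub>R \<xi>" using eigen by (simp add: right_eigenvector_def)
  have l: "- 1 \<le> l" "l < 1" using eigenvalue_2_bounds[OF Q(1) eigen(1)] eigen(2) by auto
  have sl: "- 1 < s * l"
  proof -
    have "- s \<le> s * l" using mult_left_mono[OF l(1), of s] s by simp
    then show ?thesis using s by simp
  qed
  note nz = eigenvector_2_nonzero[OF Q(2) eigen(1)]
  note orth = stationary_2_orthogonal[OF piQ eigen]
  have ne: "\<xi> $ 1 \<noteq> \<xi> $ 2"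
  proof
    assume "\<xi> $ 1 = \<xi> $ 2"
    then show False using orth(6) nz by (auto simp: mult_le_0_iff)
  qed
  have s1: "- 1 < s" using s by simp
  have G: "Gamma (1 + s) > 0" by (rule Gamma_pos[OF s1])
  have total: "\<forall>n. \<forall>\<omega>\<in>space M. (C n \<omega> \<bullet> 1) / real (n + 1) = 1"
    using content_nonneg_total by (simp add: inner_vec_def)
  obtain U where U: "U \<in> borel_measurable M" "AE \<omega> in M. (\<lambda>n. T n \<omega> / real (n + 1) powr s) \<longlonglongrightarrow> U \<omega>"
    "converges_in_L2 M (\<lambda>n \<omega>. T n \<omega> / real (n + 1) powr s) U" "expectation U = T0 / Gamma (1 + s)"
    "nondegenerate M U" "AE \<omega> in M. 0 < U \<omega>"
    "AE \<omega> in M. (\<lambda>n. T n \<omega> / Pi_prod n s) \<longlonglongrightarrow> Gamma (1 + s) * U \<omega>"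
    by (rule mass_limit)
  have U0: "AE \<omega> in M. 0 \<le> U \<omega>" using U(6) by eventually_elim simp
  note mixture = functional_converges_to_mixture[OF \<xi> l(2) sl orth(6) _ _ _ _ U(1) U0 U(7) less_imp_le[OF G]]
  have v: "converges_in_distribution M (\<lambda>n \<omega>. X \<xi> n \<omega> / real n powr (s / 2))
      (normal_variance_mixture M (s\<^sup>2 * l\<^sup>2 / (s * (1 - 2 * l)) * (piQ \<bullet> (\<chi> i. (\<xi> $ i)\<^sup>2))) U)"
    if l2: "l < 1/2"
  proof -
    have "converges_in_distribution M (\<lambda>n \<omega>. X \<xi> n \<omega> / real n powr (s / 2))
      (normal_variance_mixture M (s\<^sup>2 * l\<^sup>2 * - (\<xi> $ 1 * \<xi> $ 2) * (1 / (Gamma (1 + s) * (s * (1 - 2 * l))) * Gamma (1 + s))) U)"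
    proof (rule mixture[OF _ _ _ quadratic_variation_subcritical[OF s sl l2]])
      show "(\<lambda>n. 1 / real n powr (s / 2)) \<longlonglongrightarrow> 0" using s by real_asymp
      have "(\<lambda>n. Pi_prod n (s * l) / real n powr (s * l) * real n powr (s * l - s / 2)) \<longlonglongrightarrow> 1 / Gamma (1 + s * l) * 0"
      proof (intro tendsto_mult Pi_prod_asymptotic sl)
        have "s * l - s / 2 < 0" using l2 s by (simp add: field_simps)
        then show "(\<lambda>n. real n powr (s * l - s / 2)) \<longlonglongrightarrow> 0" by real_asymp
      qed
      moreover have "eventually (\<lambda>n. Pi_prod n (s * l) / real n powr (s * l) * real n powr (s * l - s / 2)
          = Pi_prod n (s * l) / real n powr (s / 2)) sequentially"
        using eventually_gt_at_top[of 0] by eventually_elim (simp add: powr_diff)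
      ultimately have "(\<lambda>n. Pi_prod n (s * l) / real n powr (s / 2)) \<longlonglongrightarrow> 1 / Gamma (1 + s * l) * 0"
        by (rule Lim_transform_eventually)
      then show "(\<lambda>n. Pi_prod n (s * l) / real n powr (s / 2)) \<longlonglongrightarrow> 0" by simp
    qed simp
    then show ?thesis using G by (simp add: orth(5))
  qed
  have vi: "converges_in_distribution M (\<lambda>n \<omega>. X \<xi> n \<omega> / sqrt (real n powr s * ln (real n)))
      (normal_variance_mixture M (s\<^sup>2 * l\<^sup>2 * (piQ \<bullet> (\<chi> i. (\<xi> $ i)\<^sup>2))) U)"
    if l2: "l = 1/2"
  proof -
    have "converges_in_distribution M (\<lambda>n \<omega>. X \<xi> n \<omega> / sqrt (real n powr s * ln (real n)))
      (normal_variance_mixture M (s\<^sup>2 * l\<^sup>2 * - (\<xi> $ 1 * \<xi> $ 2) * (1 / Gamma (1 + s) * Gamma (1 + s))) U)"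
    proof (rule mixture[OF _ _ _ quadratic_variation_critical[OF s, folded l2]])
      show "0 \<le> sqrt (real n powr s * ln (real n))" for n
        by (cases "n = 0") auto
      show "(\<lambda>n. 1 / sqrt (real n powr s * ln (real n))) \<longlonglongrightarrow> 0" using s by real_asymp
      have "(\<lambda>n. Pi_prod n (s * l) / real n powr (s * l) * (1 / sqrt (ln (real n)))) \<longlonglongrightarrow> 1 / Gamma (1 + s * l) * 0"
      proof (intro tendsto_mult Pi_prod_asymptotic sl)
        show "(\<lambda>n. 1 / sqrt (ln (real n))) \<longlonglongrightarrow> 0" by real_asymp
      qed
      moreover have "Pi_prod n (s * l) / real n powr (s * l) * (1 / sqrt (ln (real n)))
          = Pi_prod n (s * l) / sqrt (real n powr s * ln (real n))" for n
      proof -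
        have "real n powr s = (real n powr (s * l))\<^sup>2"
          by (simp add: power2_eq_square l2 flip: powr_add)
        then have "sqrt (real n powr s) = real n powr (s * l)" by simp
        then show ?thesis by (simp add: real_sqrt_mult)
      qed
      ultimately have "(\<lambda>n. Pi_prod n (s * l) / sqrt (real n powr s * ln (real n))) \<longlonglongrightarrow> 1 / Gamma (1 + s * l) * 0"
        by (simp only:)
      then show "(\<lambda>n. Pi_prod n (s * l) / sqrt (real n powr s * ln (real n))) \<longlonglongrightarrow> 0" by simp
    qed
    then show ?thesis using G by (simp add: orth(5))
  qed
  have U': "\<exists>c\<^sub>0' (M' :: (nat \<Rightarrow> real) measure) draw' C' U'.
        urn_process M' (triangular_matrix s Q) c\<^sub>0' draw' C' \<and> c\<^sub>0' $ 1 + c\<^sub>0' $ 2 > 0 \<and>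
        nongreen c\<^sub>0' \<noteq> nongreen c\<^sub>0 \<and> U' \<in> borel_measurable M' \<and>
        (AE \<omega> in M'. (\<lambda>n. (nongreen (C' n \<omega>) \<bullet> 1) / real (n + 1) powr s) \<longlonglongrightarrow> U' \<omega>) \<and>
        distr M' borel U' \<noteq> distr M borel U"
  proof -
    \<comment> \<open>halving the white and black content halves the mean of the limit\<close>
    define c' :: "real^3" where "c' = vector [T0 / 2, 0, 1 - T0 / 2]"
    have c': "probability_vector c'" "0 < nongreen c' \<bullet> 1" "nongreen c' \<bullet> 1 \<noteq> T0" "0 < c' $ 1 + c' $ 2"
      using nongreen_init T0_le_1 by (auto simp: c'_def probability_vector_def sum_3 forall_3 nongreen_inner)
    have \<rho>: "(\<lambda>n. Pi_prod n (s * 1) / real (n + 1) powr s) \<longlonglongrightarrow> 1 / Gamma (1 + s)"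
      using Pi_prod_asymptotic_Suc[OF s1] by simp
    have "\<exists>(M' :: (nat \<Rightarrow> real) measure) draw' C' V'. urn_process M' (triangular_matrix s Q) c' draw' C' \<and>
      V' \<in> borel_measurable M' \<and> (AE \<omega> in M'. (\<lambda>n. (nongreen (C' n \<omega>) \<bullet> 1) / real (n + 1) powr s) \<longlonglongrightarrow> V' \<omega>) \<and>
      distr M' borel V' \<noteq> distr M borel U"
      by (rule limit_law_depends_on_start[OF ones_eigenvector _ _ _ \<rho> _ U(1) _ c'(1-3)]) (use G U(4) in auto)
    moreover have "nongreen c' \<noteq> nongreen c\<^sub>0" using c'(3) by metis
    ultimately show ?thesis using c'(4) by blast
  qed
  have vii: "martingale M (natural_filtration M C) (\<lambda>n \<omega>. X \<xi> n \<omega> / Pi_prod n (s * l)) \<and>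
      L2_bounded M (\<lambda>n \<omega>. X \<xi> n \<omega> / Pi_prod n (s * l)) \<and>
      (\<exists>V \<in> borel_measurable M.
        (AE \<omega> in M. (\<lambda>n. X \<xi> n \<omega> / real n powr (s * l)) \<longlonglongrightarrow> V \<omega>) \<and>
        converges_in_L2 M (\<lambda>n \<omega>. X \<xi> n \<omega> / real n powr (s * l)) V \<and>
        nondegenerate M V \<and>
        (\<exists>c\<^sub>0' (M' :: (nat \<Rightarrow> real) measure) draw' C' V'.
          urn_process M' (triangular_matrix s Q) c\<^sub>0' draw' C' \<and> c\<^sub>0' $ 1 + c\<^sub>0' $ 2 > 0 \<and>
          nongreen c\<^sub>0' \<noteq> nongreen c\<^sub>0 \<and> V' \<in> borel_measurable M' \<and>
          (AE \<omega> in M'. (\<lambda>n. (nongreen (C' n \<omega>) \<bullet> \<xi>) / real n powr (s * l)) \<longlonglongrightarrow> V' \<omega>) \<and>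
          distr M' borel V' \<noteq> distr M borel V))"
    if l2: "l > 1/2"
  proof -
    interpret Z: L2_martingale M F "\<lambda>n \<omega>. X \<xi> n \<omega> / Pi_prod n (s * l)"
      by (rule martingale_X[OF \<xi> sl])
    obtain B where B: "\<And>n. expectation (\<lambda>\<omega>. (X \<xi> n \<omega> / Pi_prod n (s * l))\<^sup>2) \<le> B"
      using martingale_X_L2_bounded[OF \<xi> l2] by metis
    have bdd: "L2_bounded M (\<lambda>n \<omega>. X \<xi> n \<omega> / Pi_prod n (s * l))"
      using Z.sq B unfolding L2_bounded_def by blast
    have Gl: "Gamma (1 + s * l) > 0" by (rule Gamma_pos[OF sl])
    note \<rho> = Pi_prod_asymptotic[OF sl]
    have g: "1 / Gamma (1 + s * l) \<noteq> 0" using Gl by simp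
    obtain V where V: "V \<in> borel_measurable M" "AE \<omega> in M. (\<lambda>n. X \<xi> n \<omega> / real n powr (s * l)) \<longlonglongrightarrow> V \<omega>"
      "converges_in_L2 M (\<lambda>n \<omega>. X \<xi> n \<omega> / real n powr (s * l)) V"
      "expectation V = 1 / Gamma (1 + s * l) * (nongreen c\<^sub>0 \<bullet> \<xi>)" "nondegenerate M V"
      by (rule normalised_functional_limit[OF \<xi> l2 nz \<rho> g])
    \<comment> \<open>the coordinates of \<open>\<xi>\<close> differ, so an all-white or an all-black start has another initial value\<close>
    have "\<exists>c' :: real^3. probability_vector c' \<and> 0 < nongreen c' \<bullet> 1 \<and> nongreen c' \<bullet> \<xi> \<noteq> nongreen c\<^sub>0 \<bullet> \<xi>"
    proof (cases "\<xi> $ 1 = nongreen c\<^sub>0 \<bullet> \<xi>")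
      case True
      then show ?thesis using ne
        by (intro exI[of _ "vector [0, 1, 0]"]) (auto simp: probability_vector_def sum_3 forall_3 nongreen_inner)
    next
      case False
      then show ?thesis
        by (intro exI[of _ "vector [1, 0, 0]"]) (auto simp: probability_vector_def sum_3 forall_3 nongreen_inner)
    qed
    then obtain c' :: "real^3" where c': "probability_vector c'" "0 < nongreen c' \<bullet> 1" "nongreen c' \<bullet> \<xi> \<noteq> nongreen c\<^sub>0 \<bullet> \<xi>"
      by blast
    have "0 < c' $ 1 + c' $ 2" using c'(2) by (simp add: nongreen_inner)
    moreover have "nongreen c' \<noteq> nongreen c\<^sub>0" using c'(3) by metis
    ultimately show ?thesis
      using Z.mart bdd V limit_law_depends_on_start[OF \<xi> l2 nz \<rho> g V(1,4) c'] by blast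
  qed
  show ?thesis
    unfolding S
    using total content_limit[OF U(2)] U(1,2,3,5,6) direction_limit[OF \<xi> l(2) sl orth(1,2) ne U(2)] v vi U' vii
    by blast
qed

end
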